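(* Let $k$ be fixed, and let $\mathbf{r}_k=(r_{k,1},\dots,r_{k,M})$ be basic estimators built from $\mathcal{D}_k$ only, with $\mathbb{E}|r_{k,m}(\mathbf{X})|^2<\infty$ for all $m=1,\dots,M$, and such that for each $m$ the sets $r_{k,m}^{-1}((t,+\infty))$ decrease to $\emptyset$ as $t\uparrow+\infty$ and the sets $r_{k,m}^{-1}((-\infty,t))$ decrease to $\emptyset$ as $t\downarrow-\infty$. Assume that $\varepsilon_\ell\to 0$ and $\ell\varepsilon_\ell^M\to\infty$ as $\ell\to\infty$. Then $$\mathbb{E}|T_n(\mathbf{r}_k(\mathbf{X}))-T(\mathbf{r}_k(\mathbf{X}))|^2\to 0\quad\text{as }\ell\to\infty,$$ for all distributions of $(\mathbf{X},Y)$ with $\mathbb{E}Y^2<\infty$. Thus $$\limsup_{\ell\to\infty}\mathbb{E}|T_n(\mathbf{r}_k(\mathbf{X}))-r^\star(\mathbf{X})|^2\le\inf_f\mathbb{E}|f(\mathbf{r}_k(\mathbf{X}))-r^\star(\mathbf{X})|^2,$$ where the infimum is over all square integrable functions of $\mathbf{r}_k(\mathbf{X})$ (i.e. all Borel $f:\mathbb{R}^M\to\mathbb{R}$ with $\mathbb{E}|f(\mathbf{r}_k(\mathbf{X}))|^2<\infty$). In particular, $$\limsup_{\ell\to\infty}\mathbb{E}|T_n(\mathbf{r}_k(\mathbf{X}))-r^\star(\mathbf{X})|^2\le\min_{m=1,\dots,M}\mathbb{E}|r_{k,m}(\mathbf{X})-r^\star(\mathbf{X})|^2.$$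
   Context: Let $(\mathbf{X},Y)$ take values in $\mathbb{R}^d\times\mathbb{R}$ with $\mathbb{E}Y^2<\infty$, and let $r^\star(\mathbf{x})=\mathbb{E}[Y\mid\mathbf{X}=\mathbf{x}]$. The training sample $\mathcal{D}_n$ consists of $n$ i.i.d. copies of $(\mathbf{X},Y)$, independent of $(\mathbf{X},Y)$. It is split into its first $k$ elements $\mathcal{D}_k$ and the remaining $\ell=n-k\ge 1$ elements $\mathcal{D}_\ell$, which are renamed $(\mathbf{X}_1,Y_1),\dots,(\mathbf{X}_\ell,Y_\ell)$; in particular $\mathcal{D}_k$ and $\mathcal{D}_\ell$ are independent. Fix $M\ge 1$. The basic estimators (machines) $r_{k,1},\dots,r_{k,M}$ are arbitrary real-valued estimators of $r^\star$ on $\mathbb{R}^d$ (jointly measurable in the query point and the data) constructed from $\mathcal{D}_k$ alone; $\mathbf{r}_k(\mathbf{x})=(r_{k,1}(\mathbf{x}),\dots,r_{k,M}(\mathbf{x}))$. $r_{k,m}^{-1}(A)=\{\mathbf{x}\in\mathbb{R}^d: r_{k,m}(\mathbf{x})\in A\}$. For $\varepsilon_\ell>0$, the combined estimator is $T_n(\mathbf{r}_k(\mathbf{x}))=\sum_{i=1}^\ell W_{n,i}(\mathbf{x})Y_i$, $\mathbf{x}\in\mathbb{R}^d$, with $$W_{n,i}(\mathbf{x})=\frac{\mathbf{1}_{\bigcap_{m=1}^M\{|r_{k,m}(\mathbf{x})-r_{k,m}(\mathbf{X}_i)|\le\varepsilon_\ell\}}}{\sum_{j=1}^\ell\mathbf{1}_{\bigcap_{m=1}^M\{|r_{k,m}(\mathbf{x})-r_{k,m}(\mathbf{X}_j)|\le\varepsilon_\ell\}}},\qquad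 0/0=0.$$ $T(\mathbf{r}_k(\mathbf{X}))=\mathbb{E}[Y\mid\mathbf{r}_k(\mathbf{X})]$, where the conditional expectation is computed with the machines $\mathbf{r}_k$ (i.e. $\mathcal{D}_k$) held fixed: $T(\mathbf{r}_k(\mathbf{X}))=\mathbb{E}[Y\mid\mathbf{r}_k(\mathbf{X}),\mathcal{D}_k]$. Thus $T$ is, given $\mathcal{D}_k$, a function on $\mathbb{R}^M$. Unless conditioning is indicated, $\mathbb{E}$ is the expectation with respect to all random variables, including $\mathbf{X}$ and $\mathcal{D}_n$. *)

theory Defs
  imports "HOL-Probability.Probability"
begin

text \<open>A data set in \<open>\<real>\<^sup>d \<times> \<real>\<close> is a sequence of pairs. Machines built from \<open>k\<close> observations take their
  data from the space \<open>data_space k\<close>, whose elements are undefined outside \<open>{..<k}\<close>.\<close>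

type_synonym 'd dataset = "nat \<Rightarrow> (real^'d) \<times> real"

abbreviation data_space :: "nat \<Rightarrow> ('d::finite) dataset measure" where
  "data_space k \<equiv> PiM {..<k} (\<lambda>_. borel)"

definition first_part :: "nat \<Rightarrow> (nat \<Rightarrow> 'w \<Rightarrow> (real^'d) \<times> real) \<Rightarrow> 'w \<Rightarrow> 'd dataset" where
  "first_part k Z \<omega> = (\<lambda>i\<in>{..<k}. Z i \<omega>)"

text \<open>The observations after the \<open>k\<close>-th, renumbered from 0; for sample size \<open>n = k + l\<close> only the
  indices \<open>i < l\<close> are used.\<close>

definition second_part :: "nat \<Rightarrow> (nat \<Rightarrow> 'w \<Rightarrow> (real^'d) \<times> real) \<Rightarrow> 'w \<Rightarrow> 'd dataset" where
  "second_part k Z \<omega> = (\<lambda>i. Z (k + i) \<omega>)"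

definition agree :: "(real^'d \<Rightarrow> real^'m) \<Rightarrow> real \<Rightarrow> real^'d \<Rightarrow> real^'d \<Rightarrow> bool" where
  "agree \<rho> \<epsilon> x x' \<longleftrightarrow> (\<forall>m. \<bar>\<rho> x $ m - \<rho> x' $ m\<bar> \<le> \<epsilon>)"

text \<open>The convention \<open>0 / 0 = 0\<close> is that of HOL division.\<close>

definition weight ::
  "(real^'d \<Rightarrow> real^'m) \<Rightarrow> real \<Rightarrow> nat \<Rightarrow> 'd dataset \<Rightarrow> nat \<Rightarrow> real^'d \<Rightarrow> real" where
  "weight \<rho> \<epsilon> l D i x =
     of_bool (agree \<rho> \<epsilon> x (fst (D i))) / (\<Sum>j<l. of_bool (agree \<rho> \<epsilon> x (fst (D j))))"

definition combined_estimator ::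
  "(real^'d \<Rightarrow> real^'m) \<Rightarrow> real \<Rightarrow> nat \<Rightarrow> 'd dataset \<Rightarrow> real^'d \<Rightarrow> real" where
  "combined_estimator \<rho> \<epsilon> l D x = (\<Sum>i<l. weight \<rho> \<epsilon> l D i x * snd (D i))"

text \<open>\<open>g\<close> is a version of \<open>v \<mapsto> E[Y | V = v]\<close>, where \<open>V\<close> takes values in the measurable space \<open>N\<close>.\<close>

definition cond_mean_version ::
  "'w measure \<Rightarrow> ('w \<Rightarrow> real) \<Rightarrow> 'v measure \<Rightarrow> ('w \<Rightarrow> 'v) \<Rightarrow> ('v \<Rightarrow> real) \<Rightarrow> bool" where
  "cond_mean_version P Y N V g \<longleftrightarrow>
     g \<in> borel_measurable N \<and>
     (AE \<omega> in P. g (V \<omega>) = real_cond_exp P (vimage_algebra (space P) V N) Y \<omega>)"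

text \<open>\<open>E|U|\<^sup>2\<close> as an extended nonnegative real, so that \<open>mean_square P U < \<infinity>\<close> really expresses
  square integrability (the Bochner integral would be 0 for a non-integrable square).\<close>

definition mean_square :: "'w measure \<Rightarrow> ('w \<Rightarrow> real) \<Rightarrow> ennreal" where
  "mean_square P U = (\<integral>\<^sup>+ \<omega>. ennreal (\<bar>U \<omega>\<bar>\<^sup>2) \<partial>P)"

end

theory Submission
  imports Defs
begin

text \<open>
  Hold the data \<open>D\<close> of the machines fixed. The combined estimator is then window regression of \<open>Y\<close> on
  the feature \<open>U = r D X\<close>, a random vector with \<open>M\<close> components: it averages the responses of those
  sample points whose feature lies in the box of radius \<open>\<epsilon>\<close> around the feature of the query. The first
  claim is the universal mean square consistency of window regression (Devroye and Wagner, Spiegelman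
  and Sacks; a case of Stone's theorem), applied to almost every \<open>D\<close> and integrated over \<open>D\<close> by
  dominated convergence.

  The query and the sample are \<open>l + 1\<close> i.i.d. points, so exchanging the query with a sample point does
  not change their law. This turns the expectations that matter into averages over all points, and
  these averages are bounded for every configuration of points by sorting the points into cells of
  side \<open>\<epsilon>\<close>, since two points of one cell are neighbours. Two such bounds carry the proof:

  \<^item> \<open>sum_weights_at_point_le\<close>: the weights that one point receives when every other point in turn
    is the query add up to at most \<open>2 ^ M\<close>. Hence the weighted mean of a nonnegative function over the
    sample has expectation at most \<open>2 ^ M\<close> times that of the function (\<open>weighted_mean_le\<close>).
  \<^item> \<open>sum_inverse_nbr_count_le\<close>: the sum of \<open>1 / (N + 1)\<close>, with \<open>N\<close> the number of neighbours, over
    the points in a fixed box is at most the number of cells, which is of order \<open>\<epsilon> ^ (- M)\<close>. Since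
    \<open>l * \<epsilon> ^ M\<close> tends to infinity, the expectation of \<open>1 / (N + 1)\<close> at the query tends to \<open>0\<close>.

  For the regression function \<open>g\<close>, weights \<open>W i\<close> and query index \<open>0\<close>, the error of the estimate is the
  sum of the noise \<open>\<Sum>i. W i * (Y i - g (U i))\<close>, the local variation \<open>\<Sum>i. W i * (g (U i) - g (U 0))\<close>
  and a term \<open>- g (U 0)\<close> that is present only if \<open>N = 0\<close>. The cross terms in the second moment of the
  noise vanish because the noise of a point is orthogonal to every bounded function of its feature, and
  the diagonal is small because \<open>\<Sum>i. (W i)\<^sup>2\<close> is at most \<open>2 / (N + 1)\<close>. The local variation
  is small for uniformly continuous \<open>g\<close>, and by the first bound also for every \<open>g\<close> that is close to a
  uniformly continuous function in mean square. The last term is small because \<open>N = 0\<close> is unlikely.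

  The function \<open>T\<close> is given as one conditional mean in terms of \<open>D\<close> and \<open>U\<close> jointly. That \<open>T D\<close> is the
  regression function of \<open>Y\<close> on \<open>U\<close> for almost every \<open>D\<close> holds because the Borel sets have a countable
  intersection-stable generator (\<open>AE_orthogonal_sections\<close>).

  For the other two claims, \<open>T D U\<close> is the orthogonal projection of \<open>rstar X\<close> onto the square integrable
  functions of \<open>D\<close> and \<open>U\<close>. By Pythagoras it is at least as close to \<open>rstar X\<close> as any \<open>f U\<close>, in particular
  as any single machine, and the mean square convergence carries this over to the upper limit.
\<close>

section \<open>Window weights and deterministic counting bounds\<close>

text \<open>Closeness in the sup-norm, spelled out in coordinates because the norm of \<open>real^'m\<close> is the Euclidean one.\<close>

definition near :: "real \<Rightarrow> real^'m \<Rightarrow> real^'m \<Rightarrow> bool" where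
  "near e u v \<longleftrightarrow> (\<forall>m. \<bar>u $ m - v $ m\<bar> \<le> e)"

text \<open>The number of neighbours of point \<open>q\<close> among the other points of \<open>{..l}\<close>. It is taken in the reals, and as
  a function of all \<open>l + 1\<close> points, so that any point can take the role of the query.\<close>

definition nbr_count :: "real \<Rightarrow> nat \<Rightarrow> (nat \<Rightarrow> real^'m) \<Rightarrow> nat \<Rightarrow> real" where
  "nbr_count e l u q = (\<Sum>j\<in>{..l} - {q}. of_bool (near e (u q) (u j)))"

definition window_weight :: "real \<Rightarrow> nat \<Rightarrow> (nat \<Rightarrow> real^'m) \<Rightarrow> nat \<Rightarrow> nat \<Rightarrow> real" where
  "window_weight e l u q i = of_bool (near e (u q) (u i)) / nbr_count e l u q"

lemma near_sym: "near e u v \<longleftrightarrow> near e v u"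
  by (simp add: near_def abs_minus_commute)

lemma nbr_count_eq_card: "nbr_count e l u q = real (card {j \<in> {..l} - {q}. near e (u q) (u j)})"
  unfolding nbr_count_def by (simp add: sum.If_cases of_bool_def Int_def)

lemma nbr_count_nonneg: "0 \<le> nbr_count e l u q"
  by (simp add: nbr_count_eq_card)

text \<open>Each nonempty fibre of \<open>c\<close> contributes exactly \<open>1\<close>. This is the counting principle behind both cell
  bounds.\<close>

lemma sum_inverse_fibre_card:
  fixes c :: "'i \<Rightarrow> 'c"
  assumes "finite I"
  shows "(\<Sum>i\<in>I. 1 / real (card {j\<in>I. c j = c i})) = real (card (c ` I))"
proof -
  have "(\<Sum>i\<in>I. 1 / real (card {j\<in>I. c j = c i}))
      = (\<Sum>y\<in>c ` I. \<Sum>i\<in>{i\<in>I. c i = y}. 1 / real (card {j\<in>I. c j = c i}))"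
    using assms by (rule sum.image_gen)
  also have "\<dots> = (\<Sum>y\<in>c ` I. 1)"
  proof (rule sum.cong[OF refl])
    fix y assume "y \<in> c ` I"
    then have ne: "{i\<in>I. c i = y} \<noteq> {}" by auto
    have "(\<Sum>i\<in>{i\<in>I. c i = y}. 1 / real (card {j\<in>I. c j = c i}))
        = (\<Sum>i\<in>{i\<in>I. c i = y}. 1 / real (card {j\<in>I. c j = y}))"
      by (rule sum.cong) auto
    also have "\<dots> = 1"
      using ne assms by (simp add: card_eq_0_iff)
    finally show "(\<Sum>i\<in>{i\<in>I. c i = y}. 1 / real (card {j\<in>I. c j = c i})) = 1" .
  qed
  finally show ?thesis by simp
qed

text \<open>A point \<open>i\<close> gives weight to \<open>q\<close> only if it lies in the box of radius \<open>e\<close> around \<open>q\<close>. The \<open>2 ^ M\<close> orthants at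
  \<open>q\<close> cut this box into cells of side \<open>e\<close>, and all points of the cell of \<open>i\<close> are neighbours of \<open>i\<close>. The
  weight \<open>1 / N\<close> given by \<open>i\<close> is therefore at most the inverse of the number of points in its cell.\<close>

lemma sum_weights_at_point_le:
  fixes u :: "nat \<Rightarrow> real^'m::finite"
  assumes "q \<le> l"
  shows "(\<Sum>i\<in>{..l} - {q}. window_weight e l u i q) \<le> 2 ^ CARD('m)"
proof -
  define I where "I = {i \<in> {..l} - {q}. near e (u q) (u i)}"
  define c where "c i m \<longleftrightarrow> u i $ m \<ge> u q $ m" for i m
  have fin: "finite I" by (simp add: I_def)
  have le: "real (card {j\<in>I. c j = c i}) \<le> nbr_count e l u i" if "i \<in> I" for i
  proof -
    \<comment> \<open>The point \<open>i\<close> is not counted among its own neighbours, but its neighbour \<open>q\<close>, an index outside \<open>I\<close>, makes up for that.\<close>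
    have "card {j\<in>I. c j = c i} = card (insert q ({j\<in>I. c j = c i} - {i}))"
    proof -
      have "q \<notin> {j\<in>I. c j = c i} - {i}" "i \<in> {j\<in>I. c j = c i}" using that by (auto simp: I_def)
      then show ?thesis using fin card.remove[of "{j\<in>I. c j = c i}" i] by simp
    qed
    also have "\<dots> \<le> card {j \<in> {..l} - {i}. near e (u i) (u j)}"
    proof (rule card_mono, simp, safe)
      fix j assume j: "j \<in> I" "c j = c i"
      show "near e (u i) (u j)"
        unfolding near_def
      proof
        fix m
        have "\<bar>u q $ m - u i $ m\<bar> \<le> e" "\<bar>u q $ m - u j $ m\<bar> \<le> e"
          using that j by (auto simp: I_def near_def)
        moreover have "u i $ m \<ge> u q $ m \<longleftrightarrow> u j $ m \<ge> u q $ m"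
          using fun_cong[OF j(2), of m] by (simp add: c_def)
        ultimately show "\<bar>u i $ m - u j $ m\<bar> \<le> e" by linarith
      qed
    qed (use that assms near_sym in \<open>auto simp: I_def\<close>)
    finally show ?thesis by (simp add: nbr_count_eq_card)
  qed
  have pos: "0 < card {j\<in>I. c j = c i}" if "i \<in> I" for i
    using that fin by (auto simp: card_gt_0_iff)
  have "(\<Sum>i\<in>{..l} - {q}. window_weight e l u i q) = (\<Sum>i\<in>I. 1 / nbr_count e l u i)"
    unfolding window_weight_def I_def by (rule sum.mono_neutral_cong_right) (auto simp: near_sym)
  also have "\<dots> \<le> (\<Sum>i\<in>I. 1 / real (card {j\<in>I. c j = c i}))"
    using le pos by (intro sum_mono divide_left_mono mult_pos_pos) (force intro: less_le_trans)+
  also have "\<dots> = real (card (c ` I))"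
    by (rule sum_inverse_fibre_card[OF fin])
  also have "\<dots> \<le> real (card (UNIV :: ('m \<Rightarrow> bool) set))"
    by (intro of_nat_mono card_mono) auto
  also have "\<dots> = 2 ^ CARD('m)" by (simp add: card_fun)
  finally show ?thesis .
qed

text \<open>The cells are now those of the grid of mesh \<open>e\<close>, and \<open>N + 1\<close> counts a point together with its neighbours,
  hence at least all points of its cell.\<close>

lemma sum_inverse_nbr_count_le:
  fixes u :: "nat \<Rightarrow> real^'m::finite"
  assumes e: "0 < e" "e \<le> 1" and R: "0 \<le> R"
  shows "(\<Sum>i\<le>l. of_bool (near R 0 (u i)) / (nbr_count e l u i + 1)) \<le> ((2 * R + 2) / e) ^ CARD('m)"
proof -
  define I where "I = {i \<in> {..l}. near R 0 (u i)}"
  define c where "c i m = \<lfloor>u i $ m / e\<rfloor>" for i m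
  have fin: "finite I" by (simp add: I_def)
  have le: "real (card {j\<in>I. c j = c i}) \<le> nbr_count e l u i + 1" if "i \<in> I" for i
  proof -
    have "card {j\<in>I. c j = c i} \<le> card (insert i {j \<in> {..l} - {i}. near e (u i) (u j)})"
    proof (rule card_mono, simp, safe)
      fix j assume j: "j \<in> I" "c j = c i"
      show "near e (u i) (u j)"
        unfolding near_def
      proof
        fix m
        have "\<lfloor>u i $ m / e\<rfloor> = \<lfloor>u j $ m / e\<rfloor>"
          using fun_cong[OF j(2), of m] by (simp add: c_def)
        then have "\<bar>u i $ m / e - u j $ m / e\<bar> \<le> 1" by linarith
        then have "\<bar>u i $ m - u j $ m\<bar> / e \<le> 1" using e by (simp add: diff_divide_distrib[symmetric])
        then show "\<bar>u i $ m - u j $ m\<bar> \<le> e" using e by simp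
      qed
    qed (auto simp: I_def)
    also have "\<dots> = Suc (card {j \<in> {..l} - {i}. near e (u i) (u j)})"
      by (subst card_insert_disjoint) auto
    finally show ?thesis by (simp add: nbr_count_eq_card)
  qed
  have pos: "0 < card {j\<in>I. c j = c i}" if "i \<in> I" for i
    using that fin by (auto simp: card_gt_0_iff)
  have "(\<Sum>i\<le>l. of_bool (near R 0 (u i)) / (nbr_count e l u i + 1)) = (\<Sum>i\<in>I. 1 / (nbr_count e l u i + 1))"
    unfolding I_def by (rule sum.mono_neutral_cong_right) auto
  also have "\<dots> \<le> (\<Sum>i\<in>I. 1 / real (card {j\<in>I. c j = c i}))"
    using le pos by (intro sum_mono divide_left_mono mult_pos_pos) (force intro: less_le_trans)+
  also have "\<dots> = real (card (c ` I))"
    by (rule sum_inverse_fibre_card[OF fin])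
  also have "\<dots> \<le> real (card (UNIV \<rightarrow>\<^sub>E {\<lfloor>- R / e\<rfloor>..\<lfloor>R / e\<rfloor>} :: ('m \<Rightarrow> int) set))"
  proof (intro of_nat_mono card_mono)
    show "c ` I \<subseteq> UNIV \<rightarrow>\<^sub>E {\<lfloor>- R / e\<rfloor>..\<lfloor>R / e\<rfloor>}"
    proof safe
      fix i m assume "i \<in> I"
      then have "- R \<le> u i $ m" "u i $ m \<le> R" by (auto simp: I_def near_def abs_le_iff minus_le_iff)
      then show "c i m \<in> {\<lfloor>- R / e\<rfloor>..\<lfloor>R / e\<rfloor>}"
        unfolding c_def using e divide_right_mono[of "- R" "u i $ m" e]
        by (auto intro!: floor_mono divide_right_mono)
    qed auto
  qed (auto intro: finite_PiE)
  also have "\<dots> = real (nat (\<lfloor>R / e\<rfloor> - \<lfloor>- R / e\<rfloor> + 1)) ^ CARD('m)"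
    by (subst card_PiE) auto
  also have "\<dots> \<le> ((2 * R + 2) / e) ^ CARD('m)"
  proof (rule power_mono)
    have "real_of_int (\<lfloor>R / e\<rfloor> - \<lfloor>- R / e\<rfloor> + 1) \<le> 2 * (R / e) + 2" by linarith
    also have "\<dots> \<le> (2 * R + 2) / e" using e by (simp add: field_simps)
    finally have "real_of_int (\<lfloor>R / e\<rfloor> - \<lfloor>- R / e\<rfloor> + 1) \<le> (2 * R + 2) / e" .
    moreover have "0 \<le> (2 * R + 2) / e" using e R by simp
    ultimately show "real (nat (\<lfloor>R / e\<rfloor> - \<lfloor>- R / e\<rfloor> + 1)) \<le> (2 * R + 2) / e" by (cases "0 \<le> \<lfloor>R / e\<rfloor> - \<lfloor>- R / e\<rfloor> + 1") auto
  qed auto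
  finally show ?thesis .
qed

lemma borel_measurable_component:
  fixes f :: "'a \<Rightarrow> real^'m::finite"
  assumes "f \<in> borel_measurable M"
  shows "(\<lambda>x. f x $ m) \<in> borel_measurable M"
  by (rule measurable_compose[OF assms]) (intro borel_measurable_continuous_onI continuous_intros)

lemma near_measurable [measurable]:
  fixes f h :: "'a \<Rightarrow> real^'m::finite"
  assumes [measurable]: "f \<in> borel_measurable M" "h \<in> borel_measurable M"
  shows "Measurable.pred M (\<lambda>x. near e (f x) (h x))"
proof -
  note [measurable] = borel_measurable_component
  show ?thesis unfolding near_def by measurable
qed

lemma nbr_count_measurable [measurable]:
  fixes u :: "'a \<Rightarrow> nat \<Rightarrow> real^'m::finite"
  assumes [measurable]: "\<And>i. (\<lambda>x. u x i) \<in> borel_measurable M"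
  shows "(\<lambda>x. nbr_count e l (u x) q) \<in> borel_measurable M"
  unfolding nbr_count_def by measurable

lemma window_weight_measurable [measurable]:
  fixes u :: "'a \<Rightarrow> nat \<Rightarrow> real^'m::finite"
  assumes [measurable]: "\<And>i. (\<lambda>x. u x i) \<in> borel_measurable M"
  shows "(\<lambda>x. window_weight e l (u x) q i) \<in> borel_measurable M"
  unfolding window_weight_def by measurable

lemma window_weight_nonneg: "0 \<le> window_weight e l u q i"
  by (simp add: window_weight_def nbr_count_nonneg)

lemma sum_window_weight: "(\<Sum>i\<in>{..l} - {q}. window_weight e l u q i) = of_bool (nbr_count e l u q \<noteq> 0)"
  unfolding window_weight_def sum_divide_distrib[symmetric] nbr_count_def[symmetric] by simp

lemma window_weight_le_1: "i \<le> l \<Longrightarrow> i \<noteq> q \<Longrightarrow> window_weight e l u q i \<le> 1"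
proof -
  assume "i \<le> l" "i \<noteq> q"
  then have "window_weight e l u q i \<le> (\<Sum>i\<in>{..l} - {q}. window_weight e l u q i)"
    by (intro member_le_sum) (auto simp: window_weight_nonneg)
  then show ?thesis unfolding sum_window_weight by (simp add: of_bool_def split: if_splits)
qed

text \<open>All nonzero weights equal \<open>1 / N\<close> and there are \<open>N\<close> of them, so the sum is \<open>1 / N\<close> unless \<open>N = 0\<close>. The
  bound is stated with \<open>N + 1\<close> in order to cover both cases.\<close>

lemma sum_window_weight_square_le: "(\<Sum>i\<in>{..l} - {q}. (window_weight e l u q i)\<^sup>2) \<le> 2 / (nbr_count e l u q + 1)"
proof (cases "nbr_count e l u q = 0")
  case True
  then show ?thesis by (simp add: window_weight_def)
next
  case False
  obtain n where "nbr_count e l u q = real n" using nbr_count_eq_card by blast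
  with False have N: "nbr_count e l u q \<ge> 1" by simp
  have "(\<Sum>i\<in>{..l} - {q}. (window_weight e l u q i)\<^sup>2)
      = (\<Sum>i\<in>{..l} - {q}. window_weight e l u q i / nbr_count e l u q)"
    by (rule sum.cong) (auto simp: window_weight_def power2_eq_square)
  also have "\<dots> = 1 / nbr_count e l u q"
    using False by (simp add: sum_divide_distrib[symmetric] sum_window_weight)
  also have "\<dots> \<le> 2 / (nbr_count e l u q + 1)"
    using N by (simp add: field_simps)
  finally show ?thesis .
qed

text \<open>Relabelling the points by a permutation of the index set relabels the counts; this is what makes the
  exchange of the query with a sample point possible.\<close>

lemma nbr_count_permute:
  assumes "\<pi> permutes {..l}"
  shows "nbr_count e l (\<lambda>i. u (\<pi> i)) q = nbr_count e l u (\<pi> q)"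
proof -
  have "bij_betw \<pi> ({..l} - {q}) ({..l} - {\<pi> q})"
    using permutes_imp_bij[OF assms] permutes_inj[OF assms]
    by (auto simp: bij_betw_def inj_on_def image_set_diff dest: injD) 
  then show ?thesis
    unfolding nbr_count_def by (rule sum.reindex_bij_betw)
qed

lemma window_weight_permute:
  assumes "\<pi> permutes {..l}"
  shows "window_weight e l (\<lambda>i. u (\<pi> i)) q i = window_weight e l u (\<pi> q) (\<pi> i)"
  by (simp add: window_weight_def nbr_count_permute[OF assms])

text \<open>Jensen's inequality for the square; the weights may add up to less than \<open>1\<close>, as happens when no point
  is near the query.\<close>

lemma weighted_square_le:
  fixes w a :: "'i \<Rightarrow> real"
  assumes "finite I" "\<And>i. i \<in> I \<Longrightarrow> 0 \<le> w i" "sum w I \<le> 1"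
  shows "(\<Sum>i\<in>I. w i * a i)\<^sup>2 \<le> (\<Sum>i\<in>I. w i * (a i)\<^sup>2)"
proof -
  have "(\<Sum>i\<in>I. w i * a i)\<^sup>2 = (\<Sum>i\<in>I. sqrt (w i) * (sqrt (w i) * a i))\<^sup>2"
    using assms(2) by (simp flip: mult.assoc)
  also have "\<dots> \<le> (\<Sum>i\<in>I. (sqrt (w i))\<^sup>2) * (\<Sum>i\<in>I. (sqrt (w i) * a i)\<^sup>2)"
    by (rule Cauchy_Schwarz_ineq_sum)
  also have "\<dots> = sum w I * (\<Sum>i\<in>I. w i * (a i)\<^sup>2)"
    using assms(2) by (simp add: power_mult_distrib)
  also have "\<dots> \<le> 1 * (\<Sum>i\<in>I. w i * (a i)\<^sup>2)"
    using assms by (intro mult_right_mono sum_nonneg) auto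
  finally show ?thesis by simp
qed

lemma near_imp_dist_le:
  fixes u v :: "real^'m::finite" and e :: real
  assumes "near e u v"
  shows "dist u v \<le> CARD('m) * e"
proof -
  have "dist u v \<le> (\<Sum>m\<in>UNIV. \<bar>(u - v) $ m\<bar>)"
    unfolding dist_norm by (rule norm_le_l1_cart)
  also have "\<dots> \<le> (\<Sum>m\<in>(UNIV::'m set). e)"
    using assms by (intro sum_mono) (simp add: near_def)
  finally show ?thesis by simp
qed

text \<open>Index \<open>0\<close> is the query; its own response \<open>y 0\<close> does not enter.\<close>

definition window_mean :: "real \<Rightarrow> nat \<Rightarrow> (nat \<Rightarrow> real^'m) \<Rightarrow> (nat \<Rightarrow> real) \<Rightarrow> real" where
  "window_mean e l u y = (\<Sum>i\<in>{..l} - {0}. window_weight e l u 0 i * y i)"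

lemma window_mean_measurable [measurable]:
  fixes u :: "'a \<Rightarrow> nat \<Rightarrow> real^'m::finite"
  assumes [measurable]: "\<And>i. (\<lambda>x. u x i) \<in> borel_measurable M" "\<And>i. (\<lambda>x. y x i) \<in> borel_measurable M"
  shows "(\<lambda>x. window_mean e l (u x) (y x)) \<in> borel_measurable M"
  unfolding window_mean_def by measurable

section \<open>Uniformly continuous functions are dense in mean square\<close>

text \<open>The class is closed under linear combinations and mean square limits. It contains the indicators of
  closed sets, hence of all Borel sets, and so ends up as all of the square integrable functions.\<close>

definition uc_approximable :: "'a::metric_space measure \<Rightarrow> ('a \<Rightarrow> real) \<Rightarrow> bool" where
  "uc_approximable N f \<longleftrightarrow> f \<in> borel_measurable borel \<and>
     (\<forall>\<delta>>0. \<exists>h. uniformly_continuous_on UNIV h \<and> (\<integral>\<^sup>+x. ennreal ((f x - h x)\<^sup>2) \<partial>N) < ennreal \<delta>)"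

lemma L2_triangle:
  fixes f g h :: "'a \<Rightarrow> real"
  assumes [measurable]: "f \<in> borel_measurable N" "g \<in> borel_measurable N" "h \<in> borel_measurable N"
  shows "(\<integral>\<^sup>+x. ennreal ((f x - h x)\<^sup>2) \<partial>N)
      \<le> 2 * (\<integral>\<^sup>+x. ennreal ((f x - g x)\<^sup>2) \<partial>N) + 2 * (\<integral>\<^sup>+x. ennreal ((g x - h x)\<^sup>2) \<partial>N)"
proof -
  have "(f x - h x)\<^sup>2 \<le> 2 * (f x - g x)\<^sup>2 + 2 * (g x - h x)\<^sup>2" for x
    using sum_squares_bound[of "f x - g x" "g x - h x"] by (simp add: power2_eq_square algebra_simps)
  then have "ennreal ((f x - h x)\<^sup>2) \<le> 2 * ennreal ((f x - g x)\<^sup>2) + 2 * ennreal ((g x - h x)\<^sup>2)" for x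
    by (simp flip: ennreal_plus ennreal_mult' ennreal_numeral add: ennreal_leI)
  then have "(\<integral>\<^sup>+x. ennreal ((f x - h x)\<^sup>2) \<partial>N)
      \<le> (\<integral>\<^sup>+x. 2 * ennreal ((f x - g x)\<^sup>2) + 2 * ennreal ((g x - h x)\<^sup>2) \<partial>N)"
    by (intro nn_integral_mono)
  also have "\<dots> = 2 * (\<integral>\<^sup>+x. ennreal ((f x - g x)\<^sup>2) \<partial>N) + 2 * (\<integral>\<^sup>+x. ennreal ((g x - h x)\<^sup>2) \<partial>N)"
    by (simp add: nn_integral_add nn_integral_cmult)
  finally show ?thesis .
qed

lemma uc_measurable: "uniformly_continuous_on UNIV h \<Longrightarrow> h \<in> borel_measurable borel"
  for h :: "'a::metric_space \<Rightarrow> real"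
  by (intro borel_measurable_continuous_onI uniformly_continuous_imp_continuous)

lemma uc_approximable_limit:
  assumes N: "sets N = sets borel" and f: "f \<in> borel_measurable borel"
    and F: "\<And>n. uc_approximable N (F n)"
    and lim: "(\<lambda>n. \<integral>\<^sup>+x. ennreal ((f x - F n x)\<^sup>2) \<partial>N) \<longlonglongrightarrow> 0"
  shows "uc_approximable N f"
  unfolding uc_approximable_def
proof (intro conjI allI impI f)
  fix \<delta> :: real assume \<delta>: "\<delta> > 0"
  then have "\<forall>\<^sub>F n in sequentially. (\<integral>\<^sup>+x. ennreal ((f x - F n x)\<^sup>2) \<partial>N) < ennreal (\<delta> / 8)"
    by (intro order_tendstoD(2)[OF lim]) simp
  then obtain n where n: "(\<integral>\<^sup>+x. ennreal ((f x - F n x)\<^sup>2) \<partial>N) < ennreal (\<delta> / 8)"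
    by (auto simp: eventually_sequentially)
  obtain h where h: "uniformly_continuous_on UNIV h"
      "(\<integral>\<^sup>+x. ennreal ((F n x - h x)\<^sup>2) \<partial>N) < ennreal (\<delta> / 8)"
    using F[of n] \<delta> unfolding uc_approximable_def by (meson divide_pos_pos zero_less_numeral)
  have meas: "f \<in> borel_measurable N" "F n \<in> borel_measurable N" "h \<in> borel_measurable N"
    using f F[of n] uc_measurable[OF h(1)] N
    by (auto simp: uc_approximable_def cong: measurable_cong_sets)
  have "(\<integral>\<^sup>+x. ennreal ((f x - h x)\<^sup>2) \<partial>N)
      \<le> 2 * (\<integral>\<^sup>+x. ennreal ((f x - F n x)\<^sup>2) \<partial>N) + 2 * (\<integral>\<^sup>+x. ennreal ((F n x - h x)\<^sup>2) \<partial>N)"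
    by (rule L2_triangle[OF meas])
  also have "\<dots> \<le> 2 * ennreal (\<delta> / 8) + 2 * ennreal (\<delta> / 8)"
    using n h(2) by (intro add_mono mult_left_mono less_imp_le) auto
  also have "\<dots> < ennreal \<delta>"
    using \<delta> by (simp flip: ennreal_plus ennreal_mult' ennreal_numeral add: ennreal_less_iff)
  finally show "\<exists>h. uniformly_continuous_on UNIV h \<and> (\<integral>\<^sup>+x. ennreal ((f x - h x)\<^sup>2) \<partial>N) < ennreal \<delta>"
    using h(1) by blast
qed

lemma uc_approximable_self:
  "uniformly_continuous_on UNIV h \<Longrightarrow> uc_approximable N h"
  unfolding uc_approximable_def by (auto intro!: uc_measurable exI[of _ h])

lemma uc_approximable_const: "uc_approximable N (\<lambda>_. c)"
  by (intro uc_approximable_self) (rule uniformly_continuous_on_const)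

lemma uc_approximable_empty: "uc_approximable N (indicator {})"
  using uc_approximable_const[of N 0] by (simp add: indicator_def[abs_def])

lemma uc_approximable_add:
  assumes N: "sets N = sets borel" and f: "uc_approximable N f" and g: "uc_approximable N g"
  shows "uc_approximable N (\<lambda>x. f x + g x)"
  unfolding uc_approximable_def
proof (intro conjI allI impI)
  show "(\<lambda>x. f x + g x) \<in> borel_measurable borel"
    using f g by (auto simp: uc_approximable_def)
  fix \<delta> :: real assume \<delta>: "\<delta> > 0"
  obtain h where h: "uniformly_continuous_on UNIV h"
      "(\<integral>\<^sup>+x. ennreal ((f x - h x)\<^sup>2) \<partial>N) < ennreal (\<delta> / 8)"
    using f \<delta> unfolding uc_approximable_def by (meson divide_pos_pos zero_less_numeral)
  obtain k where k: "uniformly_continuous_on UNIV k"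
      "(\<integral>\<^sup>+x. ennreal ((g x - k x)\<^sup>2) \<partial>N) < ennreal (\<delta> / 8)"
    using g \<delta> unfolding uc_approximable_def by (meson divide_pos_pos zero_less_numeral)
  have [measurable]: "f \<in> borel_measurable N" "g \<in> borel_measurable N" "h \<in> borel_measurable N" "k \<in> borel_measurable N"
    using f g uc_measurable[OF h(1)] uc_measurable[OF k(1)] N
    by (auto simp: uc_approximable_def cong: measurable_cong_sets)
  have "(\<integral>\<^sup>+x. ennreal ((f x + g x - (h x + k x))\<^sup>2) \<partial>N)
      \<le> 2 * (\<integral>\<^sup>+x. ennreal ((f x + g x - (h x + g x))\<^sup>2) \<partial>N) + 2 * (\<integral>\<^sup>+x. ennreal ((h x + g x - (h x + k x))\<^sup>2) \<partial>N)"
    by (rule L2_triangle) auto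
  also have "\<dots> = 2 * (\<integral>\<^sup>+x. ennreal ((f x - h x)\<^sup>2) \<partial>N) + 2 * (\<integral>\<^sup>+x. ennreal ((g x - k x)\<^sup>2) \<partial>N)"
    by (simp add: algebra_simps)
  also have "\<dots> \<le> 2 * ennreal (\<delta> / 8) + 2 * ennreal (\<delta> / 8)"
    using k(2) h(2) by (intro add_mono mult_left_mono less_imp_le) auto
  also have "\<dots> < ennreal \<delta>"
    using \<delta> by (simp flip: ennreal_plus ennreal_mult' ennreal_numeral add: ennreal_less_iff)
  finally show "\<exists>h. uniformly_continuous_on UNIV h \<and> (\<integral>\<^sup>+x. ennreal ((f x + g x - h x)\<^sup>2) \<partial>N) < ennreal \<delta>"
    using uniformly_continuous_on_add[OF h(1) k(1)] by blast
qed

lemma uc_approximable_cmult: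
  assumes N: "sets N = sets borel" and f: "uc_approximable N f"
  shows "uc_approximable N (\<lambda>x. c * f x)"
proof (cases "c = 0")
  case True
  then show ?thesis by (simp add: uc_approximable_const)
next
  case False
  show ?thesis
    unfolding uc_approximable_def
  proof (intro conjI allI impI)
    show "(\<lambda>x. c * f x) \<in> borel_measurable borel"
      using f by (auto simp: uc_approximable_def)
    fix \<delta> :: real assume \<delta>: "\<delta> > 0"
    obtain h where h: "uniformly_continuous_on UNIV h"
        "(\<integral>\<^sup>+x. ennreal ((f x - h x)\<^sup>2) \<partial>N) < ennreal (\<delta> / c\<^sup>2)"
      using f \<delta> False unfolding uc_approximable_def by (meson divide_pos_pos zero_less_power2)
    have [measurable]: "f \<in> borel_measurable N" "h \<in> borel_measurable N"
      using f uc_measurable[OF h(1)] N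
      by (auto simp: uc_approximable_def cong: measurable_cong_sets)
    have "(\<integral>\<^sup>+x. ennreal ((c * f x - c * h x)\<^sup>2) \<partial>N) = (\<integral>\<^sup>+x. ennreal (c\<^sup>2) * ennreal ((f x - h x)\<^sup>2) \<partial>N)"
      by (simp flip: ennreal_mult' add: power_mult_distrib[symmetric] algebra_simps)
    also have "\<dots> = ennreal (c\<^sup>2) * (\<integral>\<^sup>+x. ennreal ((f x - h x)\<^sup>2) \<partial>N)"
      by (intro nn_integral_cmult) auto
    also have "\<dots> < ennreal (c\<^sup>2) * ennreal (\<delta> / c\<^sup>2)"
      using h(2) False by (intro ennreal_mult_strict_left_mono) auto
    also have "\<dots> = ennreal \<delta>" using False \<delta> by (simp flip: ennreal_mult')
    finally show "\<exists>h. uniformly_continuous_on UNIV h \<and> (\<integral>\<^sup>+x. ennreal ((c * f x - h x)\<^sup>2) \<partial>N) < ennreal \<delta>"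
      using bounded_linear.uniformly_continuous_on[OF bounded_linear_mult_right h(1)] by blast
  qed
qed

text \<open>The indicator of \<open>F\<close> is the pointwise limit of the Lipschitz functions \<open>x \<mapsto> max 0 (1 - n * infdist x F)\<close>.\<close>

lemma uc_approximable_closed:
  fixes F :: "'a::metric_space set"
  assumes N: "sets N = sets borel" "finite_measure N" and F: "closed F"
  shows "uc_approximable N (indicator F)"
proof (cases "F = {}")
  case True
  then show ?thesis by (simp add: uc_approximable_empty uc_approximable_const)
next
  case False
  interpret finite_measure N by fact
  define h where "h n x = max 0 (1 - real n * infdist x F)" for n x
  have uc: "uniformly_continuous_on UNIV (h n)" for n
  proof (rule lipschitz_on_uniformly_continuous[where L="real n"], rule lipschitz_onI)
    fix x y
    have "\<bar>infdist x F - infdist y F\<bar> \<le> dist x y"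
      using infdist_triangle_abs .
    then have "\<bar>real n * infdist x F - real n * infdist y F\<bar> \<le> real n * dist x y"
      by (metis abs_mult abs_of_nat mult_left_mono of_nat_0_le_iff right_diff_distrib)
    then show "dist (h n x) (h n y) \<le> real n * dist x y"
      by (auto simp: h_def dist_real_def)
  qed auto
  have [measurable]: "indicator F \<in> borel_measurable borel"
    using F by (auto intro: borel_closed)
  then have [measurable]: "(indicator F :: 'a \<Rightarrow> real) \<in> borel_measurable N" "h n \<in> borel_measurable N" for n
    using uc_measurable[OF uc] N by (auto cong: measurable_cong_sets)
  have h_lim: "(\<lambda>n. h n x) \<longlonglongrightarrow> indicator F x" for x
  proof (cases "x \<in> F")
    case True then show ?thesis by (simp add: h_def)
  next
    case xF: False
    then have pos: "infdist x F > 0"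
      using F False in_closed_iff_infdist_zero[of F x] infdist_nonneg[of x F] by force
    have "\<forall>\<^sub>F n in sequentially. h n x = 0"
    proof -
      obtain n0 where "1 / infdist x F < real n0" using reals_Archimedean2 by blast
      then have "1 \<le> real n * infdist x F" if "n \<ge> n0" for n
        using that pos by (simp add: divide_simps) (smt (verit) mult_right_mono of_nat_mono)
      then show ?thesis by (auto simp: eventually_sequentially h_def intro!: exI[of _ n0])
    qed
    then show ?thesis using xF by (simp add: tendsto_eventually)
  qed
  show ?thesis
  proof (rule uc_approximable_limit[where F=h])
    have "(\<lambda>n. \<integral>\<^sup>+x. ennreal ((indicator F x - h n x)\<^sup>2) \<partial>N) \<longlonglongrightarrow> (\<integral>\<^sup>+x. 0 \<partial>N)"
    proof (rule nn_integral_dominated_convergence[where w="\<lambda>_. 1"])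
      show "AE x in N. ennreal ((indicator F x - h n x)\<^sup>2) \<le> 1" for n
      proof (rule AE_I2)
        fix x
        have "0 \<le> h n x" "h n x \<le> 1" using infdist_nonneg[of x F] by (auto simp: h_def)
        then have "\<bar>indicator F x - h n x\<bar> \<le> 1" by (auto simp: indicator_def)
        then have "(indicator F x - h n x)\<^sup>2 \<le> 1" by (simp add: abs_square_le_1)
        then show "ennreal ((indicator F x - h n x)\<^sup>2) \<le> 1" by simp
      qed
      show "AE x in N. (\<lambda>n. ennreal ((indicator F x - h n x)\<^sup>2)) \<longlonglongrightarrow> 0"
      proof (rule AE_I2)
        fix x
        have "(\<lambda>n. (indicator F x - h n x)\<^sup>2) \<longlonglongrightarrow> (indicator F x - indicator F x)\<^sup>2"
          by (intro tendsto_intros h_lim)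
        then show "(\<lambda>n. ennreal ((indicator F x - h n x)\<^sup>2)) \<longlonglongrightarrow> 0"
          using tendsto_ennrealI by fastforce
      qed
    qed (auto simp: ennreal_mult_less_top emeasure_finite less_top[symmetric])
    then show "(\<lambda>n. \<integral>\<^sup>+x. ennreal ((indicator F x - h n x)\<^sup>2) \<partial>N) \<longlonglongrightarrow> 0" by simp
  qed (use N uc in \<open>auto intro: uc_approximable_self\<close>)
qed

text \<open>The closed sets form an intersection-stable generator of the Borel sets, and the closure properties
  of the class make the sets with approximable indicator a Dynkin system.\<close>

lemma uc_approximable_indicator:
  fixes A :: "'a::metric_space set"
  assumes N: "sets N = sets borel" "finite_measure N" and A: "A \<in> sets borel"
  shows "uc_approximable N (indicator A)"
proof -
  interpret finite_measure N by fact
  have S: "Int_stable (Collect closed :: 'a set set)" by (auto simp: Int_stable_def)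
  have "A \<in> sigma_sets UNIV (Collect closed)"
    using A by (simp add: borel_eq_closed)
  have "Collect closed \<subseteq> Pow (UNIV :: 'a set)" by simp
  from S this \<open>A \<in> sigma_sets UNIV (Collect closed)\<close> show ?thesis
  proof (induction rule: sigma_sets_induct_disjoint)
    case (basic A)
    then show ?case using N by (auto intro: uc_approximable_closed)
  next
    case empty
    then show ?case by (simp add: uc_approximable_empty uc_approximable_const)
  next
    case (compl A)
    have "uc_approximable N (\<lambda>x. 1 + (- 1) * indicator A x)"
      using compl(2) N by (intro uc_approximable_add uc_approximable_cmult uc_approximable_const)
    also have "(\<lambda>x. 1 + (- 1) * indicator A x :: real) = indicator (UNIV - A)"
      by (auto simp: indicator_def)
    finally show ?case .
  next
    case (union A)
    have Ab: "A i \<in> sets borel" for i using union(2) by (auto simp: borel_eq_closed)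
    have part: "uc_approximable N (indicator (\<Union>i<n. A i))" for n
    proof (induction n)
      case 0 then show ?case by (simp add: uc_approximable_empty uc_approximable_const)
    next
      case (Suc n)
      have "indicator (\<Union>i<Suc n. A i) = (\<lambda>x. indicator (\<Union>i<n. A i) x + indicator (A n) x :: real)"
      proof
        fix x
        have "x \<notin> A i" if "x \<in> A n" "i < n" for i
          using union(1) that unfolding disjoint_family_on_def by (metis disjoint_iff iso_tuple_UNIV_I less_irrefl)
        then show "indicator (\<Union>i<Suc n. A i) x = (indicator (\<Union>i<n. A i) x + indicator (A n) x :: real)"
          by (cases "x \<in> A n") (auto simp: indicator_def less_Suc_eq)
      qed
      then show ?case using uc_approximable_add[OF N(1) Suc union(3)] by simp
    qed
    have [measurable]: "(indicator (\<Union>i<n. A i) :: 'a \<Rightarrow> real) \<in> borel_measurable N"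
      "(indicator (\<Union>i. A i) :: 'a \<Rightarrow> real) \<in> borel_measurable N" for n
      using Ab N by auto
    have "(\<lambda>n. \<integral>\<^sup>+x. ennreal ((indicator (\<Union>i. A i) x - indicator (\<Union>i<n. A i) x)\<^sup>2) \<partial>N) \<longlonglongrightarrow> (\<integral>\<^sup>+x. 0 \<partial>N)"
    proof (rule nn_integral_dominated_convergence[where w="\<lambda>_. 1"])
      show "AE x in N. (\<lambda>n. ennreal ((indicator (\<Union>i. A i) x - indicator (\<Union>i<n. A i) x)\<^sup>2)) \<longlonglongrightarrow> 0"
      proof (rule AE_I2)
        fix x
        have "(\<lambda>n. (indicator (\<Union>i. A i) x - indicator (\<Union>i<n. A i) x :: real)\<^sup>2) \<longlonglongrightarrow>
           (indicator (\<Union>i. A i) x - indicator (\<Union>i. A i) x)\<^sup>2"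
          by (intro tendsto_intros LIMSEQ_indicator_UN)
        then show "(\<lambda>n. ennreal ((indicator (\<Union>i. A i) x - indicator (\<Union>i<n. A i) x)\<^sup>2)) \<longlonglongrightarrow> 0"
          using tendsto_ennrealI by fastforce
      qed
      show "AE x in N. ennreal ((indicator (\<Union>i. A i) x - indicator (\<Union>i<n. A i) x)\<^sup>2) \<le> 1" for n
        by (auto simp: indicator_def)
    qed (auto simp: less_top[symmetric])
    then show ?case
      using part N Ab by (subst uc_approximable_limit[where F="\<lambda>n. indicator (\<Union>i<n. A i)"]) auto
  qed
qed

text \<open>By monotone approximation from indicators; an increasing limit is also a mean square limit, since the
  squared error is dominated by \<open>(f x)\<^sup>2\<close>.\<close>

lemma uc_approximable_nonneg:
  fixes f :: "'a::metric_space \<Rightarrow> real"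
  assumes N: "sets N = sets borel" "finite_measure N" and f: "f \<in> borel_measurable borel"
    and nonneg: "\<And>x. 0 \<le> f x" and sq: "(\<integral>\<^sup>+x. ennreal ((f x)\<^sup>2) \<partial>N) < \<infinity>"
  shows "uc_approximable N f"
proof -
  have mono: "(\<integral>\<^sup>+x. ennreal ((p x)\<^sup>2) \<partial>N) < \<infinity>"
    if "(\<integral>\<^sup>+x. ennreal ((q x)\<^sup>2) \<partial>N) < \<infinity>" "\<And>x. 0 \<le> p x" "\<And>x. p x \<le> q x" for p q :: "'a \<Rightarrow> real"
    by (rule le_less_trans[OF nn_integral_mono that(1)]) (auto intro!: ennreal_leI power_mono that)
  have "(\<integral>\<^sup>+x. ennreal ((f x)\<^sup>2) \<partial>N) < \<infinity> \<longrightarrow> uc_approximable N f"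
    using f nonneg
  proof (induction rule: borel_measurable_induct_real)
    case (set A)
    then show ?case using N uc_approximable_indicator by auto
  next
    case (mult u c)
    show ?case
    proof (cases "c = 0")
      case True
      then show ?thesis by (simp add: uc_approximable_const)
    next
      case False
      have [measurable]: "u \<in> borel_measurable N" using mult N by (auto cong: measurable_cong_sets)
      have "(\<integral>\<^sup>+x. ennreal ((c * u x)\<^sup>2) \<partial>N) = ennreal (c\<^sup>2) * (\<integral>\<^sup>+x. ennreal ((u x)\<^sup>2) \<partial>N)"
        by (subst nn_integral_cmult[symmetric]) (auto simp flip: ennreal_mult' simp: power_mult_distrib)
      then show ?thesis
        using mult False N by (auto simp: ennreal_mult_less_top intro!: uc_approximable_cmult)
    qed
  next
    case (add u v)
    show ?case
    proof
      assume a: "(\<integral>\<^sup>+x. ennreal ((v x + u x)\<^sup>2) \<partial>N) < \<infinity>"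
      have "(\<integral>\<^sup>+x. ennreal ((u x)\<^sup>2) \<partial>N) < \<infinity>" "(\<integral>\<^sup>+x. ennreal ((v x)\<^sup>2) \<partial>N) < \<infinity>"
        by (rule mono[OF a]; simp add: add.hyps)+
      then have "uc_approximable N u" "uc_approximable N v"
        using add.IH by blast+
      then show "uc_approximable N (\<lambda>x. v x + u x)" using N by (intro uc_approximable_add)
    qed
  next
    case (seq G)
    show ?case
    proof
      assume a: "(\<integral>\<^sup>+x. ennreal ((f x)\<^sup>2) \<partial>N) < \<infinity>"
      have lim: "(\<lambda>n. G n x) \<longlonglongrightarrow> f x" for x using seq.hyps(4) by simp
      have le: "G n x \<le> f x" for n x
        using incseq_le[OF _ lim] seq.hyps(3) by (auto simp: incseq_def le_fun_def)
      have [measurable]: "f \<in> borel_measurable borel"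
        by (rule borel_measurable_LIMSEQ_real[OF lim]) (rule seq.hyps)
      have [measurable]: "f \<in> borel_measurable N" "G n \<in> borel_measurable N" for n
        using seq.hyps(1) N by (auto cong: measurable_cong_sets)
      have "(\<lambda>n. \<integral>\<^sup>+x. ennreal ((f x - G n x)\<^sup>2) \<partial>N) \<longlonglongrightarrow> (\<integral>\<^sup>+x. 0 \<partial>N)"
      proof (rule nn_integral_dominated_convergence[where w="\<lambda>x. ennreal ((f x)\<^sup>2)"])
        show "AE x in N. ennreal ((f x - G n x)\<^sup>2) \<le> ennreal ((f x)\<^sup>2)" for n
          using le seq.hyps(2) by (auto intro!: ennreal_leI power_mono AE_I2)
        show "AE x in N. (\<lambda>n. ennreal ((f x - G n x)\<^sup>2)) \<longlonglongrightarrow> 0"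
        proof (rule AE_I2)
          fix x
          have "(\<lambda>n. (f x - G n x)\<^sup>2) \<longlonglongrightarrow> (f x - f x)\<^sup>2"
            by (intro tendsto_intros lim)
          then show "(\<lambda>n. ennreal ((f x - G n x)\<^sup>2)) \<longlonglongrightarrow> 0"
            using tendsto_ennrealI by fastforce
        qed
      qed (use a in auto)
      moreover have "uc_approximable N (G n)" for n
        using seq.IH[of n] mono[OF a, of "G n"] seq.hyps(2) le by blast
      ultimately show "uc_approximable N f"
        using N(1) by (simp add: uc_approximable_limit[where F=G])
    qed
  qed
  then show ?thesis using sq by simp
qed

lemma L2_uniformly_continuous_dense:
  fixes f :: "'a::metric_space \<Rightarrow> real"
  assumes N: "sets N = sets borel" "finite_measure N" and f[measurable]: "f \<in> borel_measurable borel"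
    and sq: "(\<integral>\<^sup>+x. ennreal ((f x)\<^sup>2) \<partial>N) < \<infinity>" and "0 < \<delta>"
  obtains h where "uniformly_continuous_on UNIV h" "(\<integral>\<^sup>+x. ennreal ((f x - h x)\<^sup>2) \<partial>N) < ennreal \<delta>"
proof -
  have *: "uc_approximable N (\<lambda>x. max 0 (s * f x))" if "\<bar>s\<bar> = 1" for s
  proof (rule uc_approximable_nonneg[OF N])
    have "(max 0 (s * f x))\<^sup>2 \<le> (f x)\<^sup>2" for x
      using that by (simp add: max_def power_mult_distrib) (metis abs_1 mult_1 order_refl power2_abs power_one)
    then show "(\<integral>\<^sup>+x. ennreal ((max 0 (s * f x))\<^sup>2) \<partial>N) < \<infinity>"
      by (intro le_less_trans[OF nn_integral_mono sq] ennreal_leI)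
  qed auto
  have "uc_approximable N (\<lambda>x. max 0 (1 * f x) + (- 1) * max 0 ((- 1) * f x))"
    by (intro uc_approximable_add uc_approximable_cmult N *) auto
  also have "(\<lambda>x. max 0 (1 * f x) + (- 1) * max 0 ((- 1) * f x)) = f"
    by (auto simp: max_def)
  finally show thesis using that \<open>0 < \<delta>\<close> by (auto simp: uc_approximable_def)
qed

section \<open>Consistency of window regression on an i.i.d. sample\<close>

text \<open>Split at a level \<open>L\<close>: where \<open>h \<le> L\<close> the integral is at most \<open>L\<close> times that of \<open>V n\<close>, and where \<open>h > L\<close>
  it is at most \<open>c\<close> times a tail of the integral of \<open>h\<close>, which is small for large \<open>L\<close>.\<close>

lemma integral_vanishing_weight:
  fixes V :: "nat \<Rightarrow> 'a \<Rightarrow> real" and h :: "'a \<Rightarrow> real"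
  assumes h: "integrable M h" "\<And>x. 0 \<le> h x"
    and V[measurable]: "\<And>n. V n \<in> borel_measurable M" and V_bound: "\<And>n x. 0 \<le> V n x" "\<And>n x. V n x \<le> c"
    and V_int: "\<And>n. integrable M (V n)" and V_lim: "(\<lambda>n. \<integral>x. V n x \<partial>M) \<longlonglongrightarrow> 0"
  shows "(\<lambda>n. \<integral>x. V n x * h x \<partial>M) \<longlonglongrightarrow> 0"
proof (rule LIMSEQ_I)
  fix \<delta> :: real assume \<delta>: "0 < \<delta>"
  have [measurable]: "h \<in> borel_measurable M" using h by auto
  have c: "0 \<le> c" using V_bound[of undefined undefined] by linarith
  define tail where "tail L x = c * (h x * of_bool (h x > real L))" for L :: nat and x
  have tail_int: "integrable M (tail L)" for L
    unfolding tail_def by (rule integrable_mult_right, rule Bochner_Integration.integrable_bound[OF h(1)]) auto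
  have "(\<lambda>L. \<integral>x. tail L x \<partial>M) \<longlonglongrightarrow> (\<integral>x. 0 \<partial>M)"
  proof (rule integral_dominated_convergence[where w="\<lambda>x. c * h x"])
    show "AE x in M. (\<lambda>L. tail L x) \<longlonglongrightarrow> 0"
    proof (rule AE_I2, rule tendsto_eventually)
      fix x
      obtain n where "h x \<le> real n" using real_arch_simple by blast
      then show "\<forall>\<^sub>F L in sequentially. tail L x = 0"
        by (auto simp: eventually_sequentially tail_def not_less intro!: exI[of _ n] order_trans[OF \<open>h x \<le> real n\<close>])
    qed
  qed (use c h in \<open>auto simp: tail_def\<close>)
  then have "\<forall>\<^sub>F L in sequentially. (\<integral>x. tail L x \<partial>M) < \<delta> / 2"
    using \<delta> by (intro order_tendstoD(2)) auto
  then obtain L where L: "(\<integral>x. tail L x \<partial>M) < \<delta> / 2" by (auto simp: eventually_sequentially)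
  have Vh_int: "integrable M (\<lambda>x. V n x * h x)" for n
    by (rule Bochner_Integration.integrable_bound[where f="\<lambda>x. c * h x"])
       (use h V_bound c in \<open>auto simp: abs_mult intro!: mult_right_mono\<close>)
  have bound: "(\<integral>x. V n x * h x \<partial>M) \<le> real L * (\<integral>x. V n x \<partial>M) + (\<integral>x. tail L x \<partial>M)" for n
  proof -
    have "V n x * h x \<le> real L * V n x + tail L x" for x
    proof (cases "h x > real L")
      case True
      have "V n x * h x \<le> c * h x" "0 \<le> real L * V n x"
        using V_bound h(2) by (auto intro: mult_right_mono)
      moreover have "tail L x = c * h x" using True by (simp add: tail_def)
      ultimately show ?thesis by linarith
    next
      case False
      then have "h x * V n x \<le> real L * V n x"
        using V_bound(1) by (intro mult_right_mono) auto
      then show ?thesis using False by (simp add: tail_def mult.commute)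
    qed
    then have "(\<integral>x. V n x * h x \<partial>M) \<le> (\<integral>x. real L * V n x + tail L x \<partial>M)"
      by (intro integral_mono Vh_int Bochner_Integration.integrable_add integrable_mult_right V_int tail_int)
    also have "\<dots> = real L * (\<integral>x. V n x \<partial>M) + (\<integral>x. tail L x \<partial>M)"
      using V_int tail_int by simp
    finally show ?thesis .
  qed
  have "(\<lambda>n. real L * (\<integral>x. V n x \<partial>M)) \<longlonglongrightarrow> real L * 0"
    by (intro tendsto_intros V_lim)
  then have "\<forall>\<^sub>F n in sequentially. real L * (\<integral>x. V n x \<partial>M) < \<delta> / 2"
    using \<delta> by (intro order_tendstoD(2)) auto
  then obtain n0 where n0: "\<And>n. n \<ge> n0 \<Longrightarrow> real L * (\<integral>x. V n x \<partial>M) < \<delta> / 2"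
    by (auto simp: eventually_sequentially)
  have "norm ((\<integral>x. V n x * h x \<partial>M) - 0) < \<delta>" if "n \<ge> n0" for n
  proof -
    have "0 \<le> (\<integral>x. V n x * h x \<partial>M)" using V_bound h by (intro Bochner_Integration.integral_nonneg) auto
    then show ?thesis using bound[of n] n0[OF that] L by auto
  qed
  then show "\<exists>n0. \<forall>n\<ge>n0. norm ((\<integral>x. V n x * h x \<partial>M) - 0) < \<delta>" by blast
qed

lemma square_integrable_product:
  fixes f h :: "'a \<Rightarrow> real"
  assumes "integrable M (\<lambda>x. (f x)\<^sup>2)" "integrable M (\<lambda>x. (h x)\<^sup>2)"
    and [measurable]: "f \<in> borel_measurable M" "h \<in> borel_measurable M"
  shows "integrable M (\<lambda>x. f x * h x)"
proof (rule Bochner_Integration.integrable_bound[where f="\<lambda>x. (f x)\<^sup>2 + (h x)\<^sup>2"])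
  have "\<bar>f x * h x\<bar> \<le> (f x)\<^sup>2 + (h x)\<^sup>2" for x
    using zero_le_power2[of "f x + h x"] zero_le_power2[of "f x - h x"] zero_le_power2[of "f x"] zero_le_power2[of "h x"]
    unfolding power2_sum power2_diff by (simp add: abs_le_iff)
  then show "AE x in M. norm (f x * h x) \<le> norm ((f x)\<^sup>2 + (h x)\<^sup>2)" by (intro AE_I2) simp
qed (use assms in auto)

lemma square_integrable_diff:
  fixes f h :: "'a \<Rightarrow> real"
  assumes "integrable M (\<lambda>x. (f x)\<^sup>2)" "integrable M (\<lambda>x. (h x)\<^sup>2)"
    and "f \<in> borel_measurable M" "h \<in> borel_measurable M"
  shows "integrable M (\<lambda>x. (f x - h x)\<^sup>2)"
proof -
  have "integrable M (\<lambda>x. (f x)\<^sup>2 + (h x)\<^sup>2 - 2 * (f x * h x))"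
    using square_integrable_product[OF assms]
    by (intro Bochner_Integration.integrable_add Bochner_Integration.integrable_diff assms integrable_mult_right) auto
  then show ?thesis by (simp add: power2_diff mult.assoc)
qed

lemma expectation_affine:
  fixes A B :: "'a \<Rightarrow> real"
  assumes "prob_space M" "integrable M A" "integrable M B"
  shows "(\<integral>x. a * A x + (c + b * B x) \<partial>M) = a * (\<integral>x. A x \<partial>M) + (c + b * (\<integral>x. B x \<partial>M))"
proof -
  interpret prob_space M by fact
  show ?thesis using assms(2,3) by (simp add: prob_space)
qed

text \<open>The points live in an abstract probability space and are seen only through the feature map \<open>U\<close>. In the
  application a point is a pair \<open>(x, y)\<close> and \<open>U\<close> reads off the machines at \<open>x\<close>.\<close>

locale window_regression = prob_space \<mu> for \<mu> :: "'a measure" +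
  fixes U :: "'a \<Rightarrow> real^'m::finite"
  assumes U_measurable [measurable]: "U \<in> borel_measurable \<mu>"
begin

abbreviation S :: "(nat \<Rightarrow> 'a) measure" where
  "S \<equiv> PiM UNIV (\<lambda>_. \<mu>)"

sublocale sample: sequence_space \<mu> ..

lemma coord_integral:
  fixes h :: "'a \<Rightarrow> real"
  assumes "h \<in> borel_measurable \<mu>"
  shows "(\<integral>\<omega>. h (\<omega> i) \<partial>S) = (\<integral>x. h x \<partial>\<mu>)"
  using integral_distr[of "\<lambda>\<omega>. \<omega> i" S \<mu> h] sample.PiM_component[of i] assms by simp

lemma coord_integrable:
  fixes h :: "'a \<Rightarrow> real"
  assumes "integrable \<mu> h"
  shows "integrable S (\<lambda>\<omega>. h (\<omega> i))"
  using integrable_distr[of "\<lambda>\<omega>. \<omega> i" S \<mu> h] sample.PiM_component[of i] assms by simp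

lemma permute_measurable [measurable]:
  "(\<lambda>\<omega> i. \<omega> (\<pi> i)) \<in> S \<rightarrow>\<^sub>M S"
  by (rule measurable_PiM_single') (auto simp: space_PiM PiE_iff)

lemma distr_permute:
  assumes "inj \<pi>"
  shows "distr S S (\<lambda>\<omega> i. \<omega> (\<pi> i)) = S"
  using distr_PiM_reindex[of UNIV "\<lambda>_. \<mu>" \<pi> UNIV] assms prob_space_axioms by (simp add: restrict_def)

lemma integral_permute:
  fixes F :: "(nat \<Rightarrow> 'a) \<Rightarrow> real"
  assumes "inj \<pi>" and F: "F \<in> borel_measurable S"
  shows "(\<integral>\<omega>. F (\<lambda>i. \<omega> (\<pi> i)) \<partial>S) = (\<integral>\<omega>. F \<omega> \<partial>S)"
  using integral_distr[OF permute_measurable F, of \<pi>] by (simp add: distr_permute[OF assms(1)])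

abbreviation features :: "(nat \<Rightarrow> 'a) \<Rightarrow> nat \<Rightarrow> real^'m" where
  "features \<omega> i \<equiv> U (\<omega> i)"

text \<open>Exchanging the points \<open>0\<close> and \<open>i\<close> moves the integrand \<open>h\<close> from sample point \<open>i\<close> to the query and reverses the
  weight, so that the sum on the right collects the weights received by a single point.\<close>

lemma weighted_sum_exchange:
  fixes h :: "'a \<Rightarrow> real"
  assumes h: "integrable \<mu> h"
  shows "integrable S (\<lambda>\<omega>. \<Sum>i\<in>{..l} - {0}. window_weight e l (features \<omega>) 0 i ^ p * h (\<omega> i))" (is ?I1)
    and "(\<integral>\<omega>. (\<Sum>i\<in>{..l} - {0}. window_weight e l (features \<omega>) 0 i ^ p * h (\<omega> i)) \<partial>S)
       = (\<integral>\<omega>. (\<Sum>i\<in>{..l} - {0}. window_weight e l (features \<omega>) i 0 ^ p) * h (\<omega> 0) \<partial>S)" (is ?E)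
proof -
  have [measurable]: "h \<in> borel_measurable \<mu>" using h by auto
  have int: "integrable S (\<lambda>\<omega>. window_weight e l (features \<omega>) i j ^ p * h (\<omega> q))" if "i \<noteq> j" "j \<le> l" for i j q
  proof (rule Bochner_Integration.integrable_bound[OF coord_integrable[OF h, of q]])
    have "window_weight e l (features \<omega>) i j ^ p * \<bar>h (\<omega> q)\<bar> \<le> 1 * \<bar>h (\<omega> q)\<bar>" for \<omega>
      using that by (intro mult_right_mono power_le_one) (auto simp: window_weight_nonneg window_weight_le_1)
    then show "AE \<omega> in S. norm (window_weight e l (features \<omega>) i j ^ p * h (\<omega> q)) \<le> norm (h (\<omega> q))"
      by (simp add: abs_mult power_abs window_weight_nonneg)
  qed measurable
  show ?I1 using int by (intro Bochner_Integration.integrable_sum) auto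
  have "(\<integral>\<omega>. (\<Sum>i\<in>{..l} - {0}. window_weight e l (features \<omega>) 0 i ^ p * h (\<omega> i)) \<partial>S)
      = (\<Sum>i\<in>{..l} - {0}. \<integral>\<omega>. window_weight e l (features \<omega>) 0 i ^ p * h (\<omega> i) \<partial>S)"
    using int by (intro Bochner_Integration.integral_sum) auto
  also have "\<dots> = (\<Sum>i\<in>{..l} - {0}. \<integral>\<omega>. window_weight e l (features \<omega>) i 0 ^ p * h (\<omega> 0) \<partial>S)"
  proof (rule sum.cong[OF refl])
    fix i assume i: "i \<in> {..l} - {0}"
    define \<pi> where "\<pi> = Transposition.transpose 0 i"
    have \<pi>: "\<pi> permutes {..l}" unfolding \<pi>_def using i by (intro permutes_swap_id) auto
    have "(\<integral>\<omega>. window_weight e l (features \<omega>) 0 i ^ p * h (\<omega> i) \<partial>S)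
        = (\<integral>\<omega>. window_weight e l (features (\<lambda>i. \<omega> (\<pi> i))) 0 i ^ p * h (\<omega> (\<pi> i)) \<partial>S)"
      using permutes_inj[OF \<pi>] by (intro integral_permute[symmetric]) auto
    also have "\<dots> = (\<integral>\<omega>. window_weight e l (features \<omega>) i 0 ^ p * h (\<omega> 0) \<partial>S)"
      by (simp add: window_weight_permute[OF \<pi>, where u="\<lambda>i. U (_ i)"]) (simp add: \<pi>_def)
    finally show "(\<integral>\<omega>. window_weight e l (features \<omega>) 0 i ^ p * h (\<omega> i) \<partial>S)
        = (\<integral>\<omega>. window_weight e l (features \<omega>) i 0 ^ p * h (\<omega> 0) \<partial>S)" .
  qed
  also have "\<dots> = (\<integral>\<omega>. (\<Sum>i\<in>{..l} - {0}. window_weight e l (features \<omega>) i 0 ^ p * h (\<omega> 0)) \<partial>S)"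
    using int by (intro Bochner_Integration.integral_sum[symmetric]) auto
  finally show ?E by (simp add: sum_distrib_right)
qed

text \<open>This is the condition of Stone's theorem that the weights do not blow up integrable functions; the
  constant depends neither on the law of the points nor on \<open>l\<close> and \<open>e\<close>.\<close>

lemma weighted_mean_le:
  assumes h: "integrable \<mu> h" and nonneg: "\<And>x. 0 \<le> h x"
  shows "(\<integral>\<omega>. (\<Sum>i\<in>{..l} - {0}. window_weight e l (features \<omega>) 0 i * h (\<omega> i)) \<partial>S) \<le> 2 ^ CARD('m) * (\<integral>x. h x \<partial>\<mu>)"
proof -
  have [measurable]: "h \<in> borel_measurable \<mu>" using h by auto
  have le: "(\<Sum>i\<in>{..l} - {0}. window_weight e l (features \<omega>) i 0) * h (\<omega> 0) \<le> 2 ^ CARD('m) * h (\<omega> 0)" for \<omega>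
    using sum_weights_at_point_le[of 0 l e "features \<omega>"] nonneg by (intro mult_right_mono) auto
  have "(\<integral>\<omega>. (\<Sum>i\<in>{..l} - {0}. window_weight e l (features \<omega>) 0 i * h (\<omega> i)) \<partial>S)
      = (\<integral>\<omega>. (\<Sum>i\<in>{..l} - {0}. window_weight e l (features \<omega>) i 0) * h (\<omega> 0) \<partial>S)"
    using weighted_sum_exchange(2)[OF h, where p=1] by simp
  also have "\<dots> \<le> (\<integral>\<omega>. 2 ^ CARD('m) * h (\<omega> 0) \<partial>S)"
  proof (rule integral_mono[OF _ _ le])
    show *: "integrable S (\<lambda>\<omega>. 2 ^ CARD('m) * h (\<omega> 0))"
      using coord_integrable[OF h] by (intro integrable_mult_right)
    show "integrable S (\<lambda>\<omega>. (\<Sum>i\<in>{..l} - {0}. window_weight e l (features \<omega>) i 0) * h (\<omega> 0))"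
      by (rule Bochner_Integration.integrable_bound[OF *])
        (use le nonneg in \<open>auto simp: abs_mult sum_nonneg window_weight_nonneg\<close>)
  qed
  also have "\<dots> = 2 ^ CARD('m) * (\<integral>x. h x \<partial>\<mu>)"
    by (simp add: coord_integral)
  finally show ?thesis .
qed

lemma integrable_inverse_nbr_count: "integrable S (\<lambda>\<omega>. 1 / (nbr_count e l (features \<omega>) q + 1))"
  by (rule sample.P.integrable_const_bound[of _ 1]) (auto simp: nbr_count_nonneg divide_le_eq_1 add_nonneg_pos)

text \<open>By exchangeability the expectation over features in the box of radius \<open>R\<close> is the average over all
  \<open>l + 1\<close> points of the sum in \<open>sum_inverse_nbr_count_le\<close>. Outside the box the integrand is at most \<open>1\<close>.\<close>

lemma mean_inverse_nbr_count_bound: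
  assumes e: "0 < e" "e \<le> 1" and R: "0 \<le> R"
  shows "(\<integral>\<omega>. 1 / (nbr_count e l (features \<omega>) 0 + 1) \<partial>S)
      \<le> ((2 * R + 2) / e) ^ CARD('m) / (real l + 1) + (\<integral>x. of_bool (\<not> near R 0 (U x)) \<partial>\<mu>)"
proof -
  define \<phi> where "\<phi> \<omega> q = of_bool (near R 0 (U (\<omega> q))) / (nbr_count e l (features \<omega>) q + 1)" for \<omega> :: "nat \<Rightarrow> 'a" and q
  have [measurable]: "(\<lambda>\<omega>. \<phi> \<omega> q) \<in> borel_measurable S" for q unfolding \<phi>_def by measurable
  have int: "integrable S (\<lambda>\<omega>. \<phi> \<omega> q)" for q
    by (rule sample.P.integrable_const_bound[of _ 1])
      (auto simp: \<phi>_def nbr_count_nonneg divide_le_eq_1 add_nonneg_pos)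
  have swap: "(\<integral>\<omega>. \<phi> \<omega> q \<partial>S) = (\<integral>\<omega>. \<phi> \<omega> 0 \<partial>S)" if "q \<le> l" for q
  proof -
    define \<pi> where "\<pi> = Transposition.transpose 0 q"
    have \<pi>: "\<pi> permutes {..l}" unfolding \<pi>_def using that by (intro permutes_swap_id) auto
    have "(\<integral>\<omega>. \<phi> \<omega> q \<partial>S) = (\<integral>\<omega>. \<phi> (\<lambda>i. \<omega> (\<pi> i)) q \<partial>S)"
      using permutes_inj[OF \<pi>] by (intro integral_permute[symmetric]) auto
    also have "\<dots> = (\<integral>\<omega>. \<phi> \<omega> 0 \<partial>S)"
      by (simp add: \<phi>_def nbr_count_permute[OF \<pi>, where u="\<lambda>i. U (_ i)"]) (simp add: \<pi>_def)
    finally show ?thesis .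
  qed
  have "(real l + 1) * (\<integral>\<omega>. \<phi> \<omega> 0 \<partial>S) = (\<Sum>q\<le>l. \<integral>\<omega>. \<phi> \<omega> q \<partial>S)"
  proof -
    have "(\<Sum>q\<le>l. \<integral>\<omega>. \<phi> \<omega> q \<partial>S) = (\<Sum>q\<le>l. \<integral>\<omega>. \<phi> \<omega> 0 \<partial>S)"
      by (rule sum.cong) (auto intro: swap)
    then show ?thesis by simp
  qed
  also have "\<dots> = (\<integral>\<omega>. (\<Sum>q\<le>l. \<phi> \<omega> q) \<partial>S)"
    using int by (intro Bochner_Integration.integral_sum[symmetric]) auto
  also have "\<dots> \<le> (\<integral>\<omega>. ((2 * R + 2) / e) ^ CARD('m) \<partial>S)"
    using int sum_inverse_nbr_count_le[OF e R] by (intro integral_mono) (auto simp: \<phi>_def)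
  also have "\<dots> = ((2 * R + 2) / e) ^ CARD('m)" by (simp add: sample.P.prob_space)
  finally have 1: "(\<integral>\<omega>. \<phi> \<omega> 0 \<partial>S) \<le> ((2 * R + 2) / e) ^ CARD('m) / (real l + 1)"
    by (subst pos_le_divide_eq) (auto simp: mult.commute)
  have int2: "integrable \<mu> (\<lambda>x. of_bool (\<not> near R 0 (U x)) :: real)"
    by (rule integrable_const_bound[of _ 1]) auto
  have "(\<integral>\<omega>. 1 / (nbr_count e l (features \<omega>) 0 + 1) \<partial>S) \<le> (\<integral>\<omega>. \<phi> \<omega> 0 + of_bool (\<not> near R 0 (U (\<omega> 0))) \<partial>S)"
    using coord_integrable[OF int2] int
    by (intro integral_mono integrable_inverse_nbr_count Bochner_Integration.integrable_add)
       (auto simp: \<phi>_def nbr_count_nonneg divide_le_eq_1 add_nonneg_pos)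
  also have "\<dots> = (\<integral>\<omega>. \<phi> \<omega> 0 \<partial>S) + (\<integral>x. of_bool (\<not> near R 0 (U x)) \<partial>\<mu>)"
    using Bochner_Integration.integral_add[OF int coord_integrable[OF int2]]
      coord_integral[of "\<lambda>x. of_bool (\<not> near R 0 (U x))" 0] by simp
  finally show ?thesis using 1 by linarith
qed

text \<open>First \<open>R\<close> is chosen so that the feature rarely leaves the box of radius \<open>R\<close>; with \<open>R\<close> fixed, the
  other term of the bound is a constant divided by \<open>\<epsilon> l ^ M * (l + 1)\<close>.\<close>

lemma mean_inverse_nbr_count_tendsto_0:
  assumes pos: "\<And>l. l \<ge> 1 \<Longrightarrow> \<epsilon> l > 0" and small: "\<epsilon> \<longlonglongrightarrow> 0"
    and large: "filterlim (\<lambda>l. real l * \<epsilon> l ^ CARD('m)) at_top sequentially"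
  shows "(\<lambda>l. \<integral>\<omega>. 1 / (nbr_count (\<epsilon> l) l (features \<omega>) 0 + 1) \<partial>S) \<longlonglongrightarrow> 0"
proof (rule LIMSEQ_I)
  fix \<delta> :: real assume \<delta>: "0 < \<delta>"
  have "(\<lambda>R. \<integral>x. of_bool (\<not> near (real R) 0 (U x)) \<partial>\<mu>) \<longlonglongrightarrow> (\<integral>x. 0 \<partial>\<mu> :: real)"
  proof (rule integral_dominated_convergence[where w="\<lambda>_. 1"])
    show "AE x in \<mu>. (\<lambda>R. of_bool (\<not> near (real R) 0 (U x)) :: real) \<longlonglongrightarrow> 0"
    proof (rule AE_I2, rule tendsto_eventually)
      fix x
      obtain n where n: "norm (U x) \<le> real n" using real_arch_simple by blast
      have "near (real R) 0 (U x)" if "n \<le> R" for R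
        unfolding near_def
      proof
        fix m
        have "real n \<le> real R" using that by simp
        then show "\<bar>0 $ m - U x $ m\<bar> \<le> real R" using component_le_norm_cart[of "U x" m] n by simp
      qed
      then show "\<forall>\<^sub>F R in sequentially. of_bool (\<not> near (real R) 0 (U x)) = (0::real)"
        by (auto simp: eventually_sequentially)
    qed
  qed auto
  then have "\<forall>\<^sub>F R in sequentially. (\<integral>x. of_bool (\<not> near (real R) 0 (U x)) \<partial>\<mu>) < \<delta> / 2"
    using \<delta> by (intro order_tendstoD(2)) auto
  then obtain R :: nat where R: "(\<integral>x. of_bool (\<not> near (real R) 0 (U x)) \<partial>\<mu>) < \<delta> / 2"
    by (auto simp: eventually_sequentially)
  define C where "C = (2 * real R + 2) ^ CARD('m)"
  have "\<forall>\<^sub>F l in sequentially. 2 * C / \<delta> < real l * \<epsilon> l ^ CARD('m)"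
    using large by (auto simp: filterlim_at_top_dense)
  moreover have "\<forall>\<^sub>F l in sequentially. \<epsilon> l < 1"
    by (rule order_tendstoD(2)[OF small]) simp
  moreover have "\<forall>\<^sub>F l in sequentially. (l::nat) \<ge> 1" by (rule eventually_ge_at_top)
  ultimately have "\<forall>\<^sub>F l in sequentially. norm ((\<integral>\<omega>. 1 / (nbr_count (\<epsilon> l) l (features \<omega>) 0 + 1) \<partial>S) - 0) < \<delta>"
  proof eventually_elim
    case (elim l)
    then have e: "0 < \<epsilon> l" "\<epsilon> l \<le> 1" using pos[of l] by auto
    have "C / (\<epsilon> l ^ CARD('m) * (real l + 1)) < \<delta> / 2"
    proof -
      have "2 * C < \<delta> * (real l * \<epsilon> l ^ CARD('m))" using elim(1) \<delta> by (simp add: field_simps)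
      also have "\<dots> \<le> \<delta> * (\<epsilon> l ^ CARD('m) * (real l + 1))" using e \<delta> by (auto simp: algebra_simps)
      finally have "2 * C < \<delta> * (\<epsilon> l ^ CARD('m) * (real l + 1))" .
      moreover have "0 < \<epsilon> l ^ CARD('m) * (real l + 1)" using e by (intro mult_pos_pos) auto
      ultimately show ?thesis by (subst pos_divide_less_eq) (auto simp: mult.commute)
    qed
    moreover have "(\<integral>\<omega>. 1 / (nbr_count (\<epsilon> l) l (features \<omega>) 0 + 1) \<partial>S)
        \<le> C / (\<epsilon> l ^ CARD('m) * (real l + 1)) + (\<integral>x. of_bool (\<not> near (real R) 0 (U x)) \<partial>\<mu>)"
      using mean_inverse_nbr_count_bound[OF e, of "real R" l] by (simp add: C_def power_divide)
    moreover have "0 \<le> (\<integral>\<omega>. 1 / (nbr_count (\<epsilon> l) l (features \<omega>) 0 + 1) \<partial>S)"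
      by (intro Bochner_Integration.integral_nonneg) (auto simp: nbr_count_nonneg add_nonneg_nonneg)
    ultimately show ?case using R unfolding real_norm_def diff_0_right by linarith
  qed
  then show "\<exists>l0. \<forall>l\<ge>l0. norm ((\<integral>\<omega>. 1 / (nbr_count (\<epsilon> l) l (features \<omega>) 0 + 1) \<partial>S) - 0) < \<delta>"
    by (simp add: eventually_sequentially)
qed

lemma local_variation_integrable:
  assumes [measurable]: "g \<in> borel_measurable borel" and sq: "integrable \<mu> (\<lambda>x. (g (U x))\<^sup>2)"
  shows "integrable S (\<lambda>\<omega>. \<Sum>i\<in>{..l} - {0}. window_weight e l (features \<omega>) 0 i * (g (U (\<omega> i)) - g (U (\<omega> 0)))\<^sup>2)"
proof (rule Bochner_Integration.integrable_bound)
  let ?B = "\<lambda>\<omega>. 2 * (\<Sum>i\<in>{..l} - {0}. window_weight e l (features \<omega>) 0 i ^ 1 * (g (U (\<omega> i)))\<^sup>2) + 2 * (g (U (\<omega> 0)))\<^sup>2"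
  show "integrable S ?B"
    by (intro Bochner_Integration.integrable_add integrable_mult_right weighted_sum_exchange(1)[OF sq]
        coord_integrable[OF sq])
  have "(\<Sum>i\<in>{..l} - {0}. window_weight e l (features \<omega>) 0 i * (g (U (\<omega> i)) - g (U (\<omega> 0)))\<^sup>2) \<le> ?B \<omega>" for \<omega>
  proof -
    have "(\<Sum>i\<in>{..l} - {0}. window_weight e l (features \<omega>) 0 i * (g (U (\<omega> i)) - g (U (\<omega> 0)))\<^sup>2)
        \<le> (\<Sum>i\<in>{..l} - {0}. window_weight e l (features \<omega>) 0 i * (2 * (g (U (\<omega> i)))\<^sup>2 + 2 * (g (U (\<omega> 0)))\<^sup>2))"
    proof (intro sum_mono mult_left_mono window_weight_nonneg)
      fix i
      show "(g (U (\<omega> i)) - g (U (\<omega> 0)))\<^sup>2 \<le> 2 * (g (U (\<omega> i)))\<^sup>2 + 2 * (g (U (\<omega> 0)))\<^sup>2"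
        using zero_le_power2[of "g (U (\<omega> i)) + g (U (\<omega> 0))"] by (simp add: power2_eq_square algebra_simps)
    qed
    also have "\<dots> = 2 * (\<Sum>i\<in>{..l} - {0}. window_weight e l (features \<omega>) 0 i * (g (U (\<omega> i)))\<^sup>2)
        + (\<Sum>i\<in>{..l} - {0}. window_weight e l (features \<omega>) 0 i) * (2 * (g (U (\<omega> 0)))\<^sup>2)"
      by (simp add: distrib_left sum.distrib sum_distrib_left sum_distrib_right mult.left_commute)
    also have "\<dots> \<le> 2 * (\<Sum>i\<in>{..l} - {0}. window_weight e l (features \<omega>) 0 i * (g (U (\<omega> i)))\<^sup>2) + 1 * (2 * (g (U (\<omega> 0)))\<^sup>2)"
      by (intro add_left_mono mult_right_mono) (auto simp: sum_window_weight)
    finally show ?thesis by simp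
  qed
  moreover have "0 \<le> (\<Sum>i\<in>{..l} - {0}. window_weight e l (features \<omega>) 0 i * (g (U (\<omega> i)) - g (U (\<omega> 0)))\<^sup>2)" for \<omega>
    by (intro sum_nonneg mult_nonneg_nonneg window_weight_nonneg zero_le_power2)
  ultimately show "AE \<omega> in S. norm (\<Sum>i\<in>{..l} - {0}. window_weight e l (features \<omega>) 0 i * (g (U (\<omega> i)) - g (U (\<omega> 0)))\<^sup>2) \<le> norm (?B \<omega>)"
    unfolding real_norm_def by (intro AE_I2) (simp only: abs_of_nonneg, meson abs_ge_self order_trans)
qed measurable

text \<open>Compare \<open>g\<close> with a uniformly continuous \<open>h\<close>. For close features \<open>h\<close> hardly varies, and replacing \<open>g\<close> by \<open>h\<close>
  costs a multiple of \<open>E (g U - h U)\<^sup>2\<close>, at sample points by \<open>weighted_mean_le\<close>.\<close>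

lemma local_variation_tendsto_0:
  assumes [measurable]: "g \<in> borel_measurable borel" and sq: "integrable \<mu> (\<lambda>x. (g (U x))\<^sup>2)"
    and small: "\<epsilon> \<longlonglongrightarrow> 0"
  shows "(\<lambda>l. \<integral>\<omega>. (\<Sum>i\<in>{..l} - {0}. window_weight (\<epsilon> l) l (features \<omega>) 0 i * (g (U (\<omega> i)) - g (U (\<omega> 0)))\<^sup>2) \<partial>S) \<longlonglongrightarrow> 0"
    (is "(\<lambda>l. \<integral>\<omega>. ?v l \<omega> \<partial>S) \<longlonglongrightarrow> 0")
proof (rule LIMSEQ_I)
  fix \<delta> :: real assume \<delta>: "0 < \<delta>"
  define c :: real where "c = 2 ^ CARD('m)"
  have c: "0 < c" by (simp add: c_def)
  \<comment> \<open>The constants are such that the bound \<open>3 * (c + 1) * \<delta>' + 3 * \<eta>\<^sup>2\<close> reached below equals \<open>\<delta> / 2 + \<delta> / 4\<close>.\<close>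
  define \<delta>' where "\<delta>' = \<delta> / (6 * (c + 1))"
  have \<delta>': "0 < \<delta>'" using \<delta> c by (simp add: \<delta>'_def)
  let ?N = "distr \<mu> borel U"
  interpret N: prob_space ?N by (rule prob_space_distr) simp
  have "(\<integral>\<^sup>+x. ennreal ((g x)\<^sup>2) \<partial>?N) < \<infinity>"
    using sq by (simp add: nn_integral_distr integrable_iff_bounded)
  then obtain h where h: "uniformly_continuous_on UNIV h" "(\<integral>\<^sup>+x. ennreal ((g x - h x)\<^sup>2) \<partial>?N) < ennreal \<delta>'"
    using L2_uniformly_continuous_dense[of ?N g \<delta>'] \<delta>' N.finite_measure_axioms by auto
  have [measurable]: "h \<in> borel_measurable borel" by (rule uc_measurable[OF h(1)])
  define d where "d x = (g (U x) - h (U x))\<^sup>2" for x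
  have d_lt: "(\<integral>\<^sup>+x. ennreal (d x) \<partial>\<mu>) < ennreal \<delta>'"
    using h(2) by (simp add: nn_integral_distr d_def)
  have d_int: "integrable \<mu> d"
  proof (rule integrableI_nonneg)
    show "(\<integral>\<^sup>+x. ennreal (d x) \<partial>\<mu>) < \<infinity>" by (rule order.strict_trans[OF d_lt]) simp
  qed (auto simp: d_def[abs_def])
  have d_le: "(\<integral>x. d x \<partial>\<mu>) < \<delta>'"
  proof -
    have "(\<integral>\<^sup>+x. ennreal (d x) \<partial>\<mu>) = ennreal (\<integral>x. d x \<partial>\<mu>)"
      by (rule nn_integral_eq_integral[OF d_int]) (simp add: d_def)
    moreover have "0 \<le> (\<integral>x. d x \<partial>\<mu>)"
      by (rule Bochner_Integration.integral_nonneg) (simp add: d_def)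
    ultimately show ?thesis using d_lt by (simp add: ennreal_less_iff)
  qed
  define \<eta> where "\<eta> = sqrt (\<delta> / 12)"
  have \<eta>: "0 < \<eta>" using \<delta> by (simp add: \<eta>_def)
  obtain r where r: "0 < r" "\<And>u v. dist u v < r \<Longrightarrow> dist (h u) (h v) < \<eta>"
  proof -
    have "\<exists>r>0. \<forall>x\<in>UNIV. \<forall>x'\<in>UNIV. dist x' x < r \<longrightarrow> dist (h x') (h x) < \<eta>"
      using h(1) \<eta> unfolding uniformly_continuous_on_def by (elim allE impE)
    then show thesis using that by auto
  qed
  have "(\<lambda>l. real CARD('m) * \<epsilon> l) \<longlonglongrightarrow> real CARD('m) * 0"
    by (intro tendsto_intros small)
  then have "\<forall>\<^sub>F l in sequentially. CARD('m) * \<epsilon> l < r"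
    using r(1) by (intro order_tendstoD(2)) auto
  then have "\<forall>\<^sub>F l in sequentially. norm ((\<integral>\<omega>. ?v l \<omega> \<partial>S) - 0) < \<delta>"
  proof eventually_elim
    case (elim l)
    let ?w = "\<lambda>\<omega> i. window_weight (\<epsilon> l) l (features \<omega>) 0 i"
    have pt: "?v l \<omega> \<le> 3 * (\<Sum>i\<in>{..l} - {0}. ?w \<omega> i ^ 1 * d (\<omega> i)) + (3 * \<eta>\<^sup>2 + 3 * d (\<omega> 0))" for \<omega>
    proof -
      have "?v l \<omega> \<le> (\<Sum>i\<in>{..l} - {0}. ?w \<omega> i * (3 * d (\<omega> i) + (3 * \<eta>\<^sup>2 + 3 * d (\<omega> 0))))"
      proof (rule sum_mono)
        fix i
        show "?w \<omega> i * (g (U (\<omega> i)) - g (U (\<omega> 0)))\<^sup>2 \<le> ?w \<omega> i * (3 * d (\<omega> i) + (3 * \<eta>\<^sup>2 + 3 * d (\<omega> 0)))"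
        proof (cases "near (\<epsilon> l) (U (\<omega> 0)) (U (\<omega> i))")
          case False
          then show ?thesis by (simp add: window_weight_def)
        next
          case True
          have "dist (U (\<omega> 0)) (U (\<omega> i)) < r"
            using near_imp_dist_le[OF True] elim by linarith
          then have "dist (h (U (\<omega> 0))) (h (U (\<omega> i))) < \<eta>" by (rule r(2))
          then have hh: "(h (U (\<omega> i)) - h (U (\<omega> 0)))\<^sup>2 \<le> \<eta>\<^sup>2"
            by (intro abs_le_square_iff[THEN iffD1]) (auto simp: dist_real_def)
          have three: "(a + b + c')\<^sup>2 \<le> 3 * a\<^sup>2 + 3 * b\<^sup>2 + 3 * c'\<^sup>2" for a b c' :: real
            using sum_squares_ge_zero[of "a - b" "b - c'"] zero_le_power2[of "a - c'"]
            by (simp add: power2_eq_square algebra_simps)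
          have "(g (U (\<omega> i)) - g (U (\<omega> 0)))\<^sup>2 =
            ((g (U (\<omega> i)) - h (U (\<omega> i))) + (h (U (\<omega> i)) - h (U (\<omega> 0))) + (h (U (\<omega> 0)) - g (U (\<omega> 0))))\<^sup>2" by simp
          also have "\<dots> \<le> 3 * (g (U (\<omega> i)) - h (U (\<omega> i)))\<^sup>2 + 3 * (h (U (\<omega> i)) - h (U (\<omega> 0)))\<^sup>2 + 3 * (h (U (\<omega> 0)) - g (U (\<omega> 0)))\<^sup>2"
            by (rule three)
          also have "\<dots> \<le> 3 * d (\<omega> i) + (3 * \<eta>\<^sup>2 + 3 * d (\<omega> 0))"
            using hh by (simp add: d_def power2_commute)
          finally show ?thesis by (intro mult_left_mono window_weight_nonneg)
        qed
      qed
      also have "\<dots> = 3 * (\<Sum>i\<in>{..l} - {0}. ?w \<omega> i * d (\<omega> i)) + (\<Sum>i\<in>{..l} - {0}. ?w \<omega> i) * (3 * \<eta>\<^sup>2 + 3 * d (\<omega> 0))"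
        by (simp only: distrib_left[of "window_weight _ _ _ _ _"] sum.distrib sum_distrib_left sum_distrib_right mult.left_commute[of _ 3])
      also have "\<dots> \<le> 3 * (\<Sum>i\<in>{..l} - {0}. ?w \<omega> i * d (\<omega> i)) + 1 * (3 * \<eta>\<^sup>2 + 3 * d (\<omega> 0))"
        by (intro add_left_mono mult_right_mono) (auto simp: sum_window_weight d_def)
      finally show ?thesis by simp
    qed
    have "(\<integral>\<omega>. ?v l \<omega> \<partial>S) \<le> (\<integral>\<omega>. 3 * (\<Sum>i\<in>{..l} - {0}. ?w \<omega> i ^ 1 * d (\<omega> i)) + (3 * \<eta>\<^sup>2 + 3 * d (\<omega> 0)) \<partial>S)"
      using pt by (intro integral_mono local_variation_integrable sq Bochner_Integration.integrable_add
          integrable_mult_right weighted_sum_exchange(1)[OF d_int] coord_integrable[OF d_int]) auto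
    also have "\<dots> = 3 * (\<integral>\<omega>. (\<Sum>i\<in>{..l} - {0}. ?w \<omega> i ^ 1 * d (\<omega> i)) \<partial>S) + (3 * \<eta>\<^sup>2 + 3 * (\<integral>x. d x \<partial>\<mu>))"
      unfolding coord_integral[OF borel_measurable_integrable[OF d_int], of 0, symmetric]
      by (rule expectation_affine[OF sample.P.prob_space_axioms weighted_sum_exchange(1)[OF d_int] coord_integrable[OF d_int]])
    also have "\<dots> \<le> 3 * (c * (\<integral>x. d x \<partial>\<mu>)) + (3 * \<eta>\<^sup>2 + 3 * (\<integral>x. d x \<partial>\<mu>))"
      using weighted_mean_le[OF d_int, where l=l and e="\<epsilon> l"] by (simp add: d_def c_def)
    also have "\<dots> = 3 * (c + 1) * (\<integral>x. d x \<partial>\<mu>) + 3 * \<eta>\<^sup>2" by (simp add: algebra_simps)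
    also have "\<dots> \<le> 3 * (c + 1) * \<delta>' + 3 * \<eta>\<^sup>2"
      using d_le c by (intro add_right_mono mult_left_mono) auto
    also have "\<dots> = \<delta> / 2 + \<delta> / 4" using \<delta> c by (simp add: \<delta>'_def \<eta>_def field_simps)
    also have "\<dots> < \<delta>" using \<delta> by simp
    finally have "(\<integral>\<omega>. ?v l \<omega> \<partial>S) < \<delta>" .
    moreover have "0 \<le> (\<integral>\<omega>. ?v l \<omega> \<partial>S)"
      by (intro Bochner_Integration.integral_nonneg sum_nonneg mult_nonneg_nonneg window_weight_nonneg) auto
    ultimately show ?case by simp
  qed
  then show "\<exists>l0. \<forall>l\<ge>l0. norm ((\<integral>\<omega>. ?v l \<omega> \<partial>S) - 0) < \<delta>"
    by (simp add: eventually_sequentially)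
qed

end

text \<open>The assumption \<open>regression\<close> says that \<open>g U\<close> is a version of the conditional mean of \<open>Y\<close> given \<open>U\<close>.\<close>

locale window_regression_model = window_regression \<mu> U for \<mu> :: "'a measure" and U :: "'a \<Rightarrow> real^'m::finite" +
  fixes Y :: "'a \<Rightarrow> real" and g :: "real^'m \<Rightarrow> real"
  assumes Y_measurable [measurable]: "Y \<in> borel_measurable \<mu>"
    and g_measurable [measurable]: "g \<in> borel_measurable borel"
    and Y_square: "integrable \<mu> (\<lambda>x. (Y x)\<^sup>2)"
    and g_square: "integrable \<mu> (\<lambda>x. (g (U x))\<^sup>2)"
    and regression: "\<And>B. B \<in> sets borel \<Longrightarrow>
      (\<integral>x. indicator B (U x) * Y x \<partial>\<mu>) = (\<integral>x. indicator B (U x) * g (U x) \<partial>\<mu>)"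
begin

definition noise :: "'a \<Rightarrow> real" where "noise x = Y x - g (U x)"

lemma noise_measurable [measurable]: "noise \<in> borel_measurable \<mu>"
  unfolding noise_def[abs_def] by measurable

lemma noise_square: "integrable \<mu> (\<lambda>x. (noise x)\<^sup>2)"
  unfolding noise_def by (rule square_integrable_diff[OF Y_square g_square]) measurable

lemma noise_integrable: "integrable \<mu> noise"
  by (rule square_integrable_imp_integrable[OF _ noise_square]) measurable

text \<open>The assumption on indicators says that the conditional expectation of the noise given \<open>U\<close> is zero, and
  a bounded function of \<open>U\<close> can be taken out of that conditional expectation.\<close>

lemma noise_orthogonal:
  assumes [measurable]: "\<phi> \<in> borel_measurable borel" and bound: "\<And>v. \<bar>\<phi> v\<bar> \<le> c"
  shows "(\<integral>x. \<phi> (U x) * noise x \<partial>\<mu>) = 0"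
proof -
  define F where "F = vimage_algebra (space \<mu>) U borel"
  interpret F: finite_measure_subalgebra \<mu> F
  proof unfold_locales
    show "subalgebra \<mu> F"
      unfolding F_def subalgebra_def by (auto simp: sets_vimage_algebra2)
  qed
  have Ug: "integrable \<mu> (\<lambda>x. g (U x))" "integrable \<mu> Y"
    using square_integrable_imp_integrable[OF _ g_square] square_integrable_imp_integrable[OF _ Y_square] by auto
  have "AE x in \<mu>. real_cond_exp \<mu> F noise x = 0"
  proof (rule F.real_cond_exp_charact)
    fix A assume "A \<in> sets F"
    then obtain B where B: "B \<in> sets borel" and A: "A = U -` B \<inter> space \<mu>"
      unfolding F_def by (auto simp: sets_vimage_algebra2)
    have [measurable]: "B \<in> sets borel" by (rule B)
    have int: "integrable \<mu> (\<lambda>x. indicator B (U x) * Y x)" "integrable \<mu> (\<lambda>x. indicator B (U x) * g (U x))"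
      by (rule Bochner_Integration.integrable_bound[OF Ug(2)], measurable, simp add: indicator_def,
          rule Bochner_Integration.integrable_bound[OF Ug(1)], measurable, simp add: indicator_def)
    have "(\<integral>x\<in>A. noise x \<partial>\<mu>) = (\<integral>x. indicator B (U x) * Y x - indicator B (U x) * g (U x) \<partial>\<mu>)"
      unfolding set_lebesgue_integral_def
      by (rule Bochner_Integration.integral_cong) (auto simp: A indicator_def noise_def)
    also have "\<dots> = 0" using int regression[OF B] by simp
    finally show "(\<integral>x\<in>A. noise x \<partial>\<mu>) = (\<integral>x\<in>A. 0 \<partial>\<mu>)" by simp
  qed (auto simp: noise_integrable)
  have \<phi>U: "(\<lambda>x. \<phi> (U x)) \<in> borel_measurable F"
    unfolding F_def by (rule measurable_compose[OF measurable_vimage_algebra1]) auto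
  have "integrable \<mu> (\<lambda>x. \<phi> (U x) * noise x)"
    by (rule Bochner_Integration.integrable_bound[where f="\<lambda>x. c * noise x"])
      (use noise_integrable bound order_trans[OF abs_ge_zero bound] in \<open>auto simp: abs_mult intro!: mult_right_mono\<close>)
  then have "(\<integral>x. \<phi> (U x) * noise x \<partial>\<mu>) = (\<integral>x. \<phi> (U x) * real_cond_exp \<mu> F noise x \<partial>\<mu>)"
    by (rule F.real_cond_exp_intg(2)[symmetric, OF _ \<phi>U noise_measurable])
  also have "\<dots> = (\<integral>x. 0 \<partial>\<mu>)"
    using \<open>AE x in \<mu>. real_cond_exp \<mu> F noise x = 0\<close> by (intro integral_cong_AE) auto
  finally show ?thesis by simp
qed

lemma noise_product_integrable:
  assumes "i \<in> {..l} - {0}" "j \<in> {..l} - {0}"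
  shows "integrable S (\<lambda>\<omega>. (window_weight e l (features \<omega>) 0 i * noise (\<omega> i)) * (window_weight e l (features \<omega>) 0 j * noise (\<omega> j)))"
proof (rule Bochner_Integration.integrable_bound)
  show "integrable S (\<lambda>\<omega>. (noise (\<omega> i))\<^sup>2 + (noise (\<omega> j))\<^sup>2)"
    by (intro Bochner_Integration.integrable_add coord_integrable[OF noise_square])
  have "\<bar>(window_weight e l (features \<omega>) 0 i * noise (\<omega> i)) * (window_weight e l (features \<omega>) 0 j * noise (\<omega> j))\<bar>
      \<le> (noise (\<omega> i))\<^sup>2 + (noise (\<omega> j))\<^sup>2" for \<omega>
  proof -
    have a: "\<bar>window_weight e l (features \<omega>) 0 q * noise (\<omega> q)\<bar> \<le> \<bar>noise (\<omega> q)\<bar>" if "q \<in> {..l} - {0}" for q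
      using that window_weight_le_1[of q l 0 e "features \<omega>"] by (simp add: abs_mult window_weight_nonneg mult_left_le_one_le)
    have "\<bar>(window_weight e l (features \<omega>) 0 i * noise (\<omega> i)) * (window_weight e l (features \<omega>) 0 j * noise (\<omega> j))\<bar>
        \<le> \<bar>noise (\<omega> i)\<bar> * \<bar>noise (\<omega> j)\<bar>"
      unfolding abs_mult[of "_ * noise _"] using assms by (intro mult_mono a) auto
    also have "\<dots> \<le> (noise (\<omega> i))\<^sup>2 + (noise (\<omega> j))\<^sup>2"
      using sum_squares_bound[of "\<bar>noise (\<omega> i)\<bar>" "\<bar>noise (\<omega> j)\<bar>"] zero_le_power2[of "noise (\<omega> i)"]
        zero_le_power2[of "noise (\<omega> j)"] mult_nonneg_nonneg[OF abs_ge_zero abs_ge_zero, of "noise (\<omega> i)" "noise (\<omega> j)"]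
      unfolding power2_abs by linarith
    finally show ?thesis .
  qed
  then show "AE \<omega> in S. norm ((window_weight e l (features \<omega>) 0 i * noise (\<omega> i)) * (window_weight e l (features \<omega>) 0 j * noise (\<omega> j)))
      \<le> norm ((noise (\<omega> i))\<^sup>2 + (noise (\<omega> j))\<^sup>2)" by (intro AE_I2) simp
qed measurable

text \<open>After exchanging the query with point \<open>j\<close>, the noise of \<open>j\<close> sits at index \<open>0\<close>. When all other points are
  fixed, the remaining factor is a bounded function of the feature at index \<open>0\<close>, so the integral over
  that point is zero.\<close>

lemma noise_cross_terms_vanish:
  assumes ij: "i \<in> {..l} - {0}" "j \<in> {..l} - {0}" "i \<noteq> j"
  shows "(\<integral>\<omega>. (window_weight e l (features \<omega>) 0 i * noise (\<omega> i)) * (window_weight e l (features \<omega>) 0 j * noise (\<omega> j)) \<partial>S) = 0"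
proof -
  define \<pi> where "\<pi> = Transposition.transpose 0 j"
  have \<pi>: "\<pi> permutes {..l}" unfolding \<pi>_def using ij by (intro permutes_swap_id) auto
  have \<pi>_simps: "\<pi> 0 = j" "\<pi> j = 0" "\<pi> i = i"
    using ij by (auto simp: \<pi>_def)
  define f where "f \<omega> = (window_weight e l (features \<omega>) 0 i * noise (\<omega> i)) * (window_weight e l (features \<omega>) 0 j * noise (\<omega> j))" for \<omega>
  define G where "G \<omega> = (window_weight e l (features \<omega>) j i * noise (\<omega> i)) * (window_weight e l (features \<omega>) j 0 * noise (\<omega> 0))" for \<omega>
  have f_int: "integrable S f" unfolding f_def using ij by (intro noise_product_integrable)
  have f_swap: "f (\<lambda>i. \<omega> (\<pi> i)) = G \<omega>" for \<omega>
    by (simp add: f_def G_def window_weight_permute[OF \<pi>, where u="\<lambda>i. U (\<omega> i)"] \<pi>_simps)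
  have [measurable]: "G \<in> borel_measurable S" unfolding G_def[abs_def] by measurable
  have G_int: "integrable S G"
    using integrable_distr[OF permute_measurable, of \<pi> f] f_int by (simp add: distr_permute[OF permutes_inj[OF \<pi>]] f_swap)
  have "(\<integral>\<omega>. f \<omega> \<partial>S) = (\<integral>\<omega>. G \<omega> \<partial>S)"
    using integral_permute[OF permutes_inj[OF \<pi>], of f] f_int by (simp add: f_swap)
  also have "\<dots> = (\<integral>z. G (case_nat (fst z) (snd z)) \<partial>(\<mu> \<Otimes>\<^sub>M S))"
  proof -
    have "(\<integral>\<omega>. G \<omega> \<partial>S) = (\<integral>\<omega>. G \<omega> \<partial>(distr (\<mu> \<Otimes>\<^sub>M S) S (\<lambda>(s, \<omega>). case_nat s \<omega>)))"
      by (simp only: sample.PiM_iter)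
    also have "\<dots> = (\<integral>z. G ((\<lambda>(s, \<omega>). case_nat s \<omega>) z) \<partial>(\<mu> \<Otimes>\<^sub>M S))"
      by (rule integral_distr) (auto intro!: measurable_case_nat' simp: split_beta')
    finally show ?thesis by (simp add: split_beta')
  qed
  also have "\<dots> = (\<integral>\<omega>. (\<integral>s. G (case_nat s \<omega>) \<partial>\<mu>) \<partial>S)"
  proof -
    interpret pair_sigma_finite \<mu> S by unfold_locales
    have "(\<lambda>(s, \<omega>). case_nat s \<omega>) \<in> \<mu> \<Otimes>\<^sub>M S \<rightarrow>\<^sub>M S"
      by (auto intro!: measurable_case_nat' simp: split_beta')
    moreover have "integrable (distr (\<mu> \<Otimes>\<^sub>M S) S (\<lambda>(s, \<omega>). case_nat s \<omega>)) G"
      using G_int by (simp only: sample.PiM_iter)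
    ultimately have "integrable (\<mu> \<Otimes>\<^sub>M S) (\<lambda>z. G ((\<lambda>(s, \<omega>). case_nat s \<omega>) z))"
      by (rule integrable_distr)
    then show ?thesis
      using integral_snd[of "\<lambda>s \<omega>. G (case_nat s \<omega>)"] by (simp add: split_beta')
  qed
  also have "\<dots> = (\<integral>\<omega>. 0 \<partial>S)"
  proof (rule Bochner_Integration.integral_cong[OF refl])
    fix \<omega>
    obtain i' where i': "i = Suc i'" using ij by (cases i) auto
    define u where "u v q = case_nat v (\<lambda>q. U (\<omega> q)) q" for v q
    define \<phi> where "\<phi> v = window_weight e l (u v) j i * window_weight e l (u v) j 0 * noise (\<omega> i')" for v
    have u: "features (case_nat s \<omega>) = u (U s)" for s
      by (auto simp: u_def split: nat.split)
    have [measurable]: "(\<lambda>v. u v q) \<in> borel_measurable borel" for q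
      by (cases q) (auto simp: u_def)
    have "(\<integral>s. G (case_nat s \<omega>) \<partial>\<mu>) = (\<integral>s. \<phi> (U s) * noise s \<partial>\<mu>)"
      unfolding G_def u \<phi>_def i' by (simp add: mult_ac)
    also have "\<dots> = 0"
    proof (rule noise_orthogonal)
      show "\<phi> \<in> borel_measurable borel" unfolding \<phi>_def[abs_def] by measurable
      fix v
      have "window_weight e l (u v) j i * window_weight e l (u v) j 0 \<le> 1"
        using ij by (intro mult_le_one window_weight_le_1 window_weight_nonneg) auto
      then show "\<bar>\<phi> v\<bar> \<le> \<bar>noise (\<omega> i')\<bar>"
        by (simp add: \<phi>_def abs_mult window_weight_nonneg mult_left_le_one_le)
    qed
    finally show "(\<integral>s. G (case_nat s \<omega>) \<partial>\<mu>) = 0" .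
  qed
  finally show ?thesis by (simp add: f_def)
qed

lemma noise_variance:
  "integrable S (\<lambda>\<omega>. (\<Sum>i\<in>{..l} - {0}. window_weight e l (features \<omega>) 0 i * noise (\<omega> i))\<^sup>2)"
  "(\<integral>\<omega>. (\<Sum>i\<in>{..l} - {0}. window_weight e l (features \<omega>) 0 i * noise (\<omega> i))\<^sup>2 \<partial>S)
   = (\<integral>\<omega>. (\<Sum>i\<in>{..l} - {0}. (window_weight e l (features \<omega>) i 0)\<^sup>2) * (noise (\<omega> 0))\<^sup>2 \<partial>S)"
proof -
  let ?I = "{..l} - {0}"
  define a where "a \<omega> i = window_weight e l (features \<omega>) 0 i * noise (\<omega> i)" for \<omega> i
  have int: "integrable S (\<lambda>\<omega>. a \<omega> i * a \<omega> j)" if "i \<in> ?I" "j \<in> ?I" for i j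
    unfolding a_def using noise_product_integrable[OF that] .
  show "integrable S (\<lambda>\<omega>. (\<Sum>i\<in>?I. window_weight e l (features \<omega>) 0 i * noise (\<omega> i))\<^sup>2)"
    using int unfolding power2_eq_square sum_product a_def by (intro Bochner_Integration.integrable_sum)
  have "(\<integral>\<omega>. (\<Sum>i\<in>?I. a \<omega> i)\<^sup>2 \<partial>S) = (\<Sum>i\<in>?I. \<Sum>j\<in>?I. \<integral>\<omega>. a \<omega> i * a \<omega> j \<partial>S)"
    unfolding power2_eq_square sum_product
    by (subst Bochner_Integration.integral_sum)
      (auto intro!: Bochner_Integration.integrable_sum int sum.cong Bochner_Integration.integral_sum)
  also have "\<dots> = (\<Sum>i\<in>?I. \<Sum>j\<in>?I. if j = i then \<integral>\<omega>. a \<omega> i * a \<omega> i \<partial>S else 0)"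
    by (intro sum.cong refl) (auto simp: a_def intro!: noise_cross_terms_vanish)
  also have "\<dots> = (\<Sum>i\<in>?I. \<integral>\<omega>. a \<omega> i * a \<omega> i \<partial>S)"
    by (simp add: sum.delta)
  also have "\<dots> = (\<integral>\<omega>. (\<Sum>i\<in>?I. (window_weight e l (features \<omega>) 0 i)\<^sup>2 * (noise (\<omega> i))\<^sup>2) \<partial>S)"
    using int by (subst Bochner_Integration.integral_sum) (auto simp: a_def power2_eq_square mult_ac)
  also have "\<dots> = (\<integral>\<omega>. (\<Sum>i\<in>?I. (window_weight e l (features \<omega>) i 0)\<^sup>2) * (noise (\<omega> 0))\<^sup>2 \<partial>S)"
    by (rule weighted_sum_exchange(2)[OF noise_square])
  finally show "(\<integral>\<omega>. (\<Sum>i\<in>?I. window_weight e l (features \<omega>) 0 i * noise (\<omega> i))\<^sup>2 \<partial>S)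
    = (\<integral>\<omega>. (\<Sum>i\<in>?I. (window_weight e l (features \<omega>) i 0)\<^sup>2) * (noise (\<omega> 0))\<^sup>2 \<partial>S)" by (simp add: a_def)
qed

abbreviation estimate :: "real \<Rightarrow> nat \<Rightarrow> (nat \<Rightarrow> 'a) \<Rightarrow> real" where
  "estimate e l \<omega> \<equiv> window_mean e l (features \<omega>) (\<lambda>i. Y (\<omega> i))"

text \<open>Of the weights received by the query, the sum of squares is bounded, and its expectation equals that of
  the sum of squares of the weights which the query gives. The latter is at most \<open>2 / (N + 1)\<close>.\<close>

lemma noise_variance_tendsto_0:
  assumes inv: "(\<lambda>l. \<integral>\<omega>. 1 / (nbr_count (\<epsilon> l) l (features \<omega>) 0 + 1) \<partial>S) \<longlonglongrightarrow> 0"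
  shows "(\<lambda>l. \<integral>\<omega>. (\<Sum>i\<in>{..l} - {0}. window_weight (\<epsilon> l) l (features \<omega>) 0 i * noise (\<omega> i))\<^sup>2 \<partial>S) \<longlonglongrightarrow> 0"
proof -
  define V where "V l \<omega> = (\<Sum>i\<in>{..l} - {0}. (window_weight (\<epsilon> l) l (features \<omega>) i 0)\<^sup>2)" for l \<omega>
  have V_nonneg: "0 \<le> V l \<omega>" for l \<omega> unfolding V_def by (intro sum_nonneg) auto
  have V_le: "V l \<omega> \<le> 2 ^ CARD('m)" for l \<omega>
  proof -
    have "V l \<omega> \<le> (\<Sum>i\<in>{..l} - {0}. window_weight (\<epsilon> l) l (features \<omega>) i 0)"
      unfolding V_def power2_eq_square
      by (intro sum_mono mult_left_le window_weight_le_1 window_weight_nonneg) auto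
    also have "\<dots> \<le> 2 ^ CARD('m)" by (rule sum_weights_at_point_le) simp
    finally show ?thesis .
  qed
  have [measurable]: "V l \<in> borel_measurable S" for l unfolding V_def[abs_def] by measurable
  have V_int: "integrable S (V l)" for l
    by (rule sample.P.integrable_const_bound[of _ "2 ^ CARD('m)"]) (use V_nonneg V_le in auto)
  have V_mean: "(\<integral>\<omega>. V l \<omega> \<partial>S) \<le> 2 * (\<integral>\<omega>. 1 / (nbr_count (\<epsilon> l) l (features \<omega>) 0 + 1) \<partial>S)" for l
  proof -
    have one: "integrable \<mu> (\<lambda>_. 1 :: real)" by simp
    have "(\<integral>\<omega>. V l \<omega> \<partial>S) = (\<integral>\<omega>. (\<Sum>i\<in>{..l} - {0}. (window_weight (\<epsilon> l) l (features \<omega>) 0 i)\<^sup>2) \<partial>S)"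
      using weighted_sum_exchange(2)[OF one, where p=2 and l=l and e="\<epsilon> l"] by (simp add: V_def)
    also have "\<dots> \<le> (\<integral>\<omega>. 2 * (1 / (nbr_count (\<epsilon> l) l (features \<omega>) 0 + 1)) \<partial>S)"
      using weighted_sum_exchange(1)[OF one, where p=2 and l=l and e="\<epsilon> l"] sum_window_weight_square_le
      by (intro integral_mono integrable_mult_right integrable_inverse_nbr_count) auto
    also have "\<dots> = 2 * (\<integral>\<omega>. 1 / (nbr_count (\<epsilon> l) l (features \<omega>) 0 + 1) \<partial>S)"
      by (rule integral_mult_right_zero)
    finally show ?thesis .
  qed
  have "(\<lambda>l. \<integral>\<omega>. V l \<omega> \<partial>S) \<longlonglongrightarrow> 0"
  proof (rule tendsto_sandwich[OF _ _ tendsto_const])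
    show "(\<lambda>l. 2 * (\<integral>\<omega>. 1 / (nbr_count (\<epsilon> l) l (features \<omega>) 0 + 1) \<partial>S)) \<longlonglongrightarrow> 0"
      using tendsto_mult_left[OF inv, of 2] by simp
  qed (use V_mean V_nonneg in \<open>auto intro!: Bochner_Integration.integral_nonneg always_eventually\<close>)
  then have "(\<lambda>l. \<integral>\<omega>. V l \<omega> * (noise (\<omega> 0))\<^sup>2 \<partial>S) \<longlonglongrightarrow> 0"
    using integral_vanishing_weight[OF coord_integrable[OF noise_square, of 0], of V "2 ^ CARD('m)"]
      V_nonneg V_le V_int by simp
  then show ?thesis by (simp add: noise_variance(2) V_def)
qed

text \<open>If \<open>N = 0\<close> then \<open>1 / (N + 1) = 1\<close>, so the probability of an isolated query is at most the expectation of
  \<open>1 / (N + 1)\<close>.\<close>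

lemma isolation_tendsto_0:
  assumes inv: "(\<lambda>l. \<integral>\<omega>. 1 / (nbr_count (\<epsilon> l) l (features \<omega>) 0 + 1) \<partial>S) \<longlonglongrightarrow> 0"
  shows "(\<lambda>l. \<integral>\<omega>. of_bool (nbr_count (\<epsilon> l) l (features \<omega>) 0 = 0) * (g (U (\<omega> 0)))\<^sup>2 \<partial>S) \<longlonglongrightarrow> 0"
proof -
  define V where "V l \<omega> = (of_bool (nbr_count (\<epsilon> l) l (features \<omega>) 0 = 0) :: real)" for l \<omega>
  have [measurable]: "V l \<in> borel_measurable S" for l unfolding V_def[abs_def] by measurable
  have V_int: "integrable S (V l)" for l
    by (rule sample.P.integrable_const_bound[of _ 1]) (auto simp: V_def)
  have "(\<lambda>l. \<integral>\<omega>. V l \<omega> \<partial>S) \<longlonglongrightarrow> 0"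
  proof (rule tendsto_sandwich[OF _ _ tendsto_const inv])
    show "\<forall>\<^sub>F l in sequentially. (\<integral>\<omega>. V l \<omega> \<partial>S) \<le> (\<integral>\<omega>. 1 / (nbr_count (\<epsilon> l) l (features \<omega>) 0 + 1) \<partial>S)"
      by (intro always_eventually allI integral_mono V_int integrable_inverse_nbr_count) (auto simp: V_def nbr_count_nonneg)
  qed (auto simp: V_def intro!: Bochner_Integration.integral_nonneg always_eventually)
  moreover have "0 \<le> V l \<omega>" "V l \<omega> \<le> 1" for l \<omega> by (auto simp: V_def)
  ultimately have "(\<lambda>l. \<integral>\<omega>. V l \<omega> * (g (U (\<omega> 0)))\<^sup>2 \<partial>S) \<longlonglongrightarrow> 0"
    using integral_vanishing_weight[OF coord_integrable[OF g_square, of 0], of V 1] V_int by simp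
  then show ?thesis by (simp add: V_def)
qed

theorem estimate_consistent:
  assumes pos: "\<And>l. l \<ge> 1 \<Longrightarrow> \<epsilon> l > 0" and small: "\<epsilon> \<longlonglongrightarrow> 0"
    and large: "filterlim (\<lambda>l. real l * \<epsilon> l ^ CARD('m)) at_top sequentially"
  shows "(\<lambda>l. \<integral>\<^sup>+\<omega>. ennreal ((estimate (\<epsilon> l) l \<omega> - g (U (\<omega> 0)))\<^sup>2) \<partial>S) \<longlonglongrightarrow> 0"
proof -
  define a where "a l \<omega> = (\<Sum>i\<in>{..l} - {0}. window_weight (\<epsilon> l) l (features \<omega>) 0 i * noise (\<omega> i))\<^sup>2" for l \<omega>
  define b where "b l \<omega> = (\<Sum>i\<in>{..l} - {0}. window_weight (\<epsilon> l) l (features \<omega>) 0 i * (g (U (\<omega> i)) - g (U (\<omega> 0)))\<^sup>2)" for l \<omega>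
  define c where "c l \<omega> = of_bool (nbr_count (\<epsilon> l) l (features \<omega>) 0 = 0) * (g (U (\<omega> 0)))\<^sup>2" for l \<omega>
  note inv = mean_inverse_nbr_count_tendsto_0[OF pos small large]
  have int: "integrable S (a l)" "integrable S (b l)" "integrable S (c l)" for l
  proof -
    show "integrable S (a l)" unfolding a_def by (rule noise_variance)
    show "integrable S (b l)" unfolding b_def by (rule local_variation_integrable[OF g_measurable g_square])
    show "integrable S (c l)" unfolding c_def[abs_def]
      by (rule Bochner_Integration.integrable_bound[OF coord_integrable[OF g_square, of 0]]) auto
  qed
  have nonneg: "0 \<le> a l \<omega>" "0 \<le> b l \<omega>" "0 \<le> c l \<omega>" for l \<omega>
    by (auto simp: a_def b_def c_def intro!: sum_nonneg mult_nonneg_nonneg window_weight_nonneg)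
  have pt: "(estimate (\<epsilon> l) l \<omega> - g (U (\<omega> 0)))\<^sup>2 \<le> 3 * (a l \<omega> + b l \<omega> + c l \<omega>)" for l \<omega>
  proof -
    let ?w = "\<lambda>i. window_weight (\<epsilon> l) l (features \<omega>) 0 i" and ?I = "{..l} - {0}"
    define p q s where "p = (\<Sum>i\<in>?I. ?w i * noise (\<omega> i))" and "q = (\<Sum>i\<in>?I. ?w i * (g (U (\<omega> i)) - g (U (\<omega> 0))))"
      and "s = of_bool (nbr_count (\<epsilon> l) l (features \<omega>) 0 = 0) * g (U (\<omega> 0))"
    have "estimate (\<epsilon> l) l \<omega> = p + q + (\<Sum>i\<in>?I. ?w i) * g (U (\<omega> 0))"
      unfolding window_mean_def p_def q_def noise_def
      by (simp add: algebra_simps sum.distrib sum_subtractf sum_distrib_left)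
    then have eq: "estimate (\<epsilon> l) l \<omega> - g (U (\<omega> 0)) = p + q - s"
      by (simp add: sum_window_weight s_def)
    have "q\<^sup>2 \<le> b l \<omega>"
      unfolding q_def b_def by (rule weighted_square_le) (auto simp: window_weight_nonneg sum_window_weight)
    moreover have "p\<^sup>2 = a l \<omega>" "s\<^sup>2 = c l \<omega>" by (auto simp: p_def a_def s_def c_def)
    moreover have "(p + q - s)\<^sup>2 \<le> 3 * (p\<^sup>2 + q\<^sup>2 + s\<^sup>2)"
      using sum_squares_ge_zero[of "p - q" "q + s"] zero_le_power2[of "p + s"]
      by (simp add: power2_eq_square algebra_simps)
    ultimately show ?thesis unfolding eq by (simp add: order_trans)
  qed
  have le: "(\<integral>\<^sup>+\<omega>. ennreal ((estimate (\<epsilon> l) l \<omega> - g (U (\<omega> 0)))\<^sup>2) \<partial>S)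
      \<le> ennreal (3 * ((\<integral>\<omega>. a l \<omega> \<partial>S) + (\<integral>\<omega>. b l \<omega> \<partial>S) + (\<integral>\<omega>. c l \<omega> \<partial>S)))" for l
  proof -
    have "(\<integral>\<^sup>+\<omega>. ennreal ((estimate (\<epsilon> l) l \<omega> - g (U (\<omega> 0)))\<^sup>2) \<partial>S)
        \<le> (\<integral>\<^sup>+\<omega>. ennreal (3 * (a l \<omega> + b l \<omega> + c l \<omega>)) \<partial>S)"
      by (intro nn_integral_mono ennreal_leI pt)
    also have "\<dots> = ennreal (\<integral>\<omega>. 3 * (a l \<omega> + b l \<omega> + c l \<omega>) \<partial>S)"
      using int nonneg by (intro nn_integral_eq_integral) (auto intro!: integrable_mult_right)
    also have "(\<integral>\<omega>. 3 * (a l \<omega> + b l \<omega> + c l \<omega>) \<partial>S)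
        = 3 * ((\<integral>\<omega>. a l \<omega> \<partial>S) + (\<integral>\<omega>. b l \<omega> \<partial>S) + (\<integral>\<omega>. c l \<omega> \<partial>S))"
      using int by simp
    finally show ?thesis .
  qed
  have "(\<lambda>l. 3 * ((\<integral>\<omega>. a l \<omega> \<partial>S) + (\<integral>\<omega>. b l \<omega> \<partial>S) + (\<integral>\<omega>. c l \<omega> \<partial>S))) \<longlonglongrightarrow> 3 * (0 + 0 + 0)"
    unfolding a_def b_def c_def
    by (intro tendsto_mult tendsto_add tendsto_const noise_variance_tendsto_0[OF inv] isolation_tendsto_0[OF inv]
        local_variation_tendsto_0[OF g_measurable g_square small])
  then have lim: "(\<lambda>l. ennreal (3 * ((\<integral>\<omega>. a l \<omega> \<partial>S) + (\<integral>\<omega>. b l \<omega> \<partial>S) + (\<integral>\<omega>. c l \<omega> \<partial>S)))) \<longlonglongrightarrow> 0"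
    using tendsto_ennrealI by fastforce
  show ?thesis
    by (rule tendsto_sandwich[OF always_eventually always_eventually tendsto_const lim]) (use le in auto)
qed

text \<open>This bound is uniform in the window and in the sample size, which makes it the dominating function
  when the error is integrated over the data of the machines.\<close>

lemma estimate_error_bound:
  "(\<integral>\<^sup>+\<omega>. ennreal ((estimate e l \<omega> - g (U (\<omega> 0)))\<^sup>2) \<partial>S)
    \<le> ennreal (2 * 2 ^ CARD('m) * (\<integral>x. (Y x)\<^sup>2 \<partial>\<mu>) + 2 * (\<integral>x. (g (U x))\<^sup>2 \<partial>\<mu>))"
proof -
  let ?A = "\<lambda>\<omega>. \<Sum>i\<in>{..l} - {0}. window_weight e l (features \<omega>) 0 i ^ 1 * (Y (\<omega> i))\<^sup>2"
  have pt: "(estimate e l \<omega> - g (U (\<omega> 0)))\<^sup>2 \<le> 2 * ?A \<omega> + 2 * (g (U (\<omega> 0)))\<^sup>2" for \<omega>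
  proof -
    have "(estimate e l \<omega>)\<^sup>2 \<le> ?A \<omega>"
      unfolding window_mean_def power_one_right by (rule weighted_square_le) (auto simp: window_weight_nonneg sum_window_weight)
    moreover have "(estimate e l \<omega> - g (U (\<omega> 0)))\<^sup>2 \<le> 2 * (estimate e l \<omega>)\<^sup>2 + 2 * (g (U (\<omega> 0)))\<^sup>2"
      using zero_le_power2[of "estimate e l \<omega> + g (U (\<omega> 0))"] by (simp add: power2_eq_square algebra_simps)
    ultimately show ?thesis by linarith
  qed
  have int: "integrable S ?A" "integrable S (\<lambda>\<omega>. (g (U (\<omega> 0)))\<^sup>2)"
    by (rule weighted_sum_exchange(1)[OF Y_square], rule coord_integrable[OF g_square])
  have "(\<integral>\<^sup>+\<omega>. ennreal ((estimate e l \<omega> - g (U (\<omega> 0)))\<^sup>2) \<partial>S) \<le> (\<integral>\<^sup>+\<omega>. ennreal (2 * ?A \<omega> + 2 * (g (U (\<omega> 0)))\<^sup>2) \<partial>S)"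
    by (intro nn_integral_mono ennreal_leI pt)
  also have "\<dots> = ennreal (\<integral>\<omega>. 2 * ?A \<omega> + 2 * (g (U (\<omega> 0)))\<^sup>2 \<partial>S)"
    by (intro nn_integral_eq_integral Bochner_Integration.integrable_add integrable_mult_right int)
      (auto intro!: add_nonneg_nonneg sum_nonneg mult_nonneg_nonneg window_weight_nonneg)
  finally have "(\<integral>\<^sup>+\<omega>. ennreal ((estimate e l \<omega> - g (U (\<omega> 0)))\<^sup>2) \<partial>S)
      \<le> ennreal (\<integral>\<omega>. 2 * ?A \<omega> + 2 * (g (U (\<omega> 0)))\<^sup>2 \<partial>S)" .
  moreover have "(\<integral>\<omega>. 2 * ?A \<omega> + 2 * (g (U (\<omega> 0)))\<^sup>2 \<partial>S)
      = 2 * (\<integral>\<omega>. ?A \<omega> \<partial>S) + 2 * (\<integral>\<omega>. (g (U (\<omega> 0)))\<^sup>2 \<partial>S)"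
    using expectation_affine[OF sample.P.prob_space_axioms int, of 2 0 2] by simp
  moreover have "(\<integral>\<omega>. (g (U (\<omega> 0)))\<^sup>2 \<partial>S) = (\<integral>x. (g (U x))\<^sup>2 \<partial>\<mu>)"
    by (rule coord_integral) measurable
  moreover have "(\<integral>\<omega>. ?A \<omega> \<partial>S) \<le> 2 ^ CARD('m) * (\<integral>x. (Y x)\<^sup>2 \<partial>\<mu>)"
    using weighted_mean_le[OF Y_square, where l=l and e=e] by simp
  ultimately show ?thesis
    by (elim order_trans) (intro ennreal_leI, simp)
qed

end

section \<open>Conditional means and independent samples\<close>

lemma vimage_subalgebra:
  assumes "prob_space P" "V \<in> measurable P N"
  shows "sigma_finite_subalgebra P (vimage_algebra (space P) V N)"
proof (rule finite_measure_subalgebra_is_sigma_finite)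
  interpret prob_space P by fact
  show "finite_measure_subalgebra P (vimage_algebra (space P) V N)"
  proof unfold_locales
    show "subalgebra P (vimage_algebra (space P) V N)"
      unfolding subalgebra_def using assms(2) by (auto simp: sets_vimage_algebra2 measurable_space)
  qed
qed

lemma cond_mean_version_orthogonal:
  assumes P: "prob_space P" and V[measurable]: "V \<in> measurable P N" and Y[measurable]: "Y \<in> borel_measurable P"
    and g: "cond_mean_version P Y N V g"
    and \<phi>[measurable]: "\<phi> \<in> borel_measurable N" and int: "integrable P (\<lambda>\<omega>. \<phi> (V \<omega>) * Y \<omega>)"
  shows "integrable P (\<lambda>\<omega>. \<phi> (V \<omega>) * g (V \<omega>))" (is ?I)
    and "(\<integral>\<omega>. \<phi> (V \<omega>) * g (V \<omega>) \<partial>P) = (\<integral>\<omega>. \<phi> (V \<omega>) * Y \<omega> \<partial>P)" (is ?E)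
proof -
  let ?F = "vimage_algebra (space P) V N"
  interpret F: sigma_finite_subalgebra P ?F using P V by (rule vimage_subalgebra)
  have [measurable]: "g \<in> borel_measurable N" using g by (simp add: cond_mean_version_def)
  have \<phi>V: "(\<lambda>\<omega>. \<phi> (V \<omega>)) \<in> borel_measurable ?F"
    using measurable_space[OF V] by (intro measurable_compose[OF measurable_vimage_algebra1 \<phi>]) auto
  have ae: "AE \<omega> in P. \<phi> (V \<omega>) * g (V \<omega>) = \<phi> (V \<omega>) * real_cond_exp P ?F Y \<omega>"
    using g by (auto simp: cond_mean_version_def)
  show ?I
    using F.real_cond_exp_intg(1)[OF int \<phi>V Y] ae by (subst integrable_cong_AE[OF _ _ ae]) auto
  show ?E
    using F.real_cond_exp_intg(2)[OF int \<phi>V Y] ae by (subst integral_cong_AE[OF _ _ ae]) auto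
qed

text \<open>Conditional Jensen inequality for the square.\<close>

lemma cond_mean_version_square_integrable:
  assumes P: "prob_space P" and V[measurable]: "V \<in> measurable P N" and Y[measurable]: "Y \<in> borel_measurable P"
    and sq: "integrable P (\<lambda>\<omega>. (Y \<omega>)\<^sup>2)" and g: "cond_mean_version P Y N V g"
  shows "integrable P (\<lambda>\<omega>. (g (V \<omega>))\<^sup>2)"
proof -
  let ?F = "vimage_algebra (space P) V N"
  interpret prob_space P by fact
  interpret F: sigma_finite_subalgebra P ?F using P V by (rule vimage_subalgebra)
  have [measurable]: "g \<in> borel_measurable N" using g by (simp add: cond_mean_version_def)
  have "integrable P Y" by (rule square_integrable_imp_integrable[OF Y sq])
  then have int: "integrable P (\<lambda>\<omega>. (real_cond_exp P ?F Y \<omega>)\<^sup>2)"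
    using sq by (intro F.integrable_convex_cond_exp[where I=UNIV and q="\<lambda>x. x\<^sup>2"])
      (auto simp: emeasure_space_1 convex_power2)
  have ae: "AE \<omega> in P. (g (V \<omega>))\<^sup>2 = (real_cond_exp P ?F Y \<omega>)\<^sup>2"
    using g by (auto simp: cond_mean_version_def)
  show ?thesis using int by (subst integrable_cong_AE[OF _ _ ae]) auto
qed

text \<open>The query is placed in front of the second part of the sample, as index \<open>0\<close>, so that both together form
  one i.i.d. sequence that is independent of the first part.\<close>

lemma split_sample_law:
  fixes Z :: "nat \<Rightarrow> 'w \<Rightarrow> 'b" and W :: "'w \<Rightarrow> 'b"
  assumes P: "prob_space P" and indep: "prob_space.indep_vars P (\<lambda>_. N) (case_option W Z) UNIV"
    and ident: "\<And>i. distr P N (Z i) = distr P N W"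
  shows "prob_space.indep_var P (PiM {..<k} (\<lambda>_. N)) (\<lambda>\<omega>. \<lambda>i\<in>{..<k}. Z i \<omega>)
            (PiM UNIV (\<lambda>_. N)) (\<lambda>\<omega>. case_nat (W \<omega>) (\<lambda>i. Z (k + i) \<omega>))" (is ?indep)
    and "distr P (PiM UNIV (\<lambda>_. N)) (\<lambda>\<omega>. case_nat (W \<omega>) (\<lambda>i. Z (k + i) \<omega>)) = PiM UNIV (\<lambda>_. distr P N W)" (is ?law)
proof -
  interpret prob_space P by fact
  define X where "X = case_option W Z"
  define A where "A = Some ` {..<k}"
  define h :: "nat \<Rightarrow> nat option" where "h = case_nat None (\<lambda>i. Some (k + i))"
  have h_not_A: "h n \<in> - A" for n by (auto simp: h_def A_def split: nat.split)
  have seq: "case_nat (W \<omega>) (\<lambda>i. Z (k + i) \<omega>) = (\<lambda>n. X (h n) \<omega>)" for \<omega>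
    by (auto simp: X_def h_def fun_eq_iff split: nat.split)
  have indepX: "indep_vars (\<lambda>_. N) X UNIV" using indep by (simp add: X_def)
  have rv[measurable]: "X i \<in> measurable P N" for i
    using indepX by (auto simp: indep_vars_def)
  have 1: "indep_var (PiM A (\<lambda>_. N)) (\<lambda>\<omega>. \<lambda>i\<in>A. X i \<omega>) (PiM (-A) (\<lambda>_. N)) (\<lambda>\<omega>. \<lambda>i\<in>-A. X i \<omega>)"
    using indepX by (intro indep_var_restrict) auto
  have Y1: "(\<lambda>x. \<lambda>i\<in>{..<k}. x (Some i)) \<in> measurable (PiM A (\<lambda>_. N)) (PiM {..<k} (\<lambda>_. N))"
    by (intro measurable_restrict measurable_component_singleton) (auto simp: A_def)
  have Y2: "(\<lambda>x n. x (h n)) \<in> measurable (PiM (-A) (\<lambda>_. N)) (PiM UNIV (\<lambda>_. N))"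
    using h_not_A by (intro measurable_PiM_single') (auto intro!: measurable_component_singleton simp: space_PiM PiE_iff)
  have "indep_var (PiM {..<k} (\<lambda>_. N)) ((\<lambda>x. \<lambda>i\<in>{..<k}. x (Some i)) \<circ> (\<lambda>\<omega>. \<lambda>i\<in>A. X i \<omega>))
     (PiM UNIV (\<lambda>_. N)) ((\<lambda>x n. x (h n)) \<circ> (\<lambda>\<omega>. \<lambda>i\<in>-A. X i \<omega>))"
    by (rule indep_var_compose[OF 1 Y1 Y2])
  moreover have "(\<lambda>x. \<lambda>i\<in>{..<k}. x (Some i)) \<circ> (\<lambda>\<omega>. \<lambda>i\<in>A. X i \<omega>) = (\<lambda>\<omega>. \<lambda>i\<in>{..<k}. Z i \<omega>)"
    by (auto simp: fun_eq_iff A_def X_def)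
  moreover have "(\<lambda>x n. x (h n)) \<circ> (\<lambda>\<omega>. \<lambda>i\<in>-A. X i \<omega>) = (\<lambda>\<omega> n. X (h n) \<omega>)"
    using h_not_A by (auto simp: fun_eq_iff)
  ultimately show ?indep by (simp add: seq)
  have law_i: "distr P N (X i) = distr P N W" for i
    using ident by (cases i) (auto simp: X_def)
  have all: "distr P (PiM UNIV (\<lambda>_. N)) (\<lambda>\<omega>. \<lambda>i\<in>UNIV. X i \<omega>) = PiM UNIV (\<lambda>i. distr P N (X i))"
    using indepX by (subst indep_vars_iff_distr_eq_PiM[symmetric]) auto
  have X_meas: "(\<lambda>\<omega> i. X i \<omega>) \<in> measurable P (PiM UNIV (\<lambda>_. N))"
    using rv measurable_space[OF rv] by (intro measurable_PiM_single') (auto simp: space_PiM PiE_iff)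
  have h_meas: "(\<lambda>x n. x (h n)) \<in> measurable (PiM UNIV (\<lambda>_. N)) (PiM UNIV (\<lambda>_. N))"
    by (intro measurable_PiM_single') (auto simp: space_PiM PiE_iff)
  have "distr P (PiM UNIV (\<lambda>_. N)) (\<lambda>\<omega> n. X (h n) \<omega>)
      = distr (distr P (PiM UNIV (\<lambda>_. N)) (\<lambda>\<omega> i. X i \<omega>)) (PiM UNIV (\<lambda>_. N)) (\<lambda>x n. x (h n))"
    by (subst distr_distr[OF h_meas X_meas]) (simp add: comp_def)
  also have "\<dots> = distr (PiM UNIV (\<lambda>_. distr P N W)) (PiM UNIV (\<lambda>_. distr P N W)) (\<lambda>x n. x (h n))"
    using all by (intro distr_cong) (auto simp: law_i restrict_def intro!: sets_PiM_cong)
  also have "\<dots> = PiM UNIV (\<lambda>_. distr P N W)"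
  proof -
    have "inj h" by (auto simp: inj_on_def h_def split: nat.splits)
    moreover have "prob_space (distr P N W)"
      using rv[of None] by (intro prob_space_distr) (simp add: X_def)
    ultimately show ?thesis
      using distr_PiM_reindex[of UNIV "\<lambda>_. distr P N W" h UNIV] by (simp add: restrict_def)
  qed
  finally show ?law by (simp add: seq)
qed

text \<open>Finite intersections of members of a countable basis of the topology; the empty intersection
  contributes \<open>UNIV\<close>.\<close>

lemma countable_borel_generator:
  obtains G :: "'a::second_countable_topology set set"
  where "countable G" "Int_stable G" "UNIV \<in> G" "sets borel = sigma_sets UNIV G"
proof -
  obtain B :: "'a set set" where B: "countable B" "topological_basis B"
    using ex_countable_basis by blast
  define G where "G = Inter ` {A. finite A \<and> A \<subseteq> B}"
  have "countable G" unfolding G_def by (intro countable_image countable_Collect_finite_subset B(1))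
  moreover have "Int_stable G"
  proof (rule Int_stableI)
    fix a b assume "a \<in> G" "b \<in> G"
    then obtain A A' where "a = \<Inter>A" "b = \<Inter>A'" "finite (A \<union> A')" "A \<union> A' \<subseteq> B"
      unfolding G_def by auto
    then show "a \<inter> b \<in> G"
      unfolding G_def by (intro image_eqI[of _ _ "A \<union> A'"]) (auto simp: Inter_Un_distrib)
  qed
  moreover have "UNIV \<in> G" unfolding G_def by (auto intro!: image_eqI[of _ _ "{}"])
  moreover have "sets borel = sigma_sets UNIV G"
  proof
    have "sets borel = sigma_sets UNIV B"
      by (simp add: borel_eq_countable_basis[OF B])
    moreover have "B \<subseteq> G" unfolding G_def by (auto intro!: image_eqI[of _ _ "{_}"])
    ultimately show "sets borel \<subseteq> sigma_sets UNIV G" by (simp add: sigma_sets_mono')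
    have "G \<subseteq> sets borel"
    proof
      fix C assume "C \<in> G"
      then obtain A where "C = \<Inter>A" "finite A" "A \<subseteq> B" unfolding G_def by auto
      then have "open C" using topological_basis_open[OF B(2)] by (auto intro!: open_Inter)
      then show "C \<in> sets borel" by (rule borel_open)
    qed
    then show "sigma_sets UNIV G \<subseteq> sets borel" by (rule sets.sigma_sets_subset[where M=borel, simplified])
  qed
  ultimately show thesis by (rule that)
qed

text \<open>The sets \<open>B\<close> for which the integral vanishes form a Dynkin system; \<open>UNIV\<close> is needed in \<open>G\<close> so that the
  system is closed under complements.\<close>

lemma orthogonal_on_generator:
  fixes f :: "'a \<Rightarrow> real" and U :: "'a \<Rightarrow> 'b::topological_space"
  assumes f: "integrable M f" and U[measurable]: "U \<in> borel_measurable M"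
    and G: "Int_stable G" "UNIV \<in> G" "sets borel = sigma_sets UNIV G"
    and zero: "\<And>B. B \<in> G \<Longrightarrow> (\<integral>x. indicator B (U x) * f x \<partial>M) = 0"
    and B: "B \<in> sets borel"
  shows "(\<integral>x. indicator B (U x) * f x \<partial>M) = 0"
proof -
  have [measurable]: "f \<in> borel_measurable M" using f by auto
  have int: "integrable M (\<lambda>x. indicator B (U x) * f x)" if "B \<in> sets borel" for B
    by (rule Bochner_Integration.integrable_bound[OF f]) (use that in \<open>auto simp: indicator_def\<close>)
  have GP: "G \<subseteq> Pow UNIV" by simp
  have "B \<in> sigma_sets UNIV G" using B G(3) by simp
  with G(1) GP show ?thesis
  proof (induction rule: sigma_sets_induct_disjoint)
    case (basic A)
    then show ?case by (rule zero)
  next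
    case empty
    then show ?case by simp
  next
    case (compl A)
    have A: "A \<in> sets borel" using compl(1) G(3) by simp
    have "(\<integral>x. indicator (UNIV - A) (U x) * f x \<partial>M) = (\<integral>x. f x - indicator A (U x) * f x \<partial>M)"
      by (rule Bochner_Integration.integral_cong) (auto simp: indicator_def)
    also have "\<dots> = (\<integral>x. f x \<partial>M) - (\<integral>x. indicator A (U x) * f x \<partial>M)"
      by (rule Bochner_Integration.integral_diff[OF f int[OF A]])
    also have "\<dots> = 0" using compl(2) zero[OF G(2)] by simp
    finally show ?case .
  next
    case (union A)
    have A[measurable]: "A i \<in> sets borel" for i using union(2) G(3) by auto
    let ?C = "\<lambda>i. U -` A i \<inter> space M"
    have set: "(\<integral>x\<in>U -` A' \<inter> space M. f x \<partial>M) = (\<integral>x. indicator A' (U x) * f x \<partial>M)" for A'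
      unfolding set_lebesgue_integral_def by (rule Bochner_Integration.integral_cong) (auto simp: indicator_def)
    have C: "U -` (\<Union>i. A i) \<inter> space M = (\<Union>i. ?C i)" by auto
    have "(\<integral>x\<in>(\<Union>i. ?C i). f x \<partial>M) = (\<Sum>i. \<integral>x\<in>?C i. f x \<partial>M)"
    proof (rule lebesgue_integral_countable_add)
      show "?C i \<inter> ?C j = {}" if "i \<noteq> j" for i j
        using union(1) that by (auto simp: disjoint_family_on_def)
      have "integrable M (\<lambda>x. indicator (\<Union>i. ?C i) x * f x)"
        by (rule Bochner_Integration.integrable_bound[OF f]) (auto simp: indicator_def)
      then show "set_integrable M (\<Union>i. ?C i) f" by (simp add: set_integrable_def)
    qed measurable
    then show ?case using union(3) by (simp only: set[symmetric] C) (simp add: set)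
  qed
qed

text \<open>For a single \<open>B\<close>, the integral over the second coordinate vanishes for almost every \<open>D\<close>, since its
  integral over each set \<open>A\<close> vanishes. The exceptional null set depends on \<open>B\<close>; it can be chosen
  independent of \<open>B\<close> on a countable generator, and from there the claim extends to all Borel sets.\<close>

lemma AE_orthogonal_sections:
  fixes f :: "'d \<times> 'x \<Rightarrow> real" and U :: "'d \<times> 'x \<Rightarrow> 'b::second_countable_topology"
  assumes "prob_space \<nu>" "prob_space \<mu>"
    and f: "integrable (\<nu> \<Otimes>\<^sub>M \<mu>) f" and U[measurable]: "U \<in> borel_measurable (\<nu> \<Otimes>\<^sub>M \<mu>)"
    and zero: "\<And>A B. A \<in> sets \<nu> \<Longrightarrow> B \<in> sets borel \<Longrightarrow>
      (\<integral>z. indicator A (fst z) * indicator B (U z) * f z \<partial>(\<nu> \<Otimes>\<^sub>M \<mu>)) = 0"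
  shows "AE D in \<nu>. \<forall>B\<in>sets borel. (\<integral>x. indicator B (U (D, x)) * f (D, x) \<partial>\<mu>) = 0"
proof -
  interpret \<nu>: prob_space \<nu> by fact
  interpret \<mu>: prob_space \<mu> by fact
  interpret pair_sigma_finite \<nu> \<mu> by unfold_locales
  have [measurable]: "f \<in> borel_measurable (\<nu> \<Otimes>\<^sub>M \<mu>)" using f by auto
  obtain G :: "'b set set" where G: "countable G" "Int_stable G" "UNIV \<in> G" "sets borel = sigma_sets UNIV G"
    using countable_borel_generator by blast
  have GB: "B \<in> sets borel" if "B \<in> G" for B using that G(4) by auto
  have sect: "AE D in \<nu>. (\<integral>x. indicator B (U (D, x)) * f (D, x) \<partial>\<mu>) = 0" if B[measurable]: "B \<in> sets borel" for B
  proof -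
    have int: "integrable (\<nu> \<Otimes>\<^sub>M \<mu>) (\<lambda>z. indicator B (U z) * f z)"
      by (rule Bochner_Integration.integrable_bound[OF f]) (auto simp: indicator_def)
    show ?thesis
    proof (rule density_unique_real)
      show "integrable \<nu> (\<lambda>D. \<integral>x. indicator B (U (D, x)) * f (D, x) \<partial>\<mu>)"
        using integrable_fst'[OF int] .
      fix A assume A[measurable]: "A \<in> sets \<nu>"
      have int2: "integrable (\<nu> \<Otimes>\<^sub>M \<mu>) (\<lambda>z. indicator A (fst z) * indicator B (U z) * f z)"
        by (rule Bochner_Integration.integrable_bound[OF f]) (auto simp: indicator_def)
      have "(\<integral>D\<in>A. (\<integral>x. indicator B (U (D, x)) * f (D, x) \<partial>\<mu>) \<partial>\<nu>)
          = (\<integral>D. (\<integral>x. indicator A D * indicator B (U (D, x)) * f (D, x) \<partial>\<mu>) \<partial>\<nu>)"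
        unfolding set_lebesgue_integral_def by (simp add: mult.assoc)
      also have "\<dots> = 0"
        using integral_fst'[OF int2] zero[OF A B] by simp
      finally show "(\<integral>D\<in>A. (\<integral>x. indicator B (U (D, x)) * f (D, x) \<partial>\<mu>) \<partial>\<nu>) = (\<integral>D\<in>A. 0 \<partial>\<nu>)" by simp
    qed simp
  qed
  have "AE D in \<nu>. \<forall>B\<in>G. (\<integral>x. indicator B (U (D, x)) * f (D, x) \<partial>\<mu>) = 0"
    using sect GB by (intro AE_ball_countable' G(1)) auto
  moreover have "AE D in \<nu>. integrable \<mu> (\<lambda>x. f (D, x))" by (rule AE_integrable_fst'[OF f])
  moreover have "AE D in \<nu>. D \<in> space \<nu>" by (rule AE_space)
  ultimately show ?thesis
  proof eventually_elim
    case (elim D)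
    have "(\<lambda>x. U (D, x)) \<in> borel_measurable \<mu>" by (rule measurable_Pair2[OF U elim(3)])
    then show ?case using orthogonal_on_generator[OF elim(2) _ G(2-4)] elim(1) by blast
  qed
qed

section \<open>Aggregation of fixed machines\<close>

text \<open>The sample points \<open>0, \<dots>, l - 1\<close> of the estimator are the points \<open>1, \<dots>, l\<close> of the sequence \<open>s\<close>, whose point
  \<open>0\<close> is the query.\<close>

lemma combined_estimator_eq_window_mean:
  "combined_estimator \<rho> e l (\<lambda>i. s (Suc i)) (fst (s 0)) = window_mean e l (\<lambda>i. \<rho> (fst (s i))) (\<lambda>i. snd (s i))"
proof -
  have bij: "bij_betw Suc {..<l} ({..l} - {0})"
    unfolding bij_betw_def image_Suc_lessThan by auto
  have "weight \<rho> e l (\<lambda>i. s (Suc i)) i (fst (s 0)) = window_weight e l (\<lambda>i. \<rho> (fst (s i))) 0 (Suc i)" for i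
    unfolding weight_def window_weight_def nbr_count_def agree_def near_def
    by (simp add: sum.reindex_bij_betw[OF bij, symmetric])
  then show ?thesis
    unfolding combined_estimator_def window_mean_def
    by (simp add: sum.reindex_bij_betw[OF bij, symmetric])
qed

lemma mean_square_eq: "mean_square P V = (\<integral>\<^sup>+\<omega>. ennreal ((V \<omega>)\<^sup>2) \<partial>P)"
  by (simp add: mean_square_def)

lemma mean_square_finite_iff:
  assumes "V \<in> borel_measurable P"
  shows "mean_square P V < \<infinity> \<longleftrightarrow> integrable P (\<lambda>\<omega>. (V \<omega>)\<^sup>2)"
  using assms by (simp add: mean_square_eq integrable_iff_bounded)

lemma mean_square_integral:
  "integrable P (\<lambda>\<omega>. (V \<omega>)\<^sup>2) \<Longrightarrow> mean_square P V = ennreal (\<integral>\<omega>. (V \<omega>)\<^sup>2 \<partial>P)"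
  unfolding mean_square_eq by (rule nn_integral_eq_integral) auto

lemma borel_fst_snd_measurable [measurable (raw)]:
  fixes f :: "'a \<Rightarrow> 'b::second_countable_topology \<times> 'c::second_countable_topology"
  assumes "f \<in> borel_measurable M"
  shows "(\<lambda>x. fst (f x)) \<in> borel_measurable M" "(\<lambda>x. snd (f x)) \<in> borel_measurable M"
  by (auto intro!: measurable_compose[OF assms] borel_measurable_continuous_onI continuous_intros)

text \<open>The probabilistic setting, without a choice of windows. Below, \<open>F\<close> is the data given to the machines and \<open>Q\<close> the
  sequence that starts with \<open>W = (X, Y)\<close> and continues with the sample on which they are aggregated.\<close>

locale aggregation = prob_space P for P :: "'w measure" +
  fixes X :: "'w \<Rightarrow> real^'d::finite" and Y :: "'w \<Rightarrow> real"
    and Z :: "nat \<Rightarrow> 'w \<Rightarrow> (real^'d) \<times> real"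
    and k :: nat
    and r :: "'d dataset \<Rightarrow> real^'d \<Rightarrow> real^'m::finite"
    and rstar :: "real^'d \<Rightarrow> real"
    and T :: "'d dataset \<Rightarrow> real^'m \<Rightarrow> real"
  assumes X_measurable [measurable]: "X \<in> borel_measurable P"
    and Y_measurable [measurable]: "Y \<in> borel_measurable P"
    and Y_square: "integrable P (\<lambda>\<omega>. (Y \<omega>)\<^sup>2)"
    and sample_indep: "indep_vars (\<lambda>_. borel) (case_option (\<lambda>\<omega>. (X \<omega>, Y \<omega>)) Z) UNIV"
    and sample_distr: "\<And>i. distr P borel (Z i) = distr P borel (\<lambda>\<omega>. (X \<omega>, Y \<omega>))"
    and rstar: "cond_mean_version P Y borel X rstar"
    and machines_measurable: "(\<lambda>(D, x). r D x) \<in> borel_measurable (data_space k \<Otimes>\<^sub>M borel)"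
    and T: "cond_mean_version P Y (data_space k \<Otimes>\<^sub>M borel)
              (\<lambda>\<omega>. (first_part k Z \<omega>, r (first_part k Z \<omega>) (X \<omega>))) (\<lambda>(D, u). T D u)"
begin

abbreviation W :: "'w \<Rightarrow> (real^'d) \<times> real" where "W \<omega> \<equiv> (X \<omega>, Y \<omega>)"
abbreviation \<mu> :: "((real^'d) \<times> real) measure" where "\<mu> \<equiv> distr P borel W"
abbreviation F :: "'w \<Rightarrow> 'd dataset" where "F \<equiv> first_part k Z"
abbreviation \<nu> :: "'d dataset measure" where "\<nu> \<equiv> distr P (data_space k) F"
abbreviation Q :: "'w \<Rightarrow> nat \<Rightarrow> (real^'d) \<times> real" where
  "Q \<omega> \<equiv> case_nat (W \<omega>) (\<lambda>i. Z (k + i) \<omega>)"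

lemma W_measurable [measurable]: "W \<in> borel_measurable P"
  by (rule borel_measurable_Pair) auto

lemma Z_measurable [measurable]: "Z i \<in> borel_measurable P"
proof -
  have "\<forall>i\<in>UNIV. case_option W Z i \<in> borel_measurable P"
    using sample_indep unfolding indep_vars_def by (rule conjunct1)
  from bspec[OF this, of "Some i"] show ?thesis by simp
qed

lemma F_measurable [measurable]: "F \<in> measurable P (data_space k)"
  unfolding first_part_def[abs_def] by (intro measurable_restrict) simp

lemma Q_measurable [measurable]: "Q \<in> measurable P (PiM UNIV (\<lambda>_. borel))"
  by (intro measurable_case_nat' measurable_PiM_single') (auto simp: space_PiM)

lemma mu_prob: "prob_space \<mu>" and nu_prob: "prob_space \<nu>"
  by (auto intro: prob_space_distr)

lemma F_Q_indep: "indep_var (data_space k) F (PiM UNIV (\<lambda>_. borel)) Q"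
  using split_sample_law(1)[OF prob_space_axioms sample_indep sample_distr, of k]
  by (simp add: first_part_def[abs_def])

lemma Q_law: "distr P (PiM UNIV (\<lambda>_. borel)) Q = PiM UNIV (\<lambda>_. \<mu>)"
  by (rule split_sample_law(2)[OF prob_space_axioms sample_indep sample_distr])

lemma F_Q_law: "distr P (data_space k \<Otimes>\<^sub>M PiM UNIV (\<lambda>_. borel)) (\<lambda>\<omega>. (F \<omega>, Q \<omega>)) = \<nu> \<Otimes>\<^sub>M PiM UNIV (\<lambda>_. \<mu>)"
  using F_Q_indep unfolding indep_var_distribution_eq Q_law by simp

lemma F_W_law: "distr P (data_space k \<Otimes>\<^sub>M borel) (\<lambda>\<omega>. (F \<omega>, W \<omega>)) = \<nu> \<Otimes>\<^sub>M \<mu>"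
proof -
  interpret \<mu>: prob_space \<mu> by (rule mu_prob)
  interpret S: product_prob_space "\<lambda>_::nat. \<mu>" UNIV ..
  have "\<nu> \<Otimes>\<^sub>M \<mu> = distr \<nu> \<nu> (\<lambda>D. D) \<Otimes>\<^sub>M distr (PiM UNIV (\<lambda>_. \<mu>)) \<mu> (\<lambda>s. s (0::nat))"
    using S.PiM_component[of 0] by (simp add: distr_id2)
  also have "\<dots> = distr (\<nu> \<Otimes>\<^sub>M PiM UNIV (\<lambda>_. \<mu>)) (\<nu> \<Otimes>\<^sub>M \<mu>) (\<lambda>(D, s). (D, s (0::nat)))"
    using S.PiM_component[of 0] \<mu>.sigma_finite_measure_axioms
    by (intro pair_measure_distr) auto
  also have "\<dots> = distr (distr P (data_space k \<Otimes>\<^sub>M PiM UNIV (\<lambda>_. borel)) (\<lambda>\<omega>. (F \<omega>, Q \<omega>)))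
      (data_space k \<Otimes>\<^sub>M borel) (\<lambda>(D, s). (D, s 0))"
    unfolding F_Q_law by (intro distr_cong sets_pair_measure_cong) auto
  also have "\<dots> = distr P (data_space k \<Otimes>\<^sub>M borel) (\<lambda>\<omega>. (F \<omega>, W \<omega>))"
    by (subst distr_distr) (auto simp: comp_def)
  finally show ?thesis by (rule sym)
qed

lemma sets_nu_mu: "sets (\<nu> \<Otimes>\<^sub>M \<mu>) = sets (data_space k \<Otimes>\<^sub>M borel)"
  by (rule sets_pair_measure_cong) auto

lemma F_W_measurable [measurable]: "(\<lambda>\<omega>. (F \<omega>, W \<omega>)) \<in> measurable P (data_space k \<Otimes>\<^sub>M borel)"
  by measurable

lemma F_W_integral:
  fixes f :: "'d dataset \<times> (real^'d) \<times> real \<Rightarrow> real"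
  assumes f: "f \<in> borel_measurable (data_space k \<Otimes>\<^sub>M borel)"
  shows "(\<integral>z. f z \<partial>(\<nu> \<Otimes>\<^sub>M \<mu>)) = (\<integral>\<omega>. f (F \<omega>, W \<omega>) \<partial>P)"
    and "integrable (\<nu> \<Otimes>\<^sub>M \<mu>) f \<longleftrightarrow> integrable P (\<lambda>\<omega>. f (F \<omega>, W \<omega>))"
  unfolding F_W_law[symmetric]
  by (rule integral_distr[OF F_W_measurable f], rule integrable_distr_eq[OF F_W_measurable f])

lemma r_measurable [measurable (raw)]:
  assumes "f \<in> measurable M (data_space k)" "g \<in> borel_measurable M"
  shows "(\<lambda>x. r (f x) (g x)) \<in> borel_measurable M"
  using measurable_compose[OF measurable_Pair[OF assms] machines_measurable] by simp

lemma T_measurable [measurable (raw)]: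
  assumes "f \<in> measurable M (data_space k)" "g \<in> borel_measurable M"
  shows "(\<lambda>x. T (f x) (g x)) \<in> borel_measurable M"
proof -
  have "(\<lambda>(D, u). T D u) \<in> borel_measurable (data_space k \<Otimes>\<^sub>M borel)"
    using T by (simp add: cond_mean_version_def)
  from measurable_compose[OF measurable_Pair[OF assms] this] show ?thesis by simp
qed

lemma rstar_measurable [measurable]: "rstar \<in> borel_measurable borel"
  using rstar by (simp add: cond_mean_version_def)

lemma V_measurable [measurable]: "(\<lambda>\<omega>. (F \<omega>, r (F \<omega>) (X \<omega>))) \<in> measurable P (data_space k \<Otimes>\<^sub>M borel)"
  by measurable

lemma T_square: "integrable P (\<lambda>\<omega>. (T (F \<omega>) (r (F \<omega>) (X \<omega>)))\<^sup>2)"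
  using cond_mean_version_square_integrable[OF prob_space_axioms V_measurable Y_measurable Y_square T] by simp

lemma rstar_square: "integrable P (\<lambda>\<omega>. (rstar (X \<omega>))\<^sup>2)"
  by (rule cond_mean_version_square_integrable[OF prob_space_axioms X_measurable Y_measurable Y_square rstar])

lemma T_orthogonal:
  assumes \<phi>[measurable]: "\<phi> \<in> borel_measurable (data_space k \<Otimes>\<^sub>M borel)"
    and sq: "integrable P (\<lambda>\<omega>. (\<phi> (F \<omega>, r (F \<omega>) (X \<omega>)))\<^sup>2)"
  shows "(\<integral>\<omega>. \<phi> (F \<omega>, r (F \<omega>) (X \<omega>)) * (Y \<omega> - T (F \<omega>) (r (F \<omega>) (X \<omega>))) \<partial>P) = 0"
proof -
  have int: "integrable P (\<lambda>\<omega>. \<phi> (F \<omega>, r (F \<omega>) (X \<omega>)) * Y \<omega>)"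
    by (rule square_integrable_product[OF sq Y_square]) measurable
  note * = cond_mean_version_orthogonal[OF prob_space_axioms V_measurable Y_measurable T \<phi> int]
  show ?thesis using * int by (simp add: right_diff_distrib)
qed

text \<open>The test function may also depend on the data of the machines: these are independent of \<open>(X, Y)\<close>, so by
  Fubini it suffices to test with the sections of \<open>\<psi>\<close>, which are functions of \<open>X\<close> alone.\<close>

lemma rstar_orthogonal:
  fixes \<psi> :: "'d dataset \<times> (real^'d) \<Rightarrow> real"
  assumes \<psi>[measurable]: "\<psi> \<in> borel_measurable (data_space k \<Otimes>\<^sub>M borel)"
    and sq: "integrable P (\<lambda>\<omega>. (\<psi> (F \<omega>, X \<omega>))\<^sup>2)"
  shows "(\<integral>\<omega>. \<psi> (F \<omega>, X \<omega>) * (Y \<omega> - rstar (X \<omega>)) \<partial>P) = 0"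
proof -
  interpret \<mu>: prob_space \<mu> by (rule mu_prob)
  interpret \<nu>: prob_space \<nu> by (rule nu_prob)
  interpret pair_sigma_finite \<nu> \<mu> by unfold_locales
  define f where "f z = \<psi> (fst z, fst (snd z)) * (snd (snd z) - rstar (fst (snd z)))" for z
  define h where "h z = (\<psi> (fst z, fst (snd z)))\<^sup>2" for z :: "'d dataset \<times> (real^'d) \<times> real"
  have [measurable]: "f \<in> borel_measurable (data_space k \<Otimes>\<^sub>M borel)" "h \<in> borel_measurable (data_space k \<Otimes>\<^sub>M borel)"
    unfolding f_def[abs_def] h_def[abs_def] by measurable
  have res: "integrable P (\<lambda>\<omega>. (Y \<omega> - rstar (X \<omega>))\<^sup>2)"
    by (rule square_integrable_diff[OF Y_square rstar_square]) measurable
  have "integrable P (\<lambda>\<omega>. f (F \<omega>, W \<omega>))"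
    unfolding f_def using square_integrable_product[OF sq res] by simp
  then have f_int: "integrable (\<nu> \<Otimes>\<^sub>M \<mu>) f" by (simp add: F_W_integral(2))
  have h_int: "integrable (\<nu> \<Otimes>\<^sub>M \<mu>) h" using sq by (simp add: F_W_integral(2) h_def)
  have inner: "AE D in \<nu>. (\<integral>z. f (D, z) \<partial>\<mu>) = 0"
    using AE_integrable_fst'[OF h_int] AE_space[of \<nu>]
  proof eventually_elim
    case (elim D)
    have D: "D \<in> space (data_space k)" using elim(2) by simp
    define \<phi> where "\<phi> x = \<psi> (D, x)" for x
    have [measurable]: "\<phi> \<in> borel_measurable borel"
      unfolding \<phi>_def[abs_def] by (rule measurable_Pair2[OF \<psi> D])
    have "integrable P (\<lambda>\<omega>. (\<phi> (X \<omega>))\<^sup>2)"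
      using elim(1) by (subst (asm) integrable_distr_eq) (auto simp: h_def \<phi>_def[symmetric])
    then have int: "integrable P (\<lambda>\<omega>. \<phi> (X \<omega>) * Y \<omega>)"
      by (rule square_integrable_product[OF _ Y_square]) auto
    note * = cond_mean_version_orthogonal[OF prob_space_axioms X_measurable Y_measurable rstar _ int]
    have "(\<integral>z. f (D, z) \<partial>\<mu>) = (\<integral>\<omega>. \<phi> (X \<omega>) * (Y \<omega> - rstar (X \<omega>)) \<partial>P)"
      unfolding f_def fst_conv snd_conv \<phi>_def[symmetric] by (subst integral_distr) auto
    also have "\<dots> = 0" using * int by (simp add: right_diff_distrib)
    finally show ?case .
  qed
  have "(\<integral>\<omega>. \<psi> (F \<omega>, X \<omega>) * (Y \<omega> - rstar (X \<omega>)) \<partial>P) = (\<integral>z. f z \<partial>(\<nu> \<Otimes>\<^sub>M \<mu>))"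
    by (simp add: F_W_integral(1)) (simp add: f_def)
  also have "\<dots> = (\<integral>D. (\<integral>z. f (D, z) \<partial>\<mu>) \<partial>\<nu>)"
    using integral_fst'[OF f_int] by simp
  also have "\<dots> = (\<integral>D. 0 \<partial>\<nu>)"
    using inner f_int by (intro integral_cong_AE borel_measurable_integrable[OF integrable_fst'[OF f_int]]) auto
  finally show ?thesis by simp
qed

text \<open>The link between the two views of \<open>T\<close>: a joint conditional mean given data and machines on the one
  hand, the regression function on the machines with the data held fixed on the other.\<close>

lemma AE_regression_model: "AE D in \<nu>. window_regression_model \<mu> (\<lambda>z. r D (fst z)) snd (T D)"
proof -
  interpret \<mu>: prob_space \<mu> by (rule mu_prob)
  interpret \<nu>: prob_space \<nu> by (rule nu_prob)
  interpret pair_sigma_finite \<nu> \<mu> by unfold_locales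
  define U where "U z = r (fst z) (fst (snd z))" for z :: "'d dataset \<times> (real^'d) \<times> real"
  define f where "f z = snd (snd z) - T (fst z) (U z)" for z :: "'d dataset \<times> (real^'d) \<times> real"
  have U_meas[measurable]: "U \<in> borel_measurable (data_space k \<Otimes>\<^sub>M borel)"
    unfolding U_def[abs_def] by measurable
  have f_meas[measurable]: "f \<in> borel_measurable (data_space k \<Otimes>\<^sub>M borel)"
    unfolding f_def[abs_def] by measurable
  have T_int: "integrable (\<nu> \<Otimes>\<^sub>M \<mu>) (\<lambda>z. (T (fst z) (U z))\<^sup>2)"
    using T_square by (subst F_W_integral(2)) (auto simp: U_def)
  have Y_int: "integrable \<mu> (\<lambda>z. (snd z)\<^sup>2)"
    using Y_square by (subst integrable_distr_eq) auto
  have "integrable P Y" "integrable P (\<lambda>\<omega>. T (F \<omega>) (r (F \<omega>) (X \<omega>)))"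
    using square_integrable_imp_integrable[OF _ Y_square] square_integrable_imp_integrable[OF _ T_square] by auto
  then have f_int: "integrable (\<nu> \<Otimes>\<^sub>M \<mu>) f"
    by (subst F_W_integral(2)) (auto simp: f_def U_def)
  have "AE D in \<nu>. \<forall>B\<in>sets borel. (\<integral>x. indicator B (U (D, x)) * f (D, x) \<partial>\<mu>) = 0"
  proof (rule AE_orthogonal_sections[OF nu_prob mu_prob f_int])
    show "U \<in> borel_measurable (\<nu> \<Otimes>\<^sub>M \<mu>)"
      using U_meas by (simp cong: measurable_cong_sets add: sets_nu_mu)
    fix A :: "'d dataset set" and B :: "(real^'m) set"
    assume "A \<in> sets \<nu>" and B[measurable]: "B \<in> sets borel"
    then have A[measurable]: "A \<in> sets (data_space k)" by simp
    define \<phi> :: "'d dataset \<times> (real^'m) \<Rightarrow> real" where "\<phi> v = indicator A (fst v) * indicator B (snd v)" for v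
    have [measurable]: "\<phi> \<in> borel_measurable (data_space k \<Otimes>\<^sub>M borel)"
      unfolding \<phi>_def[abs_def] by measurable
    have "integrable P (\<lambda>\<omega>. (\<phi> (F \<omega>, r (F \<omega>) (X \<omega>)))\<^sup>2)"
      by (rule integrable_const_bound[of _ 1]) (auto simp: \<phi>_def indicator_def)
    from T_orthogonal[OF _ this]
    have "(\<integral>\<omega>. \<phi> (F \<omega>, r (F \<omega>) (X \<omega>)) * (Y \<omega> - T (F \<omega>) (r (F \<omega>) (X \<omega>))) \<partial>P) = 0" by simp
    then show "(\<integral>z. indicator A (fst z) * indicator B (U z) * f z \<partial>(\<nu> \<Otimes>\<^sub>M \<mu>)) = 0"
      by (subst F_W_integral(1)) (auto simp: \<phi>_def f_def U_def)
  qed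
  then show ?thesis
    using AE_integrable_fst'[OF T_int] AE_space[of \<nu>]
  proof eventually_elim
    case (elim D)
    have D: "D \<in> space (data_space k)" using elim(3) by simp
    have rD[measurable]: "(\<lambda>z :: (real^'d) \<times> real. r D (fst z)) \<in> borel_measurable borel"
      using D by (intro r_measurable) auto
    have TD[measurable]: "T D \<in> borel_measurable borel"
      using D by (intro T_measurable) auto
    have TU: "integrable \<mu> (\<lambda>z. (T D (r D (fst z)))\<^sup>2)" using elim(2) by (simp add: U_def)
    show ?case
    proof unfold_locales
      fix B :: "(real^'m) set" assume B[measurable]: "B \<in> sets borel"
      have i1: "integrable \<mu> (\<lambda>z. snd z)" "integrable \<mu> (\<lambda>z. T D (r D (fst z)))"
        using \<mu>.square_integrable_imp_integrable[OF _ Y_int] \<mu>.square_integrable_imp_integrable[OF _ TU] by auto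
      have i2: "integrable \<mu> (\<lambda>z. indicator B (r D (fst z)) * snd z)"
        by (rule Bochner_Integration.integrable_bound[OF i1(1)]) (auto simp: indicator_def)
      have i3: "integrable \<mu> (\<lambda>z. indicator B (r D (fst z)) * T D (r D (fst z)))"
        by (rule Bochner_Integration.integrable_bound[OF i1(2)]) (auto simp: indicator_def)
      have "(\<integral>z. indicator B (r D (fst z)) * snd z - indicator B (r D (fst z)) * T D (r D (fst z)) \<partial>\<mu>) = 0"
        using elim(1) B by (simp add: U_def f_def right_diff_distrib)
      then show "(\<integral>z. indicator B (r D (fst z)) * snd z \<partial>\<mu>) = (\<integral>z. indicator B (r D (fst z)) * T D (r D (fst z)) \<partial>\<mu>)"
        using Bochner_Integration.integral_diff[OF i2 i3] by simp
    qed (use Y_int TU in auto)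
  qed
qed

abbreviation target :: "'w \<Rightarrow> real" where "target \<omega> \<equiv> T (F \<omega>) (r (F \<omega>) (X \<omega>))"

abbreviation combined :: "real \<Rightarrow> nat \<Rightarrow> 'w \<Rightarrow> real" where
  "combined e l \<omega> \<equiv> combined_estimator (r (F \<omega>)) e l (second_part k Z \<omega>) (X \<omega>)"

definition section_error :: "real \<Rightarrow> nat \<Rightarrow> 'd dataset \<Rightarrow> (nat \<Rightarrow> (real^'d) \<times> real) \<Rightarrow> ennreal" where
  "section_error e l D s = ennreal ((window_mean e l (\<lambda>i. r D (fst (s i))) (\<lambda>i. snd (s i)) - T D (r D (fst (s 0))))\<^sup>2)"

lemma combined_eq: "combined e l \<omega> = window_mean e l (\<lambda>i. r (F \<omega>) (fst (Q \<omega> i))) (\<lambda>i. snd (Q \<omega> i))"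
  using combined_estimator_eq_window_mean[of "r (F \<omega>)" e l "Q \<omega>"] by (simp add: second_part_def)

lemma window_mean_section_measurable [measurable]:
  "(\<lambda>(D, s). window_mean e l (\<lambda>i. r D (fst (s i))) (\<lambda>i. snd (s i))) \<in> borel_measurable (data_space k \<Otimes>\<^sub>M PiM UNIV (\<lambda>_. borel))"
  unfolding split_beta' by measurable

lemma combined_measurable [measurable]: "combined e l \<in> borel_measurable P"
  using measurable_compose[OF measurable_Pair[OF F_measurable Q_measurable] window_mean_section_measurable[of e l]]
  unfolding combined_eq by simp

lemma section_error_measurable:
  "(\<lambda>(D, s). section_error e l D s) \<in> borel_measurable (data_space k \<Otimes>\<^sub>M PiM UNIV (\<lambda>_. borel))"
  unfolding section_error_def split_beta' using window_mean_section_measurable[of e l, unfolded split_beta'] by measurable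

lemma section_error_measurable': "(\<lambda>(D, s). section_error e l D s) \<in> borel_measurable (\<nu> \<Otimes>\<^sub>M PiM UNIV (\<lambda>_. \<mu>))"
proof -
  have "sets (\<nu> \<Otimes>\<^sub>M PiM UNIV (\<lambda>_. \<mu>)) = sets (data_space k \<Otimes>\<^sub>M PiM UNIV (\<lambda>_. borel))"
    by (intro sets_pair_measure_cong sets_PiM_cong) auto
  then show ?thesis using section_error_measurable[of e l] by (simp cong: measurable_cong_sets)
qed

lemma mean_square_error_eq:
  "mean_square P (\<lambda>\<omega>. combined e l \<omega> - target \<omega>)
   = (\<integral>\<^sup>+D. (\<integral>\<^sup>+s. section_error e l D s \<partial>PiM UNIV (\<lambda>_. \<mu>)) \<partial>\<nu>)"
proof -
  interpret \<mu>: prob_space \<mu> by (rule mu_prob)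
  interpret S: prob_space "PiM UNIV (\<lambda>_::nat. \<mu>)" by (rule prob_space_PiM) (rule mu_prob)
  have "mean_square P (\<lambda>\<omega>. combined e l \<omega> - target \<omega>) = (\<integral>\<^sup>+\<omega>. (\<lambda>(D, s). section_error e l D s) (F \<omega>, Q \<omega>) \<partial>P)"
    unfolding mean_square_eq combined_eq section_error_def by simp
  also have "\<dots> = (\<integral>\<^sup>+z. (\<lambda>(D, s). section_error e l D s) z \<partial>(\<nu> \<Otimes>\<^sub>M PiM UNIV (\<lambda>_. \<mu>)))"
    unfolding F_Q_law[symmetric] by (rule nn_integral_distr[symmetric]) (auto intro: section_error_measurable)
  also have "\<dots> = (\<integral>\<^sup>+D. (\<integral>\<^sup>+s. section_error e l D s \<partial>PiM UNIV (\<lambda>_. \<mu>)) \<partial>\<nu>)"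
    using S.nn_integral_fst[OF section_error_measurable'[of e l]] by simp
  finally show ?thesis .
qed

text \<open>For almost every \<open>D\<close> the inner integral tends to \<open>0\<close> and is dominated by \<open>c + 2 * t D\<close>, which is
  integrable because both \<open>Y\<close> and its conditional mean are square integrable.\<close>

theorem combined_consistent:
  assumes pos: "\<And>l. l \<ge> 1 \<Longrightarrow> \<epsilon> l > 0" and small: "\<epsilon> \<longlonglongrightarrow> 0"
    and large: "filterlim (\<lambda>l. real l * \<epsilon> l ^ CARD('m)) at_top sequentially"
  shows "(\<lambda>l. mean_square P (\<lambda>\<omega>. combined (\<epsilon> l) l \<omega> - target \<omega>)) \<longlonglongrightarrow> 0"
proof -
  interpret \<mu>: prob_space \<mu> by (rule mu_prob)
  interpret \<nu>: prob_space \<nu> by (rule nu_prob)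
  interpret S: prob_space "PiM UNIV (\<lambda>_::nat. \<mu>)" by (rule prob_space_PiM) (rule mu_prob)
  interpret pair_sigma_finite \<nu> \<mu> by unfold_locales
  define c where "c = 2 * 2 ^ CARD('m) * (\<integral>z. (snd z)\<^sup>2 \<partial>\<mu>)"
  define t where "t D = (\<integral>z. (T D (r D (fst z)))\<^sup>2 \<partial>\<mu>)" for D
  have T_int: "integrable (\<nu> \<Otimes>\<^sub>M \<mu>) (\<lambda>z. (T (fst z) (r (fst z) (fst (snd z))))\<^sup>2)"
    using T_square by (subst F_W_integral(2)) auto
  have t_int: "integrable \<nu> t" using integrable_fst'[OF T_int] by (simp add: t_def[abs_def])
  have nonneg: "0 \<le> c" "0 \<le> t D" for D
    by (auto simp: c_def t_def intro!: mult_nonneg_nonneg Bochner_Integration.integral_nonneg)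
  have "(\<lambda>l. \<integral>\<^sup>+D. (\<integral>\<^sup>+s. section_error (\<epsilon> l) l D s \<partial>PiM UNIV (\<lambda>_. \<mu>)) \<partial>\<nu>) \<longlonglongrightarrow> (\<integral>\<^sup>+D. 0 \<partial>\<nu>)"
  proof (rule nn_integral_dominated_convergence[where w="\<lambda>D. ennreal (c + 2 * t D)"])
    show "(\<lambda>D. \<integral>\<^sup>+s. section_error (\<epsilon> l) l D s \<partial>PiM UNIV (\<lambda>_. \<mu>)) \<in> borel_measurable \<nu>" for l
      using S.borel_measurable_nn_integral_fst[OF section_error_measurable'[of "\<epsilon> l" l]] by simp
    have [measurable]: "t \<in> borel_measurable \<nu>" using t_int by (rule borel_measurable_integrable)
    show "(\<lambda>D. ennreal (c + 2 * t D)) \<in> borel_measurable \<nu>" by measurable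
    have "integrable \<nu> (\<lambda>D. c + 2 * t D)" using t_int by simp
    then show "(\<integral>\<^sup>+D. ennreal (c + 2 * t D) \<partial>\<nu>) < \<infinity>"
      using nonneg by (subst nn_integral_eq_integral) auto
    show "AE D in \<nu>. (\<integral>\<^sup>+s. section_error (\<epsilon> l) l D s \<partial>PiM UNIV (\<lambda>_. \<mu>)) \<le> ennreal (c + 2 * t D)" for l
      using AE_regression_model
    proof eventually_elim
      case (elim D)
      then interpret window_regression_model \<mu> "\<lambda>z. r D (fst z)" snd "T D" .
      show ?case using estimate_error_bound[of "\<epsilon> l" l] by (simp add: section_error_def c_def t_def)
    qed
    show "AE D in \<nu>. (\<lambda>l. \<integral>\<^sup>+s. section_error (\<epsilon> l) l D s \<partial>PiM UNIV (\<lambda>_. \<mu>)) \<longlonglongrightarrow> 0"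
      using AE_regression_model
    proof eventually_elim
      case (elim D)
      then interpret window_regression_model \<mu> "\<lambda>z. r D (fst z)" snd "T D" .
      show ?case using estimate_consistent[OF pos small large] by (simp add: section_error_def)
    qed
  qed auto
  then show ?thesis by (simp add: mean_square_error_eq)
qed

text \<open>Pythagoras: with \<open>A = f - T\<close> and \<open>B = T - rstar\<close>, the product \<open>A * B\<close> has mean zero, because \<open>A\<close> is
  orthogonal to \<open>Y - T\<close> as well as to \<open>Y - rstar\<close>, being a function of the data and \<open>X\<close>.\<close>

lemma target_optimal:
  assumes f[measurable]: "f \<in> borel_measurable borel"
    and fin: "mean_square P (\<lambda>\<omega>. f (r (F \<omega>) (X \<omega>))) < \<infinity>"
  shows "mean_square P (\<lambda>\<omega>. target \<omega> - rstar (X \<omega>)) \<le> mean_square P (\<lambda>\<omega>. f (r (F \<omega>) (X \<omega>)) - rstar (X \<omega>))"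
proof -
  define A where "A \<omega> = f (r (F \<omega>) (X \<omega>)) - target \<omega>" for \<omega>
  define B where "B \<omega> = target \<omega> - rstar (X \<omega>)" for \<omega>
  have [measurable]: "A \<in> borel_measurable P" "B \<in> borel_measurable P"
    unfolding A_def[abs_def] B_def[abs_def] by measurable
  have f_sq: "integrable P (\<lambda>\<omega>. (f (r (F \<omega>) (X \<omega>)))\<^sup>2)"
    using fin by (subst (asm) mean_square_finite_iff) auto
  have A_sq: "integrable P (\<lambda>\<omega>. (A \<omega>)\<^sup>2)"
    unfolding A_def by (rule square_integrable_diff[OF f_sq T_square]) measurable
  have B_sq: "integrable P (\<lambda>\<omega>. (B \<omega>)\<^sup>2)"
    unfolding B_def by (rule square_integrable_diff[OF T_square rstar_square]) measurable
  have AB: "integrable P (\<lambda>\<omega>. A \<omega> * B \<omega>)" by (rule square_integrable_product[OF A_sq B_sq]) measurable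
  have 1: "(\<integral>\<omega>. A \<omega> * (Y \<omega> - target \<omega>) \<partial>P) = 0"
  proof -
    have "(\<lambda>v. f (snd v) - T (fst v) (snd v)) \<in> borel_measurable (data_space k \<Otimes>\<^sub>M borel)" by measurable
    from T_orthogonal[OF this] A_sq show ?thesis by (simp add: A_def)
  qed
  have 2: "(\<integral>\<omega>. A \<omega> * (Y \<omega> - rstar (X \<omega>)) \<partial>P) = 0"
  proof -
    have "(\<lambda>v. f (r (fst v) (snd v)) - T (fst v) (r (fst v) (snd v))) \<in> borel_measurable (data_space k \<Otimes>\<^sub>M borel)" by measurable
    from rstar_orthogonal[OF this] A_sq show ?thesis by (simp add: A_def)
  qed
  have AY: "integrable P (\<lambda>\<omega>. A \<omega> * (Y \<omega> - target \<omega>))" "integrable P (\<lambda>\<omega>. A \<omega> * (Y \<omega> - rstar (X \<omega>)))"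
    by (rule square_integrable_product[OF A_sq square_integrable_diff[OF Y_square T_square]]; measurable)
       (rule square_integrable_product[OF A_sq square_integrable_diff[OF Y_square rstar_square]]; measurable)
  have "(\<integral>\<omega>. A \<omega> * B \<omega> \<partial>P) = (\<integral>\<omega>. A \<omega> * (Y \<omega> - rstar (X \<omega>)) - A \<omega> * (Y \<omega> - target \<omega>) \<partial>P)"
    by (rule Bochner_Integration.integral_cong) (auto simp: B_def algebra_simps)
  also have "\<dots> = 0" using AY 1 2 by simp
  finally have cross: "(\<integral>\<omega>. A \<omega> * B \<omega> \<partial>P) = 0" .
  have "mean_square P (\<lambda>\<omega>. target \<omega> - rstar (X \<omega>)) = ennreal (\<integral>\<omega>. (B \<omega>)\<^sup>2 \<partial>P)"
    using mean_square_integral[OF B_sq] by (simp add: B_def)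
  also have "\<dots> \<le> ennreal (\<integral>\<omega>. (A \<omega> + B \<omega>)\<^sup>2 \<partial>P)"
  proof (rule ennreal_leI)
    have "(\<integral>\<omega>. (A \<omega> + B \<omega>)\<^sup>2 \<partial>P) = (\<integral>\<omega>. (A \<omega>)\<^sup>2 + (B \<omega>)\<^sup>2 + 2 * (A \<omega> * B \<omega>) \<partial>P)"
      by (simp add: power2_sum mult.assoc)
    also have "\<dots> = (\<integral>\<omega>. (A \<omega>)\<^sup>2 \<partial>P) + (\<integral>\<omega>. (B \<omega>)\<^sup>2 \<partial>P)"
      using A_sq B_sq AB cross by simp
    finally show "(\<integral>\<omega>. (B \<omega>)\<^sup>2 \<partial>P) \<le> (\<integral>\<omega>. (A \<omega> + B \<omega>)\<^sup>2 \<partial>P)"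
      using Bochner_Integration.integral_nonneg[of P "\<lambda>\<omega>. (A \<omega>)\<^sup>2"] by simp
  qed
  also have "\<dots> = (\<integral>\<^sup>+\<omega>. ennreal ((A \<omega> + B \<omega>)\<^sup>2) \<partial>P)"
  proof (rule nn_integral_eq_integral[symmetric])
    have "integrable P (\<lambda>\<omega>. (A \<omega>)\<^sup>2 + (B \<omega>)\<^sup>2 + 2 * (A \<omega> * B \<omega>))"
      using A_sq B_sq AB by simp
    then show "integrable P (\<lambda>\<omega>. (A \<omega> + B \<omega>)\<^sup>2)" by (simp add: power2_sum mult.assoc)
  qed simp
  also have "\<dots> = mean_square P (\<lambda>\<omega>. f (r (F \<omega>) (X \<omega>)) - rstar (X \<omega>))"
    by (simp add: mean_square_eq A_def B_def)
  finally show ?thesis .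
qed

end

section \<open>Comparison with all functions of the machines\<close>

text \<open>Use \<open>(p + q)\<^sup>2 \<le> (1 + 1 / \<delta>) * p\<^sup>2 + (1 + \<delta>) * q\<^sup>2\<close> with \<open>p = A l - B\<close> and \<open>q = B - C\<close>, let \<open>l\<close>
  tend to infinity and then make \<open>\<delta>\<close> small.\<close>

lemma limsup_mean_square_le:
  fixes A :: "nat \<Rightarrow> 'a \<Rightarrow> real"
  assumes [measurable]: "\<And>l. A l \<in> borel_measurable P" "B \<in> borel_measurable P" "C \<in> borel_measurable P"
    and fin: "mean_square P (\<lambda>\<omega>. B \<omega> - C \<omega>) < \<infinity>"
    and lim: "(\<lambda>l. mean_square P (\<lambda>\<omega>. A l \<omega> - B \<omega>)) \<longlonglongrightarrow> 0"
  shows "limsup (\<lambda>l. mean_square P (\<lambda>\<omega>. A l \<omega> - C \<omega>)) \<le> mean_square P (\<lambda>\<omega>. B \<omega> - C \<omega>)"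
proof (rule ennreal_le_epsilon)
  fix e :: real assume e: "0 < e"
  obtain c where c: "0 \<le> c" "mean_square P (\<lambda>\<omega>. B \<omega> - C \<omega>) = ennreal c"
    using fin by (cases "mean_square P (\<lambda>\<omega>. B \<omega> - C \<omega>)") auto
  \<comment> \<open>Chosen so that \<open>\<delta> * c \<le> e\<close>; the summand \<open>1\<close> covers the case \<open>c = 0\<close>.\<close>
  define \<delta> where "\<delta> = e / (c + 1)"
  have \<delta>: "0 < \<delta>" using e c by (simp add: \<delta>_def)
  have le: "mean_square P (\<lambda>\<omega>. A l \<omega> - C \<omega>)
      \<le> ennreal (1 + 1 / \<delta>) * mean_square P (\<lambda>\<omega>. A l \<omega> - B \<omega>) + ennreal (1 + \<delta>) * ennreal c" for l
  proof -
    have pt: "(A l \<omega> - C \<omega>)\<^sup>2 \<le> (1 + 1 / \<delta>) * (A l \<omega> - B \<omega>)\<^sup>2 + (1 + \<delta>) * (B \<omega> - C \<omega>)\<^sup>2" for \<omega>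
    proof -
      define p q where "p = A l \<omega> - B \<omega>" and "q = B \<omega> - C \<omega>"
      have "0 \<le> (p - \<delta> * q)\<^sup>2 / \<delta>" using \<delta> by simp
      also have "\<dots> = p\<^sup>2 / \<delta> + \<delta> * q\<^sup>2 - 2 * p * q"
        using \<delta> by (simp add: power2_eq_square field_simps)
      finally have "(p + q)\<^sup>2 \<le> (1 + 1 / \<delta>) * p\<^sup>2 + (1 + \<delta>) * q\<^sup>2"
        by (simp add: power2_sum distrib_right)
      then show ?thesis by (simp add: p_def q_def)
    qed
    have "mean_square P (\<lambda>\<omega>. A l \<omega> - C \<omega>)
        \<le> (\<integral>\<^sup>+\<omega>. ennreal (1 + 1 / \<delta>) * ennreal ((A l \<omega> - B \<omega>)\<^sup>2) + ennreal (1 + \<delta>) * ennreal ((B \<omega> - C \<omega>)\<^sup>2) \<partial>P)"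
      unfolding mean_square_eq
    proof (rule nn_integral_mono)
      fix \<omega>
      show "ennreal ((A l \<omega> - C \<omega>)\<^sup>2) \<le> ennreal (1 + 1 / \<delta>) * ennreal ((A l \<omega> - B \<omega>)\<^sup>2) + ennreal (1 + \<delta>) * ennreal ((B \<omega> - C \<omega>)\<^sup>2)"
        using pt[of \<omega>] \<delta> by (simp flip: ennreal_mult' ennreal_plus add: ennreal_leI)
    qed
    also have "\<dots> = ennreal (1 + 1 / \<delta>) * mean_square P (\<lambda>\<omega>. A l \<omega> - B \<omega>) + ennreal (1 + \<delta>) * mean_square P (\<lambda>\<omega>. B \<omega> - C \<omega>)"
      unfolding mean_square_eq by (subst nn_integral_add) (auto simp: nn_integral_cmult)
    finally show ?thesis by (simp add: c(2))
  qed
  have "(\<lambda>l. ennreal (1 + 1 / \<delta>) * mean_square P (\<lambda>\<omega>. A l \<omega> - B \<omega>) + ennreal (1 + \<delta>) * ennreal c)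
      \<longlonglongrightarrow> ennreal (1 + 1 / \<delta>) * 0 + ennreal (1 + \<delta>) * ennreal c"
    by (intro tendsto_add ennreal_tendsto_cmult lim tendsto_const) simp
  then have "limsup (\<lambda>l. ennreal (1 + 1 / \<delta>) * mean_square P (\<lambda>\<omega>. A l \<omega> - B \<omega>) + ennreal (1 + \<delta>) * ennreal c)
      = ennreal (1 + \<delta>) * ennreal c"
    by (subst lim_imp_Limsup) auto
  then have "limsup (\<lambda>l. mean_square P (\<lambda>\<omega>. A l \<omega> - C \<omega>)) \<le> ennreal (1 + \<delta>) * ennreal c"
    using Limsup_mono[of "\<lambda>l. mean_square P (\<lambda>\<omega>. A l \<omega> - C \<omega>)" _ sequentially] le by (metis (no_types, lifting) always_eventually)
  also have "\<dots> \<le> ennreal (c + e)"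
  proof -
    have "\<delta> * c \<le> e" using e c by (simp add: \<delta>_def field_simps)
    then have "(1 + \<delta>) * c \<le> c + e" by (simp add: distrib_right)
    moreover have "ennreal (1 + \<delta>) * ennreal c = ennreal ((1 + \<delta>) * c)"
      using \<delta> by (intro ennreal_mult'[symmetric]) simp
    ultimately show ?thesis by (simp only: ennreal_leI)
  qed
  also have "\<dots> = mean_square P (\<lambda>\<omega>. B \<omega> - C \<omega>) + ennreal e" using c e by (simp add: ennreal_plus)
  finally show "limsup (\<lambda>l. mean_square P (\<lambda>\<omega>. A l \<omega> - C \<omega>)) \<le> mean_square P (\<lambda>\<omega>. B \<omega> - C \<omega>) + ennreal e" .
qed

theorem proposition2p2:
  fixes P :: "'w measure"
    and X :: "'w \<Rightarrow> real^'d::finite" and Y :: "'w \<Rightarrow> real"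
    and Z :: "nat \<Rightarrow> 'w \<Rightarrow> (real^'d) \<times> real"
    and k :: nat
    and r :: "'d dataset \<Rightarrow> real^'d \<Rightarrow> real^'m::finite"
    and \<epsilon> :: "nat \<Rightarrow> real"
    and rstar :: "real^'d \<Rightarrow> real"
    and T :: "'d dataset \<Rightarrow> real^'m \<Rightarrow> real"
  assumes "prob_space P"
    and "X \<in> borel_measurable P" and "Y \<in> borel_measurable P"
    and "mean_square P Y < \<infinity>"
    and sample_indep: "prob_space.indep_vars P (\<lambda>_. borel)
                         (case_option (\<lambda>\<omega>. (X \<omega>, Y \<omega>)) Z) UNIV"
    and sample_distr: "\<And>i. distr P borel (Z i) = distr P borel (\<lambda>\<omega>. (X \<omega>, Y \<omega>))"
    and rstar: "cond_mean_version P Y borel X rstar"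
    and machines_measurable: "(\<lambda>(D, x). r D x) \<in> borel_measurable (data_space k \<Otimes>\<^sub>M borel)"
    and machines_square: "\<And>m. mean_square P (\<lambda>\<omega>. r (first_part k Z \<omega>) (X \<omega>) $ m) < \<infinity>"
    and upper_sets: "\<And>D m. D \<in> space (data_space k) \<Longrightarrow>
          antimono (\<lambda>t::real. (\<lambda>x. r D x $ m) -` {t<..}) \<and>
          (\<Inter>t::real. (\<lambda>x. r D x $ m) -` {t<..}) = {}"
    and lower_sets: "\<And>D m. D \<in> space (data_space k) \<Longrightarrow>
          mono (\<lambda>t::real. (\<lambda>x. r D x $ m) -` {..<t}) \<and>
          (\<Inter>t::real. (\<lambda>x. r D x $ m) -` {..<t}) = {}"
    and T: "cond_mean_version P Y (data_space k \<Otimes>\<^sub>M borel)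
              (\<lambda>\<omega>. (first_part k Z \<omega>, r (first_part k Z \<omega>) (X \<omega>))) (\<lambda>(D, u). T D u)"
    and "\<And>l. l \<ge> 1 \<Longrightarrow> \<epsilon> l > 0"
    and "\<epsilon> \<longlonglongrightarrow> 0"
    and "filterlim (\<lambda>l. real l * \<epsilon> l ^ CARD('m)) at_top sequentially"
  shows
    "((\<lambda>l. mean_square P (\<lambda>\<omega>.
         combined_estimator (r (first_part k Z \<omega>)) (\<epsilon> l) l (second_part k Z \<omega>) (X \<omega>)
         - T (first_part k Z \<omega>) (r (first_part k Z \<omega>) (X \<omega>)))) \<longlonglongrightarrow> 0)
   \<and> limsup (\<lambda>l. mean_square P (\<lambda>\<omega>.
         combined_estimator (r (first_part k Z \<omega>)) (\<epsilon> l) l (second_part k Z \<omega>) (X \<omega>)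
         - rstar (X \<omega>)))
     \<le> (INF f \<in> {f \<in> borel_measurable borel.
                   mean_square P (\<lambda>\<omega>. f (r (first_part k Z \<omega>) (X \<omega>))) < \<infinity>}.
           mean_square P (\<lambda>\<omega>. f (r (first_part k Z \<omega>) (X \<omega>)) - rstar (X \<omega>)))
   \<and> limsup (\<lambda>l. mean_square P (\<lambda>\<omega>.
         combined_estimator (r (first_part k Z \<omega>)) (\<epsilon> l) l (second_part k Z \<omega>) (X \<omega>)
         - rstar (X \<omega>)))
     \<le> (MIN m. mean_square P (\<lambda>\<omega>. r (first_part k Z \<omega>) (X \<omega>) $ m - rstar (X \<omega>)))"
proof -
  interpret prob_space P by fact
  interpret aggregation P X Y Z k r rstar T
  proof unfold_locales
    show "integrable P (\<lambda>\<omega>. (Y \<omega>)\<^sup>2)"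
      using \<open>mean_square P Y < \<infinity>\<close> mean_square_finite_iff[OF \<open>Y \<in> borel_measurable P\<close>] by blast
  qed fact+
  have consistent: "(\<lambda>l. mean_square P (\<lambda>\<omega>. combined (\<epsilon> l) l \<omega> - target \<omega>)) \<longlonglongrightarrow> 0"
    by (rule combined_consistent) fact+
  \<comment> \<open>Comparison with the zero function, whose error is the second moment of \<open>rstar X\<close>.\<close>
  have f0: "mean_square P (\<lambda>\<omega>. target \<omega> - rstar (X \<omega>)) < \<infinity>"
  proof -
    have "mean_square P (\<lambda>\<omega>. target \<omega> - rstar (X \<omega>)) \<le> mean_square P (\<lambda>\<omega>. 0 - rstar (X \<omega>))"
      using target_optimal[of "\<lambda>_. 0"] by (simp add: mean_square_def)
    also have "\<dots> < \<infinity>" using rstar_square by (subst mean_square_finite_iff) auto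
    finally show ?thesis .
  qed
  have limsup_le: "limsup (\<lambda>l. mean_square P (\<lambda>\<omega>. combined (\<epsilon> l) l \<omega> - rstar (X \<omega>)))
      \<le> mean_square P (\<lambda>\<omega>. target \<omega> - rstar (X \<omega>))"
    by (rule limsup_mean_square_le[OF _ _ _ f0 consistent]) measurable
  have bound_by: "limsup (\<lambda>l. mean_square P (\<lambda>\<omega>. combined (\<epsilon> l) l \<omega> - rstar (X \<omega>)))
      \<le> mean_square P (\<lambda>\<omega>. f (r (F \<omega>) (X \<omega>)) - rstar (X \<omega>))"
    if "f \<in> borel_measurable borel" "mean_square P (\<lambda>\<omega>. f (r (F \<omega>) (X \<omega>))) < \<infinity>" for f
    using limsup_le target_optimal[OF that] by (rule order_trans)
  have coord: "(\<lambda>u::real^'m. u $ m) \<in> borel_measurable borel" for m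
    by (intro borel_measurable_component) simp
  show ?thesis
  proof (intro conjI)
    show "limsup (\<lambda>l. mean_square P (\<lambda>\<omega>. combined (\<epsilon> l) l \<omega> - rstar (X \<omega>)))
        \<le> (MIN m. mean_square P (\<lambda>\<omega>. r (F \<omega>) (X \<omega>) $ m - rstar (X \<omega>)))"
      using bound_by[OF coord] machines_square by (intro Min.boundedI) auto
  qed (use consistent bound_by in \<open>auto intro!: INF_greatest\<close>)
qed

end
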